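(* Let $\Omega \subset \mathbb{R}^n$ be an open set, let $k \in \mathbb{N}$ with $k > 1$, and let $1 \leq p < \infty$ be such that $(k-1)p < n$. Suppose $f \in W^{k,p}_{\mathrm{loc}}(\Omega)$, and let $f^*$ be the precise representative of $f$. Then there exists a sequence of closed sets $\{C_l\}_{l=1}^{\infty}$ in $\mathbb{R}^n$ such that for every $l = 1, 2, \dots$ we have $C_l \subset C_{l+1} \subset \Omega$, and the restriction $f^*|_{C_l}$ is Lipschitz continuous $R_{k-1,p}$-almost everywhere in $C_l$ (that is, there is a set $\Theta_l\subset C_l$ with $R_{k-1,p}(\Theta_l)=0$ such that $f^*$ is Lipschitz continuous on $C_l\setminus\Theta_l$), and $$R_{k-1,p}\left(\Omega\setminus\bigcup_{l=1}^{\infty}C_l\right)=0.$$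
   Context: Sobolev spaces: for $U\subset\mathbb{R}^n$ open, $W^{k,p}(U)$ is the space of $f\in L^p(U)$ whose weak derivatives $D^\alpha f$ belong to $L^p(U)$ for all multi-indices $|\alpha|\le k$. $W^{k,p}_{\mathrm{loc}}(\Omega)$ is the space of $f\in L^1_{\mathrm{loc}}(\Omega)$ such that $f\in W^{k,p}(U)$ for every bounded open $U$ with $\overline{U}\subset\Omega$. Functions are real-valued. Precise representative: for $f\in L^1_{\mathrm{loc}}(\Omega)$, $f^*:\Omega\to\mathbb{R}$ is defined by $f^*(x)=\lim_{\epsilon\downarrow0}\frac{1}{|B(x,\epsilon)|}\int_{B(x,\epsilon)}f(y)\,dy$ if this limit exists and is a real number, and $f^*(x)=0$ otherwise. Riesz capacity: for $\alpha\in(0,\infty)$ and $p\in[1,\infty)$ with $\alpha p<n$, and any $E\subset\mathbb{R}^n$, $$R_{\alpha,p}(E)=\inf\{\|g\|_{L^p(\mathbb{R}^n)}^p : g\in L^p(\mathbb{R}^n),\ g\ge0,\ I_\alpha*g(x)\ge1 \text{ for all } x\in E\},$$ where $I_\alpha*g(x)=\frac{1}{\gamma(\alpha)}\int_{\mathbb{R}^n}\frac{g(y)}{|x-y|^{n-\alpha}}\,dy$ and $\gamma(\alpha)=\pi^{n/2}2^\alpha\frac{\Gamma(\alpha/2)}{\Gamma(n/2-\alpha/2)}$. *)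

theory Defs
  imports "HOL-Analysis.Analysis"
begin

section \<open>Multi-indices, smooth test functions and weak derivatives\<close>

text \<open>A multi-index for \<open>\<real>\<^sup>n = real ^ 'n\<close> is a function \<open>'n \<Rightarrow> nat\<close>. A function on a subset
  \<open>U\<close> is represented by a total function whose values outside \<open>U\<close> are irrelevant.\<close>

definition partial :: "'n \<Rightarrow> (real ^ 'n \<Rightarrow> real) \<Rightarrow> real ^ 'n \<Rightarrow> real" where
  "partial i \<phi> x = deriv (\<lambda>t. \<phi> (x + t *\<^sub>R axis i 1)) 0"

text \<open>An arbitrary enumeration of the coordinates, fixing the order in which the partial
  derivatives making up \<open>D\<^sup>\<alpha>\<close> are applied. The operator \<open>D\<^sup>\<alpha>\<close> is only used on smooth
  functions, where the order does not matter.\<close>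

definition coords :: "'n::finite list" where
  "coords = (SOME is. set is = UNIV \<and> distinct is)"

lemma coords: "set (coords :: 'n::finite list) = UNIV" "distinct (coords :: 'n list)"
proof -
  have "\<exists>is::'n list. set is = UNIV \<and> distinct is"
    using finite_distinct_list[of "UNIV :: 'n set"] by auto
  from someI_ex[OF this] show "set (coords :: 'n list) = UNIV" "distinct (coords :: 'n list)"
    by (simp_all add: coords_def)
qed

definition multi_partial ::
  "('n::finite \<Rightarrow> nat) \<Rightarrow> (real ^ 'n \<Rightarrow> real) \<Rightarrow> real ^ 'n \<Rightarrow> real" where
  "multi_partial \<alpha> \<phi> = foldr (\<lambda>i. partial i ^^ \<alpha> i) coords \<phi>"

definition multi_order :: "('n::finite \<Rightarrow> nat) \<Rightarrow> nat" where
  "multi_order \<alpha> = (\<Sum>i\<in>UNIV. \<alpha> i)"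

text \<open>\<open>C\<^sup>\<infinity>\<close>: all iterated partial derivatives, in every order, exist and are (totally)
  differentiable, hence continuous.\<close>

definition smooth :: "(real ^ 'n::finite \<Rightarrow> real) \<Rightarrow> bool" where
  "smooth \<phi> \<longleftrightarrow> (\<forall>is. foldr partial is \<phi> differentiable_on UNIV)"

definition test_functions :: "(real ^ 'n::finite) set \<Rightarrow> (real ^ 'n \<Rightarrow> real) set" where
  "test_functions U =
     {\<phi>. smooth \<phi> \<and> compact (closure {x. \<phi> x \<noteq> 0}) \<and> closure {x. \<phi> x \<noteq> 0} \<subseteq> U}"

definition L1_loc :: "(real ^ 'n::finite) set \<Rightarrow> (real ^ 'n \<Rightarrow> real) set" where
  "L1_loc U = {f. \<forall>K. compact K \<and> K \<subseteq> U \<longrightarrow> set_integrable lebesgue K f}"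

definition weak_derivative ::
  "(real ^ 'n::finite) set \<Rightarrow> ('n \<Rightarrow> nat) \<Rightarrow> (real ^ 'n \<Rightarrow> real) \<Rightarrow> (real ^ 'n \<Rightarrow> real) \<Rightarrow> bool" where
  "weak_derivative U \<alpha> f g \<longleftrightarrow>
     f \<in> L1_loc U \<and> g \<in> L1_loc U \<and>
     (\<forall>\<phi>\<in>test_functions U.
        (LINT x:U|lebesgue. f x * multi_partial \<alpha> \<phi> x) =
        (-1) ^ multi_order \<alpha> * (LINT x:U|lebesgue. g x * \<phi> x))"

section \<open>Sobolev spaces\<close>

definition Lp :: "real \<Rightarrow> (real ^ 'n::finite) set \<Rightarrow> (real ^ 'n \<Rightarrow> real) set" where
  "Lp p U = {f. f \<in> borel_measurable (lebesgue_on U) \<and>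
                integrable (lebesgue_on U) (\<lambda>x. \<bar>f x\<bar> powr p)}"

definition sobolev :: "nat \<Rightarrow> real \<Rightarrow> (real ^ 'n::finite) set \<Rightarrow> (real ^ 'n \<Rightarrow> real) set" where
  "sobolev k p U =
     {f \<in> Lp p U. \<forall>\<alpha>. multi_order \<alpha> \<le> k \<longrightarrow> (\<exists>g \<in> Lp p U. weak_derivative U \<alpha> f g)}"

definition sobolev_loc :: "nat \<Rightarrow> real \<Rightarrow> (real ^ 'n::finite) set \<Rightarrow> (real ^ 'n \<Rightarrow> real) set" where
  "sobolev_loc k p \<Omega> =
     {f \<in> L1_loc \<Omega>. \<forall>U. open U \<and> bounded U \<and> closure U \<subseteq> \<Omega> \<longrightarrow> f \<in> sobolev k p U}"

section \<open>Precise representative\<close>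

definition ball_average :: "(real ^ 'n::finite \<Rightarrow> real) \<Rightarrow> real ^ 'n \<Rightarrow> real \<Rightarrow> real" where
  "ball_average f x \<epsilon> = (LINT y:ball x \<epsilon>|lebesgue. f y) / measure lebesgue (ball x \<epsilon>)"

text \<open>For \<open>x\<close> in an open set \<open>\<Omega>\<close> the value depends only on \<open>f\<close> restricted to \<open>\<Omega>\<close>, since small
  balls around \<open>x\<close> lie in \<open>\<Omega>\<close>; the values outside \<open>\<Omega>\<close> carry no meaning.\<close>

definition precise_rep :: "(real ^ 'n::finite \<Rightarrow> real) \<Rightarrow> real ^ 'n \<Rightarrow> real" where
  "precise_rep f x =
     (if \<exists>L. (ball_average f x \<longlongrightarrow> L) (at_right 0) then Lim (at_right 0) (ball_average f x) else 0)"

section \<open>Riesz capacity\<close>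

definition riesz_gamma :: "'n::finite itself \<Rightarrow> real \<Rightarrow> real" where
  "riesz_gamma _ \<alpha> =
     pi powr (real CARD('n) / 2) * 2 powr \<alpha> * Gamma (\<alpha> / 2) / Gamma (real CARD('n) / 2 - \<alpha> / 2)"

text \<open>The potential of a nonnegative \<open>g\<close>, with values in \<open>[0, \<infinity>]\<close>. The kernel at \<open>y = x\<close>, which
  is \<open>0\<close> here by the convention on division, concerns only a null set.\<close>

definition riesz_potential ::
  "real \<Rightarrow> (real ^ 'n::finite \<Rightarrow> real) \<Rightarrow> real ^ 'n \<Rightarrow> ennreal" where
  "riesz_potential \<alpha> g x =
     ennreal (1 / riesz_gamma TYPE('n) \<alpha>) *
     (\<integral>\<^sup>+ y. ennreal (g y / norm (x - y) powr (real CARD('n) - \<alpha>)) \<partial>lebesgue)"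

text \<open>Meant for \<open>\<alpha> > 0\<close>, \<open>p \<ge> 1\<close>, \<open>\<alpha> * p < n\<close>. If no \<open>g\<close> is admissible, the infimum is \<open>\<infinity>\<close>.\<close>

definition riesz_capacity :: "real \<Rightarrow> real \<Rightarrow> (real ^ 'n::finite) set \<Rightarrow> ennreal" where
  "riesz_capacity \<alpha> p E =
     Inf {ennreal (LINT y|lebesgue. \<bar>g y\<bar> powr p) | g.
            g \<in> Lp p UNIV \<and> (\<forall>y. 0 \<le> g y) \<and> (\<forall>x\<in>E. 1 \<le> riesz_potential \<alpha> g x)}"

end

theory Submission
  imports Defs
begin

text \<open>Write \<open>k = m + 1\<close> and let \<open>G\<close> be the Riesz potential of order \<open>m\<close> of
  \<open>g = \<Sum>\<^bsub>|\<beta>| \<le> k\<^esub> |D\<^sup>\<beta> f| 1\<^sub>U \<in> L\<^sup>p\<close>, where \<open>U\<close> is a bounded neighbourhood of a compact set in \<open>\<Omega>\<close>.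
  Averaging the order \<open>m\<close> Taylor formula with integral remainder over all directions bounds the
  gradient of the mollifications of \<open>f\<close> by a constant times \<open>G\<close>; no polar coordinates are needed, since
  the averages are taken over balls. Averages of \<open>G\<close> over balls centred at \<open>x\<close> are at most \<open>C G(x)\<close>,
  so \<open>f\<close> oscillates around some value on balls \<open>B(x, \<rho>)\<close> by at most \<open>C \<rho> G(x)\<close>. Where \<open>G(x)\<close> is finite,
  this value is \<open>f\<^sup>*(x)\<close>, and comparing two nearby points on a common ball shows that \<open>f\<^sup>*\<close> is Lipschitz
  on \<open>{G \<le> t}\<close>, which is closed because \<open>G\<close> is lower semicontinuous. The set \<open>C\<^sub>l\<close> is the union of the
  sets \<open>{G \<le> l}\<close> for the first members of a compact exhaustion of \<open>\<Omega>\<close>; what is left lies in the countable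
  union of the sets \<open>{G = \<infinity>}\<close>, which has capacity zero directly from the definition. The exceptional
  sets \<open>\<Theta>\<close> can be taken empty.\<close>

section \<open>Riesz kernels\<close>

text \<open>The order is k - 1 because a Lipschitz bound asks for the gradient: expanding a first
  derivative by m = k - 1 further derivatives stops exactly at order k. The remainder weight s^(m-1)
  becomes the kernel |x - y|^(m-n), because a ball of directions scaled to radius s carries the
  factor s^(-n), and s^(m-1-n) integrated over s > |x - y| gives |x - y|^(m-n) / (n - m). No cutoff
  function is used, so the expansion leaves boundary terms at a fixed distance r; they are what
  brings derivatives of order below k into g. The obstacle is that f has neither pointwise values
  nor pointwise derivatives, while a null set may have positive capacity, so that almost-everywhere
  statements are too weak. All pointwise estimates are therefore made at every point for
  mollifications, with constants that do not depend on the mollification parameter, and only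
  integrals over balls are passed to the limit.\<close>

text \<open>At \<open>z = 0\<close> the value is \<open>0\<close> instead of \<open>\<infinity>\<close>, hence the hypothesis \<open>a \<noteq> b\<close> and the
  almost-everywhere arguments below.\<close>

definition kern :: "real \<Rightarrow> 'a::euclidean_space \<Rightarrow> real" where
  "kern \<gamma> z = 1 / norm z powr \<gamma>"

lemma kern_nonneg [simp]: "0 \<le> kern \<gamma> z"
  by (simp add: kern_def)

lemma kern_measurable [measurable]: "kern \<gamma> \<in> borel_measurable borel"
  unfolding kern_def by measurable

lemma kern_minus_commute: "kern \<gamma> (x - y) = kern \<gamma> (y - x)"
  by (simp add: kern_def norm_minus_commute)

lemma nn_integral_lborel_affine:
  fixes h :: "'a::euclidean_space \<Rightarrow> ennreal"
  assumes [measurable]: "h \<in> borel_measurable borel" and c: "c > 0"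
  shows "(\<integral>\<^sup>+z. h z \<partial>lborel) = ennreal (c ^ DIM('a)) * (\<integral>\<^sup>+z. h (t + c *\<^sub>R z) \<partial>lborel)"
proof -
  have "(\<integral>\<^sup>+z. h z \<partial>lborel) = (\<integral>\<^sup>+z. h z \<partial>density (distr lborel borel (\<lambda>x. t + c *\<^sub>R x)) (\<lambda>_. \<bar>c\<bar> ^ DIM('a)))"
    using lborel_affine[of c t] c by simp
  also have "\<dots> = (\<integral>\<^sup>+z. ennreal (c ^ DIM('a)) * h (t + c *\<^sub>R z) \<partial>lborel)"
    using c by (simp add: nn_integral_density nn_integral_distr)
  also have "\<dots> = ennreal (c ^ DIM('a)) * (\<integral>\<^sup>+z. h (t + c *\<^sub>R z) \<partial>lborel)"
    by (rule nn_integral_cmult) simp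
  finally show ?thesis .
qed

lemma nn_integral_ball_affine:
  fixes h :: "'a::euclidean_space \<Rightarrow> ennreal"
  assumes [measurable]: "h \<in> borel_measurable borel" and c: "c > 0"
  shows "(\<integral>\<^sup>+z\<in>ball x c. h z \<partial>lborel) = ennreal (c ^ DIM('a)) * (\<integral>\<^sup>+e\<in>ball 0 1. h (x + c *\<^sub>R e) \<partial>lborel)"
proof -
  have "indicator (ball x c) (x + c *\<^sub>R e) = (indicator (ball 0 1) e :: ennreal)" for e
    using c by (auto simp: indicator_def dist_norm)
  moreover have [measurable]: "ball x c \<in> sets borel" by simp
  ultimately show ?thesis
    using c by (subst nn_integral_lborel_affine[of _ c x]) simp_all
qed

lemma sets_lborel_pair:
  "sets (lborel \<Otimes>\<^sub>M lborel) = sets (borel :: ('a::euclidean_space \<times> 'b::euclidean_space) measure)"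
  by (simp only: lborel_prod sets_lborel)

text \<open>|z|^(-\<gamma>) is the integral of \<gamma> s^(-\<gamma>-1) over s >= |z|. The kernel is
  thus a superposition of indicators of balls, and integrals against it reduce to integrals over
  balls.\<close>

lemma kern_layer_cake:
  fixes z :: "'a::euclidean_space"
  assumes "z \<noteq> 0" "\<gamma> > 0"
  shows "ennreal (kern \<gamma> z) =
    (\<integral>\<^sup>+s. ennreal (\<gamma> * s powr (- \<gamma> - 1)) * indicator {norm z..} s \<partial>lborel)"
proof -
  have "((\<lambda>s. \<gamma> * s powr (- \<gamma> - 1)) has_integral \<gamma> * (- (norm z powr (- \<gamma> - 1 + 1)) / (- \<gamma> - 1 + 1))) {norm z..}"
    using assms by (intro has_integral_mult_right has_integral_powr_to_inf) auto
  from nn_integral_has_integral_lebesgue'[OF _ this] assms show ?thesis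
    by (simp add: kern_def powr_minus divide_inverse)
qed

text \<open>The kernel is a Muckenhoupt \<open>A\<^sub>1\<close> weight. Averages of Riesz potentials are therefore controlled
  pointwise by the potentials themselves, which replaces the maximal function theorem and also covers
  \<open>p = 1\<close>.\<close>

lemma kern_average:
  assumes "0 < \<gamma>" "\<gamma> < real DIM('a::euclidean_space)"
  obtains C where "C > 0"
    "\<And>(a::'a) b s. s > 0 \<Longrightarrow> a \<noteq> b \<Longrightarrow>
      (\<integral>\<^sup>+z\<in>ball a s. ennreal (kern \<gamma> (b - z)) \<partial>lborel) \<le> ennreal (C * s ^ DIM('a) * kern \<gamma> (b - a))"
proof -
  let ?n = "DIM('a)"
  define \<omega> where "\<omega> = unit_ball_vol (real ?n)"
  have \<omega>: "\<omega> > 0" unfolding \<omega>_def by simp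
  \<comment> \<open>The summand \<gamma> / (n - \<gamma>) comes from radii \<tau> < d/2 and the
    summand 1 from \<tau> >= d/2, where d = |b - a|; both parts scale like (d/2)^(-\<gamma>), hence
    \<open>2 powr \<gamma>\<close>.\<close>
  define C where "C = \<omega> * 2 powr \<gamma> * (\<gamma> / (?n - \<gamma>) + 1)"
  have "C > 0" unfolding C_def using \<omega> assms by (intro mult_pos_pos add_pos_pos divide_pos_pos) auto
  moreover have "(\<integral>\<^sup>+z\<in>ball a s. ennreal (kern \<gamma> (b - z)) \<partial>lborel) \<le> ennreal (C * s ^ ?n * kern \<gamma> (b - a))"
    if s: "s > 0" and ab: "a \<noteq> b" for a b :: 'a and s
  proof -
    define d where "d = norm (b - a)"
    have d: "d > 0" using ab by (simp add: d_def)
    define w where "w \<tau> = \<gamma> * \<tau> powr (- \<gamma> - 1)" for \<tau> :: real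
    have [measurable]: "w \<in> borel_measurable borel" unfolding w_def by measurable
    have [measurable]: "ball a s \<in> sets borel" by simp
    have w0: "w \<tau> \<ge> 0" for \<tau> using assms by (simp add: w_def)
    have "(\<integral>\<^sup>+z\<in>ball a s. ennreal (kern \<gamma> (b - z)) \<partial>lborel) =
        (\<integral>\<^sup>+z. (\<integral>\<^sup>+\<tau>. ennreal (w \<tau>) * indicator {norm (b - z)..} \<tau> * indicator (ball a s) z \<partial>lborel) \<partial>lborel)"
    proof (rule nn_integral_cong_AE)
      have "AE z in lborel. z \<noteq> b" by (rule AE_lborel_singleton)
      then show "AE z in lborel. ennreal (kern \<gamma> (b - z)) * indicator (ball a s) z =
          (\<integral>\<^sup>+\<tau>. ennreal (w \<tau>) * indicator {norm (b - z)..} \<tau> * indicator (ball a s) z \<partial>lborel)"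
      proof eventually_elim
        case (elim z)
        then show ?case using kern_layer_cake[of "b - z" \<gamma>] assms
          by (subst nn_integral_multc) (auto simp: w_def)
      qed
    qed
    also have "\<dots> = (\<integral>\<^sup>+\<tau>. (\<integral>\<^sup>+z. ennreal (w \<tau>) * indicator {norm (b - z)..} \<tau> * indicator (ball a s) z \<partial>lborel) \<partial>lborel)"
    proof (rule lborel_pair.Fubini')
      have "closed {p :: real \<times> 'a. norm (b - snd p) \<le> fst p}"
        by (intro closed_Collect_le continuous_intros)
      then have [measurable]: "{p :: real \<times> 'a. norm (b - snd p) \<le> fst p} \<in> sets (lborel \<Otimes>\<^sub>M lborel)"
        by (simp only: sets_lborel_pair borel_closed)
      have eq: "(\<lambda>(\<tau>, z). ennreal (w \<tau>) * indicator {norm (b - z)..} \<tau> * indicator (ball a s) z) =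
         (\<lambda>p. ennreal (w (fst p)) * indicator {p. norm (b - snd p) \<le> fst p} p * indicator (ball a s) (snd p))"
        by (auto simp: fun_eq_iff indicator_def)
      show "(\<lambda>(\<tau>, z). ennreal (w \<tau>) * indicator {norm (b - z)..} \<tau> * indicator (ball a s) z) \<in>
         borel_measurable (lborel \<Otimes>\<^sub>M lborel)"
        unfolding eq by measurable
    qed
    also have "\<dots> = (\<integral>\<^sup>+\<tau>. ennreal (w \<tau>) * emeasure lborel (ball a s \<inter> cball b \<tau>) \<partial>lborel)"
    proof (intro nn_integral_cong)
      fix \<tau> :: real
      have "(\<integral>\<^sup>+z. ennreal (w \<tau>) * indicator {norm (b - z)..} \<tau> * indicator (ball a s) z \<partial>lborel) =
         (\<integral>\<^sup>+z. ennreal (w \<tau>) * indicator (ball a s \<inter> cball b \<tau>) z \<partial>lborel)"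
        by (intro nn_integral_cong) (auto simp: indicator_def dist_norm)
      then show "(\<integral>\<^sup>+z. ennreal (w \<tau>) * indicator {norm (b - z)..} \<tau> * indicator (ball a s) z \<partial>lborel) =
         ennreal (w \<tau>) * emeasure lborel (ball a s \<inter> cball b \<tau>)"
        by (simp add: nn_integral_cmult_indicator sets.Int)
    qed
    \<comment> \<open>Split at \<tau> = d/2. A ball of radius \<tau> < d/2 around b meets
      \<open>ball a s\<close> only if s > d/2, and then its volume may be enlarged by the factor
      (2s/d)^n >= 1. For larger \<tau> the volume of \<open>ball a s\<close> is a sufficient bound.
      The first piece is integrable at 0 since \<gamma> < n, the second at infinity since \<gamma> >
      0.\<close>
    also have "\<dots> \<le> (\<integral>\<^sup>+\<tau>. ennreal (\<omega> * s ^ ?n * (2 / d) ^ ?n * \<gamma> * \<tau> powr (?n - \<gamma> - 1)) * indicator {0..d/2} \<tau>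
        + ennreal (\<omega> * s ^ ?n) * (ennreal (\<gamma> * \<tau> powr (- \<gamma> - 1)) * indicator {d/2..} \<tau>) \<partial>lborel)"
    proof (rule nn_integral_mono)
      fix \<tau> :: real
      let ?e = "emeasure lborel (ball a s \<inter> cball b \<tau>)"
      consider "\<tau> \<le> 0" | "\<tau> > 0" "\<tau> < d / 2" | "\<tau> \<ge> d / 2" using d by linarith
      then show "ennreal (w \<tau>) * ?e \<le> ennreal (\<omega> * s ^ ?n * (2 / d) ^ ?n * \<gamma> * \<tau> powr (?n - \<gamma> - 1)) * indicator {0..d/2} \<tau>
        + ennreal (\<omega> * s ^ ?n) * (ennreal (\<gamma> * \<tau> powr (- \<gamma> - 1)) * indicator {d/2..} \<tau>)"
      proof cases
        case 1
        have "?e \<le> emeasure lborel (cball b \<tau>)" by (intro emeasure_mono) auto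
        also have "\<dots> = 0" using 1 by (cases "\<tau> = 0") auto
        finally show ?thesis by simp
      next
        case 2
        have "?e \<le> ennreal (\<omega> * \<tau> ^ ?n * (s * 2 / d) ^ ?n)"
        proof (cases "s > d / 2")
          case True
          then have "1 \<le> (s * 2 / d) ^ ?n" using d by (intro one_le_power) (auto simp: field_simps)
          have "?e \<le> emeasure lborel (cball b \<tau>)" by (intro emeasure_mono) auto
          also have "\<dots> = ennreal (\<omega> * \<tau> ^ ?n)" using 2 by (simp add: emeasure_cball \<omega>_def)
          also have "\<dots> \<le> ennreal (\<omega> * \<tau> ^ ?n * (s * 2 / d) ^ ?n)"
            using mult_left_mono[OF \<open>1 \<le> (s * 2 / d) ^ ?n\<close>, of "\<omega> * \<tau> ^ ?n"] \<omega> 2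
            by (intro ennreal_leI) simp
          finally show ?thesis .
        next
          case False
          have "ball a s \<inter> cball b \<tau> = {}"
          proof (safe, simp)
            fix z assume "dist a z < s" "dist b z \<le> \<tau>"
            then show False using False 2 dist_triangle2[of b a z]
              by (simp add: d_def dist_norm)
          qed
          then show ?thesis by simp
        qed
        then have "ennreal (w \<tau>) * ?e \<le> ennreal (w \<tau>) * ennreal (\<omega> * \<tau> ^ ?n * (s * 2 / d) ^ ?n)"
          by (intro mult_left_mono) auto
        also have "\<dots> = ennreal (w \<tau> * (\<omega> * \<tau> ^ ?n * (s * 2 / d) ^ ?n))"
          using w0 by (simp add: ennreal_mult')
        also have "w \<tau> * (\<omega> * \<tau> ^ ?n * (s * 2 / d) ^ ?n) = \<omega> * s ^ ?n * (2 / d) ^ ?n * \<gamma> * \<tau> powr (?n - \<gamma> - 1)"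
          using 2 by (simp add: w_def powr_diff powr_minus powr_add powr_realpow power_mult_distrib power_divide field_simps)
        finally show ?thesis using 2 by (simp add: add_increasing2)
      next
        case 3
        have "?e \<le> emeasure lborel (ball a s)" by (intro emeasure_mono) auto
        also have "\<dots> = ennreal (\<omega> * s ^ ?n)" using s by (simp add: emeasure_ball \<omega>_def)
        finally have "ennreal (w \<tau>) * ?e \<le> ennreal (w \<tau>) * ennreal (\<omega> * s ^ ?n)"
          by (intro mult_left_mono) auto
        then show ?thesis using 3 by (simp add: w_def mult.commute add_increasing)
      qed
    qed
    also have "\<dots> = (\<integral>\<^sup>+\<tau>. ennreal (\<omega> * s ^ ?n * (2 / d) ^ ?n * \<gamma> * \<tau> powr (?n - \<gamma> - 1)) * indicator {0..d/2} \<tau> \<partial>lborel)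
        + ennreal (\<omega> * s ^ ?n) * (\<integral>\<^sup>+\<tau>. ennreal (\<gamma> * \<tau> powr (- \<gamma> - 1)) * indicator {d/2..} \<tau> \<partial>lborel)"
      by (subst nn_integral_add) (auto simp: nn_integral_cmult)
    also have "(\<integral>\<^sup>+\<tau>. ennreal (\<omega> * s ^ ?n * (2 / d) ^ ?n * \<gamma> * \<tau> powr (?n - \<gamma> - 1)) * indicator {0..d/2} \<tau> \<partial>lborel)
        = ennreal (\<omega> * s ^ ?n * (2 / d) ^ ?n * \<gamma> * ((d / 2) powr (?n - \<gamma> - 1 + 1) / (?n - \<gamma> - 1 + 1)))"
      using assms d \<omega> s
      by (intro nn_integral_has_integral_lebesgue' has_integral_mult_right has_integral_powr_from_0) auto
    also have "(\<integral>\<^sup>+\<tau>. ennreal (\<gamma> * \<tau> powr (- \<gamma> - 1)) * indicator {d/2..} \<tau> \<partial>lborel)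
        = ennreal (\<gamma> * (- ((d / 2) powr (- \<gamma> - 1 + 1)) / (- \<gamma> - 1 + 1)))"
      using assms d
      by (intro nn_integral_has_integral_lebesgue' has_integral_mult_right has_integral_powr_to_inf) auto
    also have "ennreal (\<omega> * s ^ ?n * (2 / d) ^ ?n * \<gamma> * ((d / 2) powr (?n - \<gamma> - 1 + 1) / (?n - \<gamma> - 1 + 1)))
       + ennreal (\<omega> * s ^ ?n) * ennreal (\<gamma> * (- ((d / 2) powr (- \<gamma> - 1 + 1)) / (- \<gamma> - 1 + 1)))
       = ennreal (\<omega> * s ^ ?n * (2 / d) ^ ?n * \<gamma> * ((d / 2) powr (?n - \<gamma> - 1 + 1) / (?n - \<gamma> - 1 + 1))
       + (\<omega> * s ^ ?n) * (\<gamma> * (- ((d / 2) powr (- \<gamma> - 1 + 1)) / (- \<gamma> - 1 + 1))))"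
      using assms d \<omega> s by (subst ennreal_mult[symmetric], simp, simp, subst ennreal_plus[symmetric]) auto
    also have "\<omega> * s ^ ?n * (2 / d) ^ ?n * \<gamma> * ((d / 2) powr (?n - \<gamma> - 1 + 1) / (?n - \<gamma> - 1 + 1))
       + (\<omega> * s ^ ?n) * (\<gamma> * (- ((d / 2) powr (- \<gamma> - 1 + 1)) / (- \<gamma> - 1 + 1))) = C * s ^ ?n * kern \<gamma> (b - a)"
    proof -
      have 1: "(d / 2) powr (?n - \<gamma>) = (d / 2) ^ ?n * (2 powr \<gamma> / d powr \<gamma>)"
        using d by (simp add: powr_diff powr_realpow powr_divide power_divide)
      have 2: "(d / 2) powr (- \<gamma>) = 2 powr \<gamma> / d powr \<gamma>"
        using d by (simp add: powr_minus powr_divide)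
      have 3: "(2 / d) ^ ?n * (d / 2) ^ ?n = 1"
        using d by (simp flip: power_mult_distrib)
      have "\<omega> * s ^ ?n * (2 / d) ^ ?n * \<gamma> * ((d / 2) powr (?n - \<gamma> - 1 + 1) / (?n - \<gamma> - 1 + 1))
        = \<omega> * s ^ ?n * \<gamma> * ((2 / d) ^ ?n * (d / 2) ^ ?n) * (2 powr \<gamma> / d powr \<gamma>) / (?n - \<gamma>)"
        using 1 by simp
      moreover have "(\<omega> * s ^ ?n) * (\<gamma> * (- ((d / 2) powr (- \<gamma> - 1 + 1)) / (- \<gamma> - 1 + 1)))
        = \<omega> * s ^ ?n * (2 powr \<gamma> / d powr \<gamma>)"
        using 2 assms by simp
      moreover have "\<omega> * s ^ ?n * \<gamma> * 1 * X / (?n - \<gamma>) + \<omega> * s ^ ?n * X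
        = \<omega> * (\<gamma> / (?n - \<gamma>) + 1) * s ^ ?n * X" for X
        using assms by (simp add: field_simps)
      ultimately have "\<omega> * s ^ ?n * (2 / d) ^ ?n * \<gamma> * ((d / 2) powr (?n - \<gamma> - 1 + 1) / (?n - \<gamma> - 1 + 1))
          + (\<omega> * s ^ ?n) * (\<gamma> * (- ((d / 2) powr (- \<gamma> - 1 + 1)) / (- \<gamma> - 1 + 1)))
        = \<omega> * (\<gamma> / (?n - \<gamma>) + 1) * s ^ ?n * (2 powr \<gamma> / d powr \<gamma>)"
        by (simp only: 3)
      then show ?thesis
        by (rule trans) (simp add: C_def kern_def d_def)
    qed
    finally show ?thesis .
  qed
  ultimately show thesis using that by blast
qed

section \<open>A smooth mollifier\<close>

text \<open>Differentiating t^(-q) exp(-1/t) only produces terms of the same kind with larger q;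
  keeping q as a parameter closes the family under derivatives, up to linear combinations.\<close>

definition exp_inv :: "nat \<Rightarrow> real \<Rightarrow> real" where
  "exp_inv q t = (if t > 0 then (1 / t) ^ q * exp (- 1 / t) else 0)"

lemma exp_inv_tendsto_0: "(exp_inv q \<longlongrightarrow> 0) (at 0)"
proof -
  have "((\<lambda>t. inverse t ^ q / exp (inverse t)) \<longlongrightarrow> 0) (at_right (0::real))"
    by (rule filterlim_compose[OF tendsto_power_div_exp_0 filterlim_inverse_at_top_right])
  moreover have "eventually (\<lambda>t. inverse t ^ q / exp (inverse t) = exp_inv q t) (at_right (0::real))"
    by (auto simp: eventually_at_right_field exp_inv_def exp_minus field_simps intro!: exI[of _ 1])
  ultimately have "(exp_inv q \<longlongrightarrow> 0) (at_right 0)"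
    by (rule Lim_transform_eventually)
  moreover have "(exp_inv q \<longlongrightarrow> 0) (at_left 0)"
    by (rule Lim_transform_eventually[OF tendsto_const])
      (auto simp: eventually_at_left_field exp_inv_def intro!: exI[of _ "-1"])
  ultimately show ?thesis
    by (simp add: filterlim_split_at)
qed

lemma exp_inv_has_derivative:
  "(exp_inv q has_real_derivative exp_inv (q + 2) t - real q * exp_inv (q + 1) t) (at t)"
proof -
  consider "t > 0" | "t < 0" | "t = 0" by linarith
  then show ?thesis
  proof cases
    case 1
    have u: "((\<lambda>t. 1 / t) has_real_derivative - ((1 / t) ^ 2)) (at t)"
      using 1 by (auto intro!: derivative_eq_intros simp: power2_eq_square)
    have "((\<lambda>t. (1 / t) ^ q) has_real_derivative real q * - ((1 / t) ^ (q + 1))) (at t)"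
    proof (cases q)
      case (Suc n)
      then show ?thesis using DERIV_power_Suc[OF u, of n] by (simp add: algebra_simps power2_eq_square)
    qed simp
    moreover have "((\<lambda>t. exp (- (1 / t))) has_real_derivative exp (- (1 / t)) * - (- ((1 / t) ^ 2))) (at t)"
      by (rule DERIV_chain2[OF DERIV_exp DERIV_minus[OF u]])
    ultimately have "((\<lambda>t. (1 / t) ^ q * exp (- (1 / t))) has_real_derivative
        real q * - ((1 / t) ^ (q + 1)) * exp (- (1 / t)) + exp (- (1 / t)) * - (- ((1 / t) ^ 2)) * (1 / t) ^ q) (at t)"
      by (rule DERIV_mult)
    then have "((\<lambda>t. (1 / t) ^ q * exp (- 1 / t)) has_real_derivative
        exp_inv (q + 2) t - real q * exp_inv (q + 1) t) (at t)"
      using 1 by (simp add: exp_inv_def power2_eq_square algebra_simps)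
    then show ?thesis
      by (rule has_field_derivative_transform_within_open[of _ _ _ "{0<..}"])
        (use 1 in \<open>auto simp: exp_inv_def\<close>)
  next
    case 2
    have "((\<lambda>t. 0) has_real_derivative exp_inv (q + 2) t - real q * exp_inv (q + 1) t) (at t)"
      using 2 by (simp add: exp_inv_def)
    then show ?thesis
      by (rule has_field_derivative_transform_within_open[of _ _ _ "{..<0}"])
        (use 2 in \<open>auto simp: exp_inv_def\<close>)
  next
    case 3
    \<comment> \<open>At the origin the difference quotient of \<open>exp_inv q\<close> is
      \<open>exp_inv (q + 1)\<close> itself, because \<open>exp_inv q 0 = 0\<close>; its limit 0 is
      the derivative.\<close>
    have "(\<lambda>h. (exp_inv q (0 + h) - exp_inv q 0) / h) = exp_inv (q + 1)"
      by (auto simp: fun_eq_iff exp_inv_def)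
    then show ?thesis
      using 3 exp_inv_tendsto_0[of "q + 1"] by (simp add: DERIV_def exp_inv_def)
  qed
qed

lemma exp_inv_has_derivative' [derivative_intros]:
  assumes "(g has_real_derivative g') (at t)"
  shows "((\<lambda>t. exp_inv q (g t)) has_real_derivative
     (exp_inv (q + 2) (g t) - real q * exp_inv (q + 1) (g t)) * g') (at t)"
  by (rule DERIV_chain2[OF exp_inv_has_derivative assms])

text \<open>Smoothness is obtained from a vector space of functions vanishing outside (-1, 1) that
  contains the derivative of each of its members: iterated derivatives never leave it.\<close>

inductive_set bump_space :: "(real \<Rightarrow> real) set" where
  prod: "(\<lambda>t. exp_inv a (1 + t) * exp_inv b (1 - t)) \<in> bump_space"
| lincomb: "f \<in> bump_space \<Longrightarrow> g \<in> bump_space \<Longrightarrow> (\<lambda>t. c * f t + d * g t) \<in> bump_space"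

lemma bump_space_has_derivative:
  assumes "f \<in> bump_space"
  shows "\<exists>g\<in>bump_space. \<forall>t. (f has_real_derivative g t) (at t)"
  using assms
proof induction
  case (prod a b)
  let ?p = "\<lambda>a b t. exp_inv a (1 + t) * exp_inv b (1 - t)"
  \<comment> \<open>The product rule, arranged as nested two-term combinations so that the
    introduction rules of \<open>bump_space\<close> match it syntactically. The signs in the second
    half come from the inner derivative of 1 - t.\<close>
  let ?g = "\<lambda>t. 1 * (1 * ?p (a + 2) b t + (- real a) * ?p (a + 1) b t) +
     1 * ((- 1) * ?p a (b + 2) t + real b * ?p a (b + 1) t)"
  have "?g \<in> bump_space"
    by (intro bump_space.intros)
  moreover have "(?p a b has_real_derivative ?g t) (at t)" for t
    by (auto intro!: derivative_eq_intros simp: algebra_simps)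
  ultimately show ?case by (intro bexI[of _ ?g] allI)
next
  case (lincomb f g c d)
  then obtain f' g' where "f' \<in> bump_space" "g' \<in> bump_space"
    "\<And>t. (f has_real_derivative f' t) (at t)" "\<And>t. (g has_real_derivative g' t) (at t)"
    by blast
  then show ?case
    by (intro bexI[of _ "\<lambda>t. c * f' t + d * g' t"] bump_space.lincomb)
      (auto intro!: derivative_eq_intros)
qed

lemma bump_space_deriv:
  assumes "f \<in> bump_space"
  shows "deriv f \<in> bump_space" "(f has_real_derivative deriv f t) (at t)"
proof -
  obtain g where g: "g \<in> bump_space" "\<And>t. (f has_real_derivative g t) (at t)"
    using bump_space_has_derivative[OF assms] by blast
  then have "deriv f = g" by (auto simp: fun_eq_iff intro: DERIV_imp_deriv)
  with g show "deriv f \<in> bump_space" "(f has_real_derivative deriv f t) (at t)" by auto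
qed

lemma bump_space_eq_0:
  assumes "f \<in> bump_space" "\<bar>t\<bar> \<ge> 1"
  shows "f t = 0"
  using assms by induction (auto simp: exp_inv_def)

text \<open>The j-th derivative of the classical bump exp(-2 / (1 - t^2)) on (-1, 1), extended by
  zero.\<close>

definition bump :: "nat \<Rightarrow> real \<Rightarrow> real" where
  "bump j = (deriv ^^ j) (\<lambda>t. exp_inv 0 (1 + t) * exp_inv 0 (1 - t))"

lemma bump_in_bump_space: "bump j \<in> bump_space"
  unfolding bump_def by (induction j) (auto intro: bump_space.prod bump_space_deriv)

lemma bump_has_derivative: "(bump j has_real_derivative bump (Suc j) t) (at t)"
  using bump_space_deriv(2)[OF bump_in_bump_space[of j]] by (simp add: bump_def)

lemma bump_eq_0: "\<bar>t\<bar> \<ge> 1 \<Longrightarrow> bump j t = 0"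
  by (rule bump_space_eq_0[OF bump_in_bump_space])

lemma bump_0_nonneg: "bump 0 t \<ge> 0"
  by (simp add: bump_def exp_inv_def)

lemma bump_0_pos: "bump 0 0 > 0"
  by (simp add: bump_def exp_inv_def)

lemma continuous_on_bump: "continuous_on S (bump j)"
  by (meson DERIV_isCont bump_has_derivative continuous_at_imp_continuous_on)

lemma bump_bounded: obtains B where "B > 0" "\<And>t. \<bar>bump j t\<bar> \<le> B"
proof -
  have "bounded (bump j ` {-1..1})"
    by (intro compact_imp_bounded compact_continuous_image continuous_on_bump) auto
  then obtain B where B: "B > 0" "\<And>t. t \<in> {-1..1} \<Longrightarrow> \<bar>bump j t\<bar> \<le> B"
    by (auto simp: bounded_pos)
  have "\<bar>bump j t\<bar> \<le> B" for t
  proof (cases "\<bar>t\<bar> \<ge> 1")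
    case False
    then have "t \<in> {-1..1}" by auto
    then show ?thesis by (rule B)
  qed (use B bump_eq_0[of t j] in auto)
  with B show thesis using that by blast
qed

section \<open>Multi-indices and the tensor product bump\<close>

definition inc :: "'n \<Rightarrow> ('n \<Rightarrow> nat) \<Rightarrow> 'n \<Rightarrow> nat" where
  "inc i \<alpha> = \<alpha>(i := Suc (\<alpha> i))"

lemma multi_order_inc [simp]: "multi_order (inc i \<alpha>) = Suc (multi_order \<alpha>)"
proof -
  have "multi_order (inc i \<alpha>) = (\<Sum>j\<in>UNIV. \<alpha> j + (if j = i then 1 else 0))"
    unfolding multi_order_def inc_def by (intro sum.cong) auto
  then show ?thesis by (simp add: sum.distrib multi_order_def)
qed

text \<open>The mollifier is a tensor product of one-dimensional bumps, so that \<open>D\<^sup>\<alpha>\<close> is explicit and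
  partial derivatives commute trivially.\<close>

definition tensor_bump :: "('n::finite \<Rightarrow> nat) \<Rightarrow> real ^ 'n \<Rightarrow> real" where
  "tensor_bump \<alpha> w = (\<Prod>i\<in>UNIV. bump (\<alpha> i) (w $ i))"

lemma tensor_bump_has_derivative:
  "(tensor_bump \<alpha> has_derivative (\<lambda>v. \<Sum>i\<in>UNIV. v $ i * tensor_bump (inc i \<alpha>) w)) (at w)"
proof -
  have "((\<lambda>w. bump (\<alpha> i) (w $ i)) has_derivative (\<lambda>v. v $ i * bump (Suc (\<alpha> i)) (w $ i))) (at w)" for i
    using has_derivative_compose[OF bounded_linear_imp_has_derivative[OF bounded_linear_vec_nth]
        bump_has_derivative[of "\<alpha> i" "w $ i", unfolded has_field_derivative_def]]
    by (simp add: mult.commute)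
  from has_derivative_prod[of UNIV, OF this]
  have "(tensor_bump \<alpha> has_derivative
     (\<lambda>v. \<Sum>i\<in>UNIV. v $ i * bump (Suc (\<alpha> i)) (w $ i) * (\<Prod>j\<in>UNIV - {i}. bump (\<alpha> j) (w $ j)))) (at w)"
    by (simp add: tensor_bump_def[abs_def])
  moreover have "tensor_bump (inc i \<alpha>) w = bump (Suc (\<alpha> i)) (w $ i) * (\<Prod>j\<in>UNIV - {i}. bump (\<alpha> j) (w $ j))" for i
    unfolding tensor_bump_def inc_def by (subst prod.remove[of _ i]) (auto intro!: prod.cong)
  ultimately show ?thesis by (simp add: mult.assoc)
qed

lemma continuous_on_tensor_bump: "continuous_on S (tensor_bump \<alpha>)"
  unfolding tensor_bump_def
  by (intro continuous_on_prod continuous_on_compose2[OF continuous_on_bump[of UNIV]] continuous_intros) auto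

lemma tensor_bump_measurable [measurable]: "tensor_bump \<alpha> \<in> borel_measurable borel"
  by (intro borel_measurable_continuous_onI continuous_on_tensor_bump)

lemma tensor_bump_bounded: obtains B where "B > 0" "\<And>w. \<bar>tensor_bump \<alpha> w\<bar> \<le> B"
proof -
  have "\<forall>j. \<exists>B>0. \<forall>t. \<bar>bump j t\<bar> \<le> B" using bump_bounded by metis
  then obtain B where B: "\<And>j. B j > 0" "\<And>j t. \<bar>bump j t\<bar> \<le> B j" by metis
  have "\<bar>tensor_bump \<alpha> w\<bar> \<le> (\<Prod>i\<in>UNIV. B (\<alpha> i))" for w
    unfolding tensor_bump_def abs_prod by (intro prod_mono) (auto simp: B)
  moreover have "(\<Prod>i\<in>UNIV. B (\<alpha> i)) > 0" by (intro prod_pos) (auto simp: B)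
  ultimately show thesis using that by blast
qed

text \<open>The bump is supported in the cube [-1, 1]^n, and by comparison with the l1 norm a
  Euclidean norm of at least n forces a coordinate of size at least 1. This is the origin of the
  radius n \<epsilon> in all later support conditions.\<close>

lemma tensor_bump_eq_0:
  fixes w :: "real ^ 'n::finite"
  assumes "norm w \<ge> real CARD('n)"
  shows "tensor_bump \<alpha> w = 0"
proof -
  obtain i where "\<bar>w $ i\<bar> \<ge> 1"
  proof (rule ccontr)
    assume "\<not> thesis"
    then have "\<not> \<bar>w $ i\<bar> \<ge> 1" for i using that by blast
    then have "(\<Sum>i\<in>UNIV. \<bar>w $ i\<bar>) < (\<Sum>i\<in>(UNIV::'n set). 1)"
      by (intro sum_strict_mono) (auto simp: not_le)
    then show False using assms norm_le_l1_cart[of w] by simp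
  qed
  then show ?thesis unfolding tensor_bump_def by (intro prod_zero) (auto intro!: exI[of _ i] simp: bump_eq_0)
qed

lemma tensor_bump_0_nonneg: "tensor_bump (\<lambda>_. 0) w \<ge> 0"
  unfolding tensor_bump_def by (auto intro!: prod_nonneg bump_0_nonneg)

lemma tensor_bump_integrable: "integrable lborel (tensor_bump \<alpha> :: real ^ 'n::finite \<Rightarrow> real)"
proof -
  have "integrable lborel (\<lambda>w :: real ^ 'n. indicator (cball 0 (real CARD('n))) w *\<^sub>R tensor_bump \<alpha> w)"
    by (intro borel_integrable_compact continuous_on_tensor_bump) auto
  moreover have "(\<lambda>w :: real ^ 'n. indicator (cball 0 (real CARD('n))) w *\<^sub>R tensor_bump \<alpha> w) = tensor_bump \<alpha>"
    by (auto simp: fun_eq_iff indicator_def tensor_bump_eq_0)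
  ultimately show ?thesis by simp
qed

definition bump_mass :: "'n::finite itself \<Rightarrow> real" where
  "bump_mass _ = (LINT w|lborel. tensor_bump (\<lambda>_::'n. 0) w)"

text \<open>Continuity makes the bump positive on a whole ball around 0, whereas a nonnegative
  function with integral 0 vanishes almost everywhere.\<close>

lemma bump_mass_pos: "bump_mass TYPE('n::finite) > 0"
proof -
  let ?t = "tensor_bump (\<lambda>_::'n. 0)"
  have pos: "?t 0 > 0" unfolding tensor_bump_def by (simp add: bump_0_pos)
  have "isCont ?t 0" using continuous_on_tensor_bump[of UNIV "\<lambda>_::'n. 0"] by (simp add: continuous_on_eq_continuous_at)
  then have "eventually (\<lambda>w. ?t w > 0) (nhds 0)"
    using pos by (metis order_tendstoD(1) isCont_def tendsto_at_iff_tendsto_nhds)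
  then obtain e where e: "e > 0" "\<And>w. dist w 0 < e \<Longrightarrow> ?t w > 0"
    by (auto simp: eventually_nhds_metric)
  have "bump_mass TYPE('n) \<noteq> 0"
  proof
    assume "bump_mass TYPE('n) = 0"
    then have "AE w in lborel. ?t w = 0"
      using integral_nonneg_eq_0_iff_AE[OF tensor_bump_integrable[of "\<lambda>_::'n. 0"]]
      by (simp add: bump_mass_def tensor_bump_0_nonneg)
    then have "AE w in lborel. w \<notin> ball (0::real^'n) e"
      by eventually_elim (use e in \<open>force simp: dist_commute\<close>)
    then have "emeasure lborel (ball (0::real^'n) e) = 0"
      by (subst (asm) AE_iff_measurable[of "ball 0 e"]) auto
    then show False using e unit_ball_vol_pos[of "real CARD('n)"] by (simp add: emeasure_ball)
  qed
  moreover have "bump_mass TYPE('n) \<ge> 0"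
    unfolding bump_mass_def by (intro integral_nonneg_AE) (simp add: tensor_bump_0_nonneg)
  ultimately show ?thesis by simp
qed

section \<open>Rescaled mollifiers\<close>

text \<open>D^\<alpha> of the standard mollifier of mass 1 at scale \<epsilon>. The power of
  1/\<epsilon> beyond n is the chain rule factor; with it included, differentiation merely
  increments \<alpha>.\<close>

definition moll :: "real \<Rightarrow> ('n::finite \<Rightarrow> nat) \<Rightarrow> real ^ 'n \<Rightarrow> real" where
  "moll \<epsilon> \<alpha> w = tensor_bump \<alpha> ((1 / \<epsilon>) *\<^sub>R w) * (1 / \<epsilon>) ^ (CARD('n) + multi_order \<alpha>) / bump_mass TYPE('n)"

lemma moll_has_derivative:
  "(moll \<epsilon> \<alpha> has_derivative (\<lambda>v. \<Sum>i\<in>UNIV. v $ i * moll \<epsilon> (inc i \<alpha>) w)) (at w)"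
proof -
  have "((\<lambda>w. tensor_bump \<alpha> ((1 / \<epsilon>) *\<^sub>R w)) has_derivative
     (\<lambda>v. \<Sum>i\<in>UNIV. ((1 / \<epsilon>) *\<^sub>R v) $ i * tensor_bump (inc i \<alpha>) ((1 / \<epsilon>) *\<^sub>R w))) (at w)"
    by (rule has_derivative_compose[OF _ tensor_bump_has_derivative]) (auto intro!: derivative_eq_intros)
  then have "(moll \<epsilon> \<alpha> has_derivative (\<lambda>v. (\<Sum>i\<in>UNIV. ((1 / \<epsilon>) *\<^sub>R v) $ i * tensor_bump (inc i \<alpha>) ((1 / \<epsilon>) *\<^sub>R w))
      * ((1 / \<epsilon>) ^ (CARD('a) + multi_order \<alpha>) / bump_mass TYPE('a)))) (at w)"
    unfolding moll_def[abs_def] times_divide_eq_right[symmetric]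
    by (rule has_derivative_mult_left)
  moreover have "(\<Sum>i\<in>UNIV. ((1 / \<epsilon>) *\<^sub>R v) $ i * tensor_bump (inc i \<alpha>) ((1 / \<epsilon>) *\<^sub>R w))
      * ((1 / \<epsilon>) ^ (CARD('a) + multi_order \<alpha>) / bump_mass TYPE('a))
    = (\<Sum>i\<in>UNIV. v $ i * moll \<epsilon> (inc i \<alpha>) w)" for v
    unfolding sum_distrib_right by (intro sum.cong) (auto simp: moll_def)
  ultimately show ?thesis by simp
qed

lemma continuous_on_moll: "continuous_on S (moll \<epsilon> \<alpha>)"
  by (meson continuous_at_imp_continuous_on has_derivative_continuous moll_has_derivative)

lemma moll_measurable [measurable]: "moll \<epsilon> \<alpha> \<in> borel_measurable borel"
  by (intro borel_measurable_continuous_onI continuous_on_moll)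

lemma moll_eq_0:
  fixes w :: "real ^ 'n::finite"
  assumes "\<epsilon> > 0" "norm w \<ge> real CARD('n) * \<epsilon>"
  shows "moll \<epsilon> \<alpha> w = 0"
  using assms by (simp add: moll_def tensor_bump_eq_0 field_simps)

lemma moll_bounded:
  obtains B where "B > 0" "\<And>w. \<bar>moll \<epsilon> \<alpha> w\<bar> \<le> B"
proof -
  obtain B where B: "B > 0" "\<And>w. \<bar>tensor_bump \<alpha> w\<bar> \<le> B" using tensor_bump_bounded by blast
  define c where "c = \<bar>(1 / \<epsilon>) ^ (CARD('a) + multi_order \<alpha>) / bump_mass TYPE('a)\<bar>"
  have "\<bar>moll \<epsilon> \<alpha> w\<bar> \<le> B * c + 1" for w
  proof -
    have "\<bar>moll \<epsilon> \<alpha> w\<bar> = \<bar>tensor_bump \<alpha> ((1 / \<epsilon>) *\<^sub>R w)\<bar> * c"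
      by (simp add: moll_def c_def abs_mult)
    also have "\<dots> \<le> B * c" using B by (intro mult_right_mono) (auto simp: c_def)
    finally show ?thesis by simp
  qed
  moreover have "B * c + 1 > 0" using B by (simp add: c_def add_nonneg_pos)
  ultimately show thesis using that by blast
qed

lemma moll_0_nonneg: "\<epsilon> > 0 \<Longrightarrow> moll \<epsilon> (\<lambda>_. 0) w \<ge> 0"
  by (simp add: moll_def tensor_bump_0_nonneg bump_mass_pos less_imp_le)

text \<open>B does not depend on \<epsilon>. Up to this constant, mollifying a nonnegative function
  is dominated by averaging over a ball of radius n \<epsilon>, so bounds for ball averages carry
  over to mollifications.\<close>

lemma moll_0_le:
  obtains B where "B > 0" "\<And>\<epsilon> w. \<epsilon> > 0 \<Longrightarrow>
    moll \<epsilon> (\<lambda>_::'n::finite. 0) w \<le> B / \<epsilon> ^ CARD('n) * indicator (ball 0 (real CARD('n) * \<epsilon>)) w"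
proof -
  obtain B where B: "B > 0" "\<And>w. \<bar>tensor_bump (\<lambda>_::'n. 0) w\<bar> \<le> B" using tensor_bump_bounded by blast
  show thesis
  proof (rule that[of "B / bump_mass TYPE('n)"])
    show "B / bump_mass TYPE('n) > 0" using B bump_mass_pos[where 'n='n] by simp
    fix \<epsilon> :: real and w :: "real ^ 'n" assume e: "\<epsilon> > 0"
    show "moll \<epsilon> (\<lambda>_. 0) w \<le> B / bump_mass TYPE('n) / \<epsilon> ^ CARD('n) * indicator (ball 0 (real CARD('n) * \<epsilon>)) w"
    proof (cases "norm w \<ge> real CARD('n) * \<epsilon>")
      case True
      then show ?thesis using e by (simp add: moll_eq_0 indicator_def)
    next
      case False
      have "moll \<epsilon> (\<lambda>_. 0) w = tensor_bump (\<lambda>_. 0) ((1 / \<epsilon>) *\<^sub>R w) / bump_mass TYPE('n) / \<epsilon> ^ CARD('n)"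
        by (simp add: moll_def multi_order_def power_divide)
      also have "\<dots> \<le> B / bump_mass TYPE('n) / \<epsilon> ^ CARD('n)"
        using B(2)[of "(1 / \<epsilon>) *\<^sub>R w"] e bump_mass_pos[where 'n='n] by (intro divide_right_mono) auto
      finally show ?thesis using False by (simp add: indicator_def)
    qed
  qed
qed

lemma nn_integral_moll:
  assumes "\<epsilon> > 0"
  shows "(\<integral>\<^sup>+w. ennreal (moll \<epsilon> (\<lambda>_::'n::finite. 0) w) \<partial>lborel) = 1"
proof -
  have pos: "bump_mass TYPE('n) > 0" by (rule bump_mass_pos)
  have "(\<integral>\<^sup>+w. ennreal (moll \<epsilon> (\<lambda>_::'n. 0) w) \<partial>lborel) =
     ennreal (\<epsilon> ^ CARD('n)) * (\<integral>\<^sup>+w. ennreal (moll \<epsilon> (\<lambda>_::'n. 0) (0 + \<epsilon> *\<^sub>R w)) \<partial>lborel)"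
    using nn_integral_lborel_affine[OF _ assms, of "\<lambda>w. ennreal (moll \<epsilon> (\<lambda>_::'n. 0) w)" 0] by simp
  also have "\<dots> = (\<integral>\<^sup>+w. ennreal (\<epsilon> ^ CARD('n)) * ennreal (moll \<epsilon> (\<lambda>_::'n. 0) (0 + \<epsilon> *\<^sub>R w)) \<partial>lborel)"
    by (rule nn_integral_cmult[symmetric]) measurable
  also have "\<dots> = (\<integral>\<^sup>+w. ennreal (1 / bump_mass TYPE('n)) * ennreal (tensor_bump (\<lambda>_::'n. 0) w) \<partial>lborel)"
    using assms pos
    by (intro nn_integral_cong)
      (auto simp: moll_def multi_order_def power_divide tensor_bump_0_nonneg simp flip: ennreal_mult)
  also have "\<dots> = ennreal (1 / bump_mass TYPE('n)) * ennreal (bump_mass TYPE('n))"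
    unfolding bump_mass_def
    by (subst nn_integral_cmult, simp, subst nn_integral_eq_integral[OF tensor_bump_integrable])
      (auto simp: tensor_bump_0_nonneg)
  also have "\<dots> = 1" using pos by (simp flip: ennreal_mult)
  finally show ?thesis .
qed

section \<open>Mollification and weak derivatives\<close>

lemma moll_line_derivative:
  "((\<lambda>t. moll \<epsilon> \<alpha> (a + t *\<^sub>R e)) has_real_derivative
     (\<Sum>i\<in>UNIV. e $ i * moll \<epsilon> (inc i \<alpha>) (a + t *\<^sub>R e))) (at t)"
proof -
  have "((\<lambda>t. a + t *\<^sub>R e) has_derivative (\<lambda>t. t *\<^sub>R e)) (at t)"
    by (auto intro!: derivative_eq_intros)
  from has_derivative_compose[OF this moll_has_derivative]
  have "((\<lambda>t. moll \<epsilon> \<alpha> (a + t *\<^sub>R e)) has_derivative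
     (\<lambda>h. \<Sum>i\<in>UNIV. (h *\<^sub>R e) $ i * moll \<epsilon> (inc i \<alpha>) (a + t *\<^sub>R e))) (at t)" .
  moreover have "(\<Sum>i\<in>UNIV. (h *\<^sub>R e) $ i * moll \<epsilon> (inc i \<alpha>) (a + t *\<^sub>R e)) =
     (\<Sum>i\<in>UNIV. e $ i * moll \<epsilon> (inc i \<alpha>) (a + t *\<^sub>R e)) * h" for h
    unfolding sum_distrib_right by (intro sum.cong) simp_all
  ultimately show ?thesis
    by (simp add: has_field_derivative_def)
qed

text \<open>The reflection in x - y contributes a minus sign at each differentiation; the scalar c
  absorbs it, so that the shape of the function is stable under iteration.\<close>

lemma partial_moll:
  fixes x :: "real ^ 'n::finite"
  shows "partial i (\<lambda>y. c * moll \<epsilon> \<alpha> (x - y)) = (\<lambda>y. - c * moll \<epsilon> (inc i \<alpha>) (x - y))"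
proof
  fix y
  have eq: "x - (y + t *\<^sub>R axis i 1) = (x - y) + t *\<^sub>R (- axis i 1)" for t :: real by simp
  have "(\<Sum>j\<in>UNIV. (- axis i 1 :: real ^ 'n) $ j * moll \<epsilon> (inc j \<alpha>) (x - y)) =
     (\<Sum>j\<in>UNIV. if j = i then - moll \<epsilon> (inc j \<alpha>) (x - y) else 0)"
    by (intro sum.cong) (auto simp: axis_def)
  then have "((\<lambda>t. c * moll \<epsilon> \<alpha> (x - (y + t *\<^sub>R axis i 1))) has_real_derivative
     c * - moll \<epsilon> (inc i \<alpha>) (x - y)) (at 0)"
    using DERIV_cmult[OF moll_line_derivative[of \<epsilon> \<alpha> "x - y" "- axis i 1" 0], of c]
    unfolding eq by simp
  then show "partial i (\<lambda>y. c * moll \<epsilon> \<alpha> (x - y)) y = - c * moll \<epsilon> (inc i \<alpha>) (x - y)"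
    unfolding partial_def by (auto dest: DERIV_imp_deriv)
qed

text \<open>Partial derivatives taken in any order lead to scalar multiples of some
  \<open>moll \<epsilon> \<beta> (x - y)\<close>, and each of these is differentiable.\<close>

lemma smooth_moll: "smooth (\<lambda>y. moll \<epsilon> \<alpha> (x - y))"
  unfolding smooth_def
proof
  fix js
  have "\<exists>c \<beta>. foldr partial js (\<lambda>y. moll \<epsilon> \<alpha> (x - y)) = (\<lambda>y. c * moll \<epsilon> \<beta> (x - y))"
  proof (induction js)
    case Nil
    show ?case by (intro exI[of _ 1] exI[of _ \<alpha>]) simp
  next
    case (Cons i js)
    then obtain c \<beta> where "foldr partial js (\<lambda>y. moll \<epsilon> \<alpha> (x - y)) = (\<lambda>y. c * moll \<epsilon> \<beta> (x - y))" by blast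
    then have "foldr partial (i # js) (\<lambda>y. moll \<epsilon> \<alpha> (x - y)) = (\<lambda>y. - c * moll \<epsilon> (inc i \<beta>) (x - y))"
      by (simp only: foldr.simps comp_def partial_moll)
    then show ?case by blast
  qed
  then obtain c \<beta> where "foldr partial js (\<lambda>y. moll \<epsilon> \<alpha> (x - y)) = (\<lambda>y. c * moll \<epsilon> \<beta> (x - y))" by blast
  moreover have "(\<lambda>y. moll \<epsilon> \<beta> (x - y)) differentiable (at y)" for y
    unfolding differentiable_def
    by (rule exI, rule has_derivative_compose[OF _ moll_has_derivative]) (auto intro!: derivative_eq_intros)
  ultimately show "foldr partial js (\<lambda>y. moll \<epsilon> \<alpha> (x - y)) differentiable_on UNIV"
    by (auto simp: differentiable_on_def intro!: differentiable_mult)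
qed

lemma moll_test_function:
  fixes x :: "real ^ 'n::finite"
  assumes "\<epsilon> > 0" "cball x (real CARD('n) * \<epsilon>) \<subseteq> U"
  shows "(\<lambda>y. moll \<epsilon> \<alpha> (x - y)) \<in> test_functions U"
proof -
  have "{y. moll \<epsilon> \<alpha> (x - y) \<noteq> 0} \<subseteq> cball x (real CARD('n) * \<epsilon>)"
  proof safe
    fix y assume "moll \<epsilon> \<alpha> (x - y) \<noteq> 0"
    then have "norm (x - y) < real CARD('n) * \<epsilon>" using moll_eq_0[OF assms(1), of "x - y" \<alpha>] by force
    then show "y \<in> cball x (real CARD('n) * \<epsilon>)" by (simp add: dist_norm)
  qed
  then have cl: "closure {y. moll \<epsilon> \<alpha> (x - y) \<noteq> 0} \<subseteq> cball x (real CARD('n) * \<epsilon>)"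
    by (simp add: closure_minimal)
  then have "compact (closure {y. moll \<epsilon> \<alpha> (x - y) \<noteq> 0})"
    by (meson bounded_cball bounded_subset closed_closure compact_eq_bounded_closed)
  then show ?thesis using cl assms smooth_moll by (auto simp: test_functions_def)
qed

lemma partial_power_moll:
  "(partial i ^^ k) (\<lambda>y. c * moll \<epsilon> \<alpha> (x - y)) =
     (\<lambda>y. (-1) ^ k * c * moll \<epsilon> (\<alpha>(i := \<alpha> i + k)) (x - y))"
proof (induction k)
  case (Suc k)
  have "(partial i ^^ Suc k) (\<lambda>y. c * moll \<epsilon> \<alpha> (x - y)) =
     partial i (\<lambda>y. ((-1) ^ k * c) * moll \<epsilon> (\<alpha>(i := \<alpha> i + k)) (x - y))"
    by (simp only: funpow.simps comp_def Suc)
  moreover have "inc i (\<alpha>(i := \<alpha> i + k)) = \<alpha>(i := \<alpha> i + Suc k)"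
    by (auto simp: inc_def fun_eq_iff)
  ultimately show ?case by (simp only: partial_moll power_Suc mult_minus_left mult_1)
qed simp

text \<open>Induction over a duplicate-free list of coordinates, with \<alpha> restricted to those
  already treated. The resulting sign is the one in the definition of weak derivatives, so the two
  cancel later.\<close>

lemma multi_partial_moll:
  "multi_partial \<alpha> (\<lambda>y. moll \<epsilon> (\<lambda>_. 0) (x - y)) = (\<lambda>y. (-1) ^ multi_order \<alpha> * moll \<epsilon> \<alpha> (x - y))"
proof -
  have "foldr (\<lambda>i. partial i ^^ \<alpha> i) js (\<lambda>y. moll \<epsilon> (\<lambda>_. 0) (x - y)) =
     (\<lambda>y. (-1) ^ (\<Sum>i\<in>set js. \<alpha> i) * moll \<epsilon> (\<lambda>i. if i \<in> set js then \<alpha> i else 0) (x - y))"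
    if "distinct js" for js
    using that
  proof (induction js)
    case (Cons i js)
    then have *: "(\<lambda>j. if j \<in> set js then \<alpha> j else 0)(i := (if i \<in> set js then \<alpha> i else 0) + \<alpha> i) =
      (\<lambda>j. if j \<in> set (i # js) then \<alpha> j else 0)"
      by (auto simp: fun_eq_iff)
    have "foldr (\<lambda>i. partial i ^^ \<alpha> i) (i # js) (\<lambda>y. moll \<epsilon> (\<lambda>_. 0) (x - y)) =
      (partial i ^^ \<alpha> i) (\<lambda>y. (-1) ^ (\<Sum>i\<in>set js. \<alpha> i) * moll \<epsilon> (\<lambda>i. if i \<in> set js then \<alpha> i else 0) (x - y))"
      using Cons by simp
    also have "\<dots> = (\<lambda>y. (-1) ^ \<alpha> i * (-1) ^ (\<Sum>i\<in>set js. \<alpha> i) *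
        moll \<epsilon> (\<lambda>j. if j \<in> set (i # js) then \<alpha> j else 0) (x - y))"
      unfolding partial_power_moll * ..
    finally show ?case using Cons.prems by (simp add: power_add)
  qed simp
  from this[OF coords(2)] show ?thesis
    by (simp add: multi_partial_def multi_order_def coords(1))
qed

section \<open>Convolution with the mollifier and its derivatives along lines\<close>

text \<open>This is D^\<alpha> of the mollification of f, with all derivatives placed on the
  mollifier, so that it makes sense for every integrable f; for \<alpha> = 0 it is the mollification
  itself.\<close>

definition mconv :: "real \<Rightarrow> (real ^ 'n::finite \<Rightarrow> real) \<Rightarrow> ('n \<Rightarrow> nat) \<Rightarrow> real ^ 'n \<Rightarrow> real" where
  "mconv \<epsilon> f \<alpha> x = (LINT y|lborel. f y * moll \<epsilon> \<alpha> (x - y))"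

lemma mconv_measurable [measurable]:
  assumes [measurable]: "f \<in> borel_measurable borel"
  shows "mconv \<epsilon> f \<alpha> \<in> borel_measurable borel"
  unfolding mconv_def by measurable

lemma mconv_integrable:
  assumes "integrable lborel f"
  shows "integrable lborel (\<lambda>y. f y * moll \<epsilon> \<alpha> (x - y))"
proof -
  obtain B where B: "\<And>w. \<bar>moll \<epsilon> \<alpha> w\<bar> \<le> B" using moll_bounded by blast
  have [measurable]: "f \<in> borel_measurable borel" using assms by auto
  show ?thesis
  proof (rule Bochner_Integration.integrable_bound)
    show "integrable lborel (\<lambda>y. B * f y)" using assms by simp
    show "AE y in lborel. norm (f y * moll \<epsilon> \<alpha> (x - y)) \<le> norm (B * f y)"
      using order_trans[OF B abs_ge_self] by (simp add: abs_mult mult.commute[of "\<bar>B\<bar>"] mult_left_mono)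
  qed measurable
qed

lemma mconv_line_derivative:
  assumes f: "integrable lborel f"
  shows "((\<lambda>t. mconv \<epsilon> f \<alpha> (a + t *\<^sub>R e)) has_real_derivative
     (\<Sum>i\<in>UNIV. e $ i * mconv \<epsilon> f (inc i \<alpha>) (a + t *\<^sub>R e))) (at t)"
proof -
  have [measurable]: "f \<in> borel_measurable borel" using f by auto
  define \<phi> where "\<phi> t w = moll \<epsilon> \<alpha> (w + t *\<^sub>R e)" for t w
  define \<phi>' where "\<phi>' t w = (\<Sum>i\<in>UNIV. e $ i * moll \<epsilon> (inc i \<alpha>) (w + t *\<^sub>R e))" for t w
  have [measurable]: "\<phi> t \<in> borel_measurable borel" "\<phi>' t \<in> borel_measurable borel" for t
    unfolding \<phi>_def \<phi>'_def by measurable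
  have d: "((\<lambda>t. \<phi> t w) has_real_derivative \<phi>' t w) (at t)" for t w
    unfolding \<phi>_def \<phi>'_def by (rule moll_line_derivative)
  have "\<forall>i. \<exists>B>0. \<forall>w. \<bar>moll \<epsilon> (inc i \<alpha>) w\<bar> \<le> B" by (metis moll_bounded)
  then obtain B where B: "\<And>i w. \<bar>moll \<epsilon> (inc i \<alpha>) w\<bar> \<le> B i" by metis
  \<comment> \<open>A bound for the slope in t that is uniform in w: by the mean value inequality
    all difference quotients are at most M, so M |f| dominates the integrands.\<close>
  define M where "M = (\<Sum>i\<in>UNIV. \<bar>e $ i\<bar> * B i)"
  have M: "\<bar>\<phi>' t w\<bar> \<le> M" for t w
    unfolding \<phi>'_def M_def by (intro order_trans[OF sum_abs] sum_mono) (auto simp: abs_mult intro!: mult_left_mono B)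
  have lip: "\<bar>\<phi> s w - \<phi> t w\<bar> \<le> M * \<bar>s - t\<bar>" for s w
    using field_differentiable_bound[of UNIV "\<lambda>t. \<phi> t w" "\<lambda>t. \<phi>' t w" M s t] d M
    by (auto intro: has_field_derivative_at_within)
  have lim: "((\<lambda>h. (mconv \<epsilon> f \<alpha> (a + (t + h) *\<^sub>R e) - mconv \<epsilon> f \<alpha> (a + t *\<^sub>R e)) / h) \<longlongrightarrow>
      (LINT y|lborel. f y * \<phi>' t (a - y))) (at 0)"
    unfolding tendsto_at_iff_sequentially comp_def
  proof (intro allI impI)
    fix h :: "nat \<Rightarrow> real" assume h: "\<forall>i. h i \<in> UNIV - {0}" "h \<longlonglongrightarrow> 0"
    have eq: "mconv \<epsilon> f \<alpha> (a + s *\<^sub>R e) = (LINT y|lborel. f y * \<phi> s (a - y))"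
      and int: "integrable lborel (\<lambda>y. f y * \<phi> s (a - y))" for s
      using mconv_integrable[OF f, of \<epsilon> \<alpha> "a + s *\<^sub>R e"]
      by (simp_all add: mconv_def \<phi>_def algebra_simps)
    have "(\<lambda>n. LINT y|lborel. f y * ((\<phi> (t + h n) (a - y) - \<phi> t (a - y)) / h n)) \<longlonglongrightarrow>
       (LINT y|lborel. f y * \<phi>' t (a - y))"
    proof (rule integral_dominated_convergence)
      show "integrable lborel (\<lambda>y. M * \<bar>f y\<bar>)" using f by simp
      show "AE y in lborel. (\<lambda>n. f y * ((\<phi> (t + h n) (a - y) - \<phi> t (a - y)) / h n)) \<longlonglongrightarrow> f y * \<phi>' t (a - y)"
      proof (intro AE_I2 tendsto_mult_left)
        fix y
        show "(\<lambda>n. (\<phi> (t + h n) (a - y) - \<phi> t (a - y)) / h n) \<longlonglongrightarrow> \<phi>' t (a - y)"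
          using d[of "a - y" t] h unfolding DERIV_def tendsto_at_iff_sequentially comp_def by blast
      qed
      fix n
      have "\<bar>(\<phi> (t + h n) (a - y) - \<phi> t (a - y)) / h n\<bar> \<le> M" for y
        using lip[of "t + h n" "a - y"] h(1)[rule_format, of n] by (simp add: abs_divide field_simps)
      then show "AE y in lborel. norm (f y * ((\<phi> (t + h n) (a - y) - \<phi> t (a - y)) / h n)) \<le> M * \<bar>f y\<bar>"
        unfolding real_norm_def abs_mult mult.commute[of M] by (intro AE_I2 mult_left_mono) auto
    qed measurable
    moreover have "(LINT y|lborel. f y * ((\<phi> (t + h n) (a - y) - \<phi> t (a - y)) / h n)) =
      (mconv \<epsilon> f \<alpha> (a + (t + h n) *\<^sub>R e) - mconv \<epsilon> f \<alpha> (a + t *\<^sub>R e)) / h n" for n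
      unfolding eq Bochner_Integration.integral_diff[OF int int, symmetric]
        integral_divide_zero[symmetric]
      by (intro Bochner_Integration.integral_cong) (auto simp: algebra_simps)
    ultimately show "(\<lambda>n. (mconv \<epsilon> f \<alpha> (a + (t + h n) *\<^sub>R e) - mconv \<epsilon> f \<alpha> (a + t *\<^sub>R e)) / h n)
      \<longlonglongrightarrow> (LINT y|lborel. f y * \<phi>' t (a - y))" by (simp only:)
  qed
  have "(LINT y|lborel. f y * \<phi>' t (a - y)) =
      (LINT y|lborel. (\<Sum>i\<in>UNIV. e $ i * (f y * moll \<epsilon> (inc i \<alpha>) (a + t *\<^sub>R e - y))))"
    by (intro Bochner_Integration.integral_cong)
      (auto simp: \<phi>'_def sum_distrib_left algebra_simps)
  also have "\<dots> = (\<Sum>i\<in>UNIV. e $ i * mconv \<epsilon> f (inc i \<alpha>) (a + t *\<^sub>R e))"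
    using mconv_integrable[OF f] by (simp add: mconv_def)
  finally show ?thesis
    using lim by (simp add: DERIV_def)
qed

text \<open>The j-th derivative of \<open>mconv \<epsilon> f \<alpha>\<close> in direction e,
  expanded into multi-index derivatives: Taylor's formula along a ray needs the former, the weak
  derivatives of f supply the latter.\<close>

primrec dir_deriv :: "real \<Rightarrow> (real ^ 'n::finite \<Rightarrow> real) \<Rightarrow> real ^ 'n \<Rightarrow> nat \<Rightarrow> ('n \<Rightarrow> nat) \<Rightarrow> real ^ 'n \<Rightarrow> real" where
  "dir_deriv \<epsilon> f e 0 \<alpha> x = mconv \<epsilon> f \<alpha> x"
| "dir_deriv \<epsilon> f e (Suc j) \<alpha> x = (\<Sum>i\<in>UNIV. e $ i * dir_deriv \<epsilon> f e j (inc i \<alpha>) x)"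

lemma dir_deriv_line_derivative:
  assumes f: "integrable lborel f"
  shows "((\<lambda>t. dir_deriv \<epsilon> f e j \<alpha> (a + t *\<^sub>R e)) has_real_derivative
     dir_deriv \<epsilon> f e (Suc j) \<alpha> (a + t *\<^sub>R e)) (at t)"
proof (induction j arbitrary: \<alpha>)
  case 0
  show ?case using mconv_line_derivative[OF f] by simp
next
  case (Suc j)
  have "((\<lambda>t. \<Sum>i\<in>UNIV. e $ i * dir_deriv \<epsilon> f e j (inc i \<alpha>) (a + t *\<^sub>R e)) has_real_derivative
     (\<Sum>i\<in>UNIV. e $ i * dir_deriv \<epsilon> f e (Suc j) (inc i \<alpha>) (a + t *\<^sub>R e))) (at t)"
    by (intro DERIV_sum DERIV_cmult Suc)
  then show ?case by (simp only: dir_deriv.simps(2))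
qed

lemma finite_multi_order_le: "finite {\<beta> :: 'n::finite \<Rightarrow> nat. multi_order \<beta> \<le> k}"
proof (rule finite_subset)
  show "{\<beta> :: 'n \<Rightarrow> nat. multi_order \<beta> \<le> k} \<subseteq> (\<Pi>\<^sub>E i\<in>UNIV. {..k})"
  proof safe
    fix \<beta> :: "'n \<Rightarrow> nat" and i assume "multi_order \<beta> \<le> k"
    moreover have "\<beta> i \<le> multi_order \<beta>" unfolding multi_order_def by (rule member_le_sum) auto
    ultimately show "\<beta> i \<le> k" by simp
  qed auto
qed (simp add: finite_PiE)

definition mconv_sum :: "real \<Rightarrow> nat \<Rightarrow> (real ^ 'n::finite \<Rightarrow> real) \<Rightarrow> real ^ 'n \<Rightarrow> real" where
  "mconv_sum \<epsilon> k f x = (\<Sum>\<beta> | multi_order \<beta> \<le> k. \<bar>mconv \<epsilon> f \<beta> x\<bar>)"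

lemma mconv_sum_nonneg: "mconv_sum \<epsilon> k f x \<ge> 0"
  unfolding mconv_sum_def by (intro sum_nonneg) auto

lemma mconv_sum_measurable [measurable]:
  assumes [measurable]: "f \<in> borel_measurable borel"
  shows "mconv_sum \<epsilon> k f \<in> borel_measurable borel"
  unfolding mconv_sum_def by measurable

lemma mconv_le_mconv_sum: "multi_order \<beta> \<le> k \<Longrightarrow> \<bar>mconv \<epsilon> f \<beta> x\<bar> \<le> mconv_sum \<epsilon> k f x"
  unfolding mconv_sum_def by (rule member_le_sum) (auto simp: finite_multi_order_le)

text \<open>Expanding j directional derivatives gives n^j terms, each with a coefficient of absolute
  value at most 1.\<close>

lemma dir_deriv_le_mconv_sum:
  fixes e :: "real ^ 'n::finite"
  assumes e: "norm e \<le> 1" and "multi_order \<alpha> + j \<le> k"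
  shows "\<bar>dir_deriv \<epsilon> f e j \<alpha> x\<bar> \<le> real CARD('n) ^ j * mconv_sum \<epsilon> k f x"
  using assms(2)
proof (induction j arbitrary: \<alpha>)
  case 0
  then show ?case by (simp add: mconv_le_mconv_sum)
next
  case (Suc j)
  have "\<bar>dir_deriv \<epsilon> f e (Suc j) \<alpha> x\<bar> \<le> (\<Sum>i\<in>UNIV. \<bar>e $ i * dir_deriv \<epsilon> f e j (inc i \<alpha>) x\<bar>)"
    by simp
  also have "\<dots> \<le> (\<Sum>i\<in>(UNIV::'n set). 1 * (real CARD('n) ^ j * mconv_sum \<epsilon> k f x))"
    unfolding abs_mult
    using Suc order_trans[OF component_le_norm_cart e]
    by (intro sum_mono mult_mono) auto
  finally show ?case by simp
qed

section \<open>Integration along rays and Riesz potentials\<close>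

text \<open>The value at 0 is expanded about the far end r; the remainder is then weighted by
  s^(m-1), with s the distance from 0, and this weight later produces the Riesz kernel. Reciprocal
  factorials are bounded by 1. For m = 1 this is the fundamental theorem of calculus.\<close>

lemma taylor_estimate:
  fixes v :: "nat \<Rightarrow> real \<Rightarrow> real"
  assumes m: "m > 0" and r: "r \<ge> 0"
    and d: "\<And>j t. (v j has_real_derivative v (Suc j) t) (at t)"
  shows "ennreal \<bar>v 0 0\<bar> \<le> ennreal (\<Sum>j<m. r ^ j * \<bar>v j r\<bar>) +
    (\<integral>\<^sup>+s. ennreal (s ^ (m - 1) * \<bar>v m s\<bar>) * indicator {0..r} s \<partial>lborel)"
proof -
  \<comment> \<open>The path is traversed backwards, so that \<open>Taylor_integral\<close> has its
    base point at r; each derivative then picks up a sign.\<close>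
  define Dw where "Dw j s = (-1) ^ j * v j (r - s)" for j s
  have Dw: "(Dw j has_vector_derivative Dw (Suc j) s) (at s within {0..r})" for j s
  proof -
    have "((\<lambda>s. v j (r - s)) has_real_derivative v (Suc j) (r - s) * (- 1)) (at s)"
      by (rule DERIV_chain2[OF d]) (auto intro!: derivative_eq_intros)
    from DERIV_cmult[OF this, of "(-1) ^ j"] show ?thesis
      unfolding Dw_def has_real_derivative_iff_has_vector_derivative[symmetric]
      by (auto intro: has_field_derivative_at_within)
  qed
  have cont: "continuous_on S (v j)" for S j
    by (meson DERIV_isCont d continuous_at_imp_continuous_on)
  define i where "i s = ((r - s) ^ (m - 1) / fact (m - 1)) * Dw m s" for s
  define h where "h s = (r - s) ^ (m - 1) * \<bar>v m (r - s)\<bar>" for s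
  have Dw0: "Dw 0 = (\<lambda>s. v 0 (r - s))" by (auto simp: Dw_def)
  have "Dw 0 r = (\<Sum>j<m. ((r - 0) ^ j / fact j) *\<^sub>R Dw j 0) + integral {0..r} (\<lambda>s. ((r - s) ^ (m - 1) / fact (m - 1)) *\<^sub>R Dw m s)"
    by (rule Taylor_integral[where Df=Dw and f="Dw 0" and a=0 and b=r and p=m]) (use r m Dw in auto)
  then have eq: "v 0 0 = (\<Sum>j<m. (r ^ j / fact j) * Dw j 0) + integral {0..r} i"
    by (simp add: Dw0 i_def[abs_def])
  have "continuous_on {0..r} h"
    unfolding h_def by (intro continuous_intros continuous_on_compose2[OF cont[of UNIV]]) auto
  then have h: "(h has_integral integral {0..r} h) {0..r}"
    by (intro integrable_integral integrable_continuous_real)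
  have "continuous_on {0..r} i"
    unfolding i_def Dw_def by (intro continuous_intros continuous_on_compose2[OF cont[of UNIV]]) auto
  moreover have "norm (i s) \<le> h s" if "s \<in> {0..r}" for s
  proof -
    have "(r - s) ^ (m - 1) / fact (m - 1) \<le> (r - s) ^ (m - 1) / 1"
      using that by (intro divide_left_mono) (auto simp: fact_ge_1)
    then have "(r - s) ^ (m - 1) / fact (m - 1) * \<bar>v m (r - s)\<bar> \<le> (r - s) ^ (m - 1) * \<bar>v m (r - s)\<bar>"
      by (intro mult_right_mono) auto
    moreover have "norm (i s) = (r - s) ^ (m - 1) / fact (m - 1) * \<bar>v m (r - s)\<bar>"
      using that by (simp add: i_def Dw_def abs_mult power_abs)
    ultimately show ?thesis by (simp add: h_def)
  qed
  ultimately have int: "\<bar>integral {0..r} i\<bar> \<le> integral {0..r} h"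
    using integral_norm_bound_integral[of i "{0..r}" h] h
    by (simp add: integrable_continuous_real has_integral_integrable)
  have sum: "\<bar>\<Sum>j<m. (r ^ j / fact j) * Dw j 0\<bar> \<le> (\<Sum>j<m. r ^ j * \<bar>v j r\<bar>)"
  proof (intro order_trans[OF sum_abs] sum_mono)
    fix j
    have "r ^ j / fact j \<le> r ^ j / 1"
      using r by (intro divide_left_mono) (auto simp: fact_ge_1)
    then have "r ^ j / fact j * \<bar>v j r\<bar> \<le> r ^ j * \<bar>v j r\<bar>"
      by (intro mult_right_mono) auto
    then show "\<bar>(r ^ j / fact j) * Dw j 0\<bar> \<le> r ^ j * \<bar>v j r\<bar>"
      using r by (simp add: Dw_def abs_mult power_abs)
  qed
  have "integral {0..r} h \<ge> 0"
    by (intro integral_nonneg) (use h in \<open>auto simp: h_def has_integral_integrable\<close>)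
  have vm [measurable]: "v m \<in> borel_measurable borel"
    by (intro borel_measurable_continuous_onI cont)
  have "ennreal (integral {0..r} h) = (\<integral>\<^sup>+s. ennreal (h s) * indicator {0..r} s \<partial>lborel)"
    by (rule nn_integral_has_integral_lebesgue'[OF _ h, symmetric]) (auto simp: h_def)
  \<comment> \<open>Reflecting s to r - s turns the weight (r - s)^(m-1) into s^(m-1).\<close>
  also have "\<dots> = (\<integral>\<^sup>+s. ennreal (h (r + (-1) * s)) * indicator {0..r} (r + (-1) * s) \<partial>lborel)"
    by (subst nn_integral_real_affine[where c="-1" and t=r]) (auto simp: h_def[abs_def])
  also have "\<dots> = (\<integral>\<^sup>+s. ennreal (s ^ (m - 1) * \<bar>v m s\<bar>) * indicator {0..r} s \<partial>lborel)"
    by (intro nn_integral_cong) (auto simp: h_def indicator_def)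
  finally have "ennreal (integral {0..r} h) = (\<integral>\<^sup>+s. ennreal (s ^ (m - 1) * \<bar>v m s\<bar>) * indicator {0..r} s \<partial>lborel)" .
  moreover have "\<bar>v 0 0\<bar> \<le> (\<Sum>j<m. r ^ j * \<bar>v j r\<bar>) + integral {0..r} h"
    unfolding eq using sum int by linarith
  then have "ennreal \<bar>v 0 0\<bar> \<le> ennreal (\<Sum>j<m. r ^ j * \<bar>v j r\<bar>) + ennreal (integral {0..r} h)"
    using \<open>integral {0..r} h \<ge> 0\<close> r
    by (subst ennreal_plus[symmetric]) (auto intro!: sum_nonneg ennreal_leI)
  ultimately show ?thesis by simp
qed

text \<open>After the exchange of integrals, e |-> x + s e maps the unit ball onto
  \<open>ball x s\<close>, which contributes s^(-n). Letting e range over the ball instead of the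
  sphere makes this a plain affine substitution. The excluded radius s = 0 is a null set.\<close>

lemma ray_fubini:
  fixes H :: "'a::euclidean_space \<Rightarrow> ennreal" and x :: 'a
  assumes [measurable]: "H \<in> borel_measurable borel" "\<phi> \<in> borel_measurable borel"
  shows "(\<integral>\<^sup>+e\<in>ball 0 1. (\<integral>\<^sup>+s. \<phi> s * H (x + s *\<^sub>R e) * indicator {0..r} s \<partial>lborel) \<partial>lborel) =
    (\<integral>\<^sup>+s. \<phi> s * ennreal (1 / s ^ DIM('a)) * (\<integral>\<^sup>+z\<in>ball x s. H z \<partial>lborel) * indicator {0<..r} s \<partial>lborel)"
proof -
  have [measurable]: "ball (0::'a) 1 \<in> sets borel" by simp
  have "(\<integral>\<^sup>+e\<in>ball 0 1. (\<integral>\<^sup>+s. \<phi> s * H (x + s *\<^sub>R e) * indicator {0..r} s \<partial>lborel) \<partial>lborel) =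
    (\<integral>\<^sup>+e. (\<integral>\<^sup>+s. \<phi> s * H (x + s *\<^sub>R e) * indicator {0..r} s * indicator (ball 0 1) e \<partial>lborel) \<partial>lborel)"
    by (intro nn_integral_cong nn_integral_multc[symmetric]) measurable
  also have "\<dots> = (\<integral>\<^sup>+s. (\<integral>\<^sup>+e. \<phi> s * H (x + s *\<^sub>R e) * indicator {0..r} s * indicator (ball 0 1) e \<partial>lborel) \<partial>lborel)"
    by (rule lborel_pair.Fubini') measurable
  also have "\<dots> = (\<integral>\<^sup>+s. \<phi> s * ennreal (1 / s ^ DIM('a)) * (\<integral>\<^sup>+z\<in>ball x s. H z \<partial>lborel) * indicator {0<..r} s \<partial>lborel)"
  proof (rule nn_integral_cong_AE)
    have "AE s in lborel. s \<noteq> (0::real)" by (rule AE_lborel_singleton)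
    then show "AE s in lborel. (\<integral>\<^sup>+e. \<phi> s * H (x + s *\<^sub>R e) * indicator {0..r} s * indicator (ball 0 1) e \<partial>lborel) =
       \<phi> s * ennreal (1 / s ^ DIM('a)) * (\<integral>\<^sup>+z\<in>ball x s. H z \<partial>lborel) * indicator {0<..r} s"
    proof eventually_elim
      case (elim s)
      show ?case
      proof (cases "0 < s \<and> s \<le> r")
        case True
        have "(\<integral>\<^sup>+e. \<phi> s * H (x + s *\<^sub>R e) * indicator {0..r} s * indicator (ball 0 1) e \<partial>lborel) =
           (\<integral>\<^sup>+e. \<phi> s * (H (x + s *\<^sub>R e) * indicator (ball 0 1) e) \<partial>lborel)"
          using True by (intro nn_integral_cong) (auto simp: mult.assoc)
        also have "\<dots> = \<phi> s * (\<integral>\<^sup>+e\<in>ball 0 1. H (x + s *\<^sub>R e) \<partial>lborel)"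
          by (rule nn_integral_cmult) measurable
        also have "(\<integral>\<^sup>+e\<in>ball 0 1. H (x + s *\<^sub>R e) \<partial>lborel) =
            ennreal (1 / s ^ DIM('a)) * ennreal (s ^ DIM('a)) * (\<integral>\<^sup>+e\<in>ball 0 1. H (x + s *\<^sub>R e) \<partial>lborel)"
          using True by (simp flip: ennreal_mult)
        also have "\<dots> = ennreal (1 / s ^ DIM('a)) * (\<integral>\<^sup>+z\<in>ball x s. H z \<partial>lborel)"
          using True nn_integral_ball_affine[of H s x] by (simp add: mult.assoc)
        finally show ?thesis using True by (simp add: mult.assoc)
      next
        case False
        then have "s \<notin> {0..r}" "s \<notin> {0<..r}" using elim by auto
        then show ?thesis by simp
      qed
    qed
  qed
  finally show ?thesis .
qed

section \<open>Riesz potentials and their averages\<close>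

text \<open>The Riesz potential of order n - \<gamma>, up to the factor 1 /
  \<open>riesz_gamma\<close>, which enters only when capacities are computed. It is an integral over
  \<open>lborel\<close>, since Tonelli is applied to Borel functions.\<close>

definition potential :: "real \<Rightarrow> ('a::euclidean_space \<Rightarrow> real) \<Rightarrow> 'a \<Rightarrow> ennreal" where
  "potential \<gamma> g x = (\<integral>\<^sup>+y. ennreal (g y * kern \<gamma> (x - y)) \<partial>lborel)"

lemma potential_measurable [measurable]:
  assumes [measurable]: "g \<in> borel_measurable borel"
  shows "potential \<gamma> g \<in> borel_measurable borel"
  unfolding potential_def by measurable

text \<open>By Tonelli the integral over the ball falls on the kernel with y fixed, and the kernel
  bound applies to all y other than x, hence to almost all y.\<close>

lemma potential_average:
  assumes "0 < \<gamma>" "\<gamma> < real DIM('a::euclidean_space)"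
  obtains C where "C > 0"
    "\<And>(g :: 'a \<Rightarrow> real) x s. g \<in> borel_measurable borel \<Longrightarrow> (\<And>y. g y \<ge> 0) \<Longrightarrow> s > 0 \<Longrightarrow>
      (\<integral>\<^sup>+z\<in>ball x s. potential \<gamma> g z \<partial>lborel) \<le> ennreal (C * s ^ DIM('a)) * potential \<gamma> g x"
proof -
  obtain C where C: "C > 0" "\<And>(a::'a) b s. s > 0 \<Longrightarrow> a \<noteq> b \<Longrightarrow>
      (\<integral>\<^sup>+z\<in>ball a s. ennreal (kern \<gamma> (b - z)) \<partial>lborel) \<le> ennreal (C * s ^ DIM('a) * kern \<gamma> (b - a))"
    using kern_average[OF assms] by blast
  show thesis
  proof (rule that[OF C(1)])
    fix g :: "'a \<Rightarrow> real" and x :: 'a and s :: real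
    assume [measurable]: "g \<in> borel_measurable borel" and g: "\<And>y. g y \<ge> 0" and s: "s > 0"
    have [measurable]: "ball x s \<in> sets borel" by simp
    have "(\<integral>\<^sup>+z\<in>ball x s. potential \<gamma> g z \<partial>lborel) =
      (\<integral>\<^sup>+z. (\<integral>\<^sup>+y. ennreal (g y * kern \<gamma> (z - y)) * indicator (ball x s) z \<partial>lborel) \<partial>lborel)"
      unfolding potential_def by (intro nn_integral_cong nn_integral_multc[symmetric]) measurable
    also have "\<dots> = (\<integral>\<^sup>+y. (\<integral>\<^sup>+z. ennreal (g y * kern \<gamma> (z - y)) * indicator (ball x s) z \<partial>lborel) \<partial>lborel)"
      by (rule lborel_pair.Fubini') measurable
    also have "\<dots> \<le> (\<integral>\<^sup>+y. ennreal (C * s ^ DIM('a)) * ennreal (g y * kern \<gamma> (x - y)) \<partial>lborel)"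
    proof (rule nn_integral_mono_AE)
      have "AE y in lborel. y \<noteq> x" by (rule AE_lborel_singleton)
      then show "AE y in lborel. (\<integral>\<^sup>+z. ennreal (g y * kern \<gamma> (z - y)) * indicator (ball x s) z \<partial>lborel) \<le>
         ennreal (C * s ^ DIM('a)) * ennreal (g y * kern \<gamma> (x - y))"
      proof eventually_elim
        case (elim y)
        have "(\<integral>\<^sup>+z. ennreal (g y * kern \<gamma> (z - y)) * indicator (ball x s) z \<partial>lborel) =
          (\<integral>\<^sup>+z. ennreal (g y) * (ennreal (kern \<gamma> (y - z)) * indicator (ball x s) z) \<partial>lborel)"
          using g by (intro nn_integral_cong) (simp add: ennreal_mult kern_minus_commute mult.assoc)
        also have "\<dots> = ennreal (g y) * (\<integral>\<^sup>+z\<in>ball x s. ennreal (kern \<gamma> (y - z)) \<partial>lborel)"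
          by (rule nn_integral_cmult) measurable
        also have "\<dots> \<le> ennreal (g y) * ennreal (C * s ^ DIM('a) * kern \<gamma> (y - x))"
          using elim s by (intro mult_left_mono C(2)) auto
        also have "\<dots> = ennreal (C * s ^ DIM('a)) * ennreal (g y * kern \<gamma> (x - y))"
          using g s C(1) by (simp add: kern_minus_commute[of \<gamma> y x] ac_simps flip: ennreal_mult)
        finally show ?case .
      qed
    qed
    also have "\<dots> = ennreal (C * s ^ DIM('a)) * potential \<gamma> g x"
      unfolding potential_def by (rule nn_integral_cmult) measurable
    finally show "(\<integral>\<^sup>+z\<in>ball x s. potential \<gamma> g z \<partial>lborel) \<le> ennreal (C * s ^ DIM('a)) * potential \<gamma> g x" .
  qed
qed

text \<open>By Tonelli the mollifier moves onto the kernel, where it is at most a constant times an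
  average over a ball of radius n \<epsilon>. The bound for kernel averages holds at every radius
  with the same constant, which makes C independent of \<epsilon>.\<close>

lemma potential_mollified:
  assumes "0 < \<gamma>" "\<gamma> < real CARD('n::finite)"
  obtains C where "C > 0"
    "\<And>(g :: real ^ 'n \<Rightarrow> real) x \<epsilon>. g \<in> borel_measurable borel \<Longrightarrow> (\<And>y. g y \<ge> 0) \<Longrightarrow> \<epsilon> > 0 \<Longrightarrow>
      (\<integral>\<^sup>+z. (\<integral>\<^sup>+y. ennreal (g y * moll \<epsilon> (\<lambda>_. 0) (z - y)) \<partial>lborel) * ennreal (kern \<gamma> (x - z)) \<partial>lborel)
        \<le> ennreal C * potential \<gamma> g x"
proof -
  let ?n = "CARD('n)"
  obtain C where C: "C > 0" "\<And>(a::real^'n) b s. s > 0 \<Longrightarrow> a \<noteq> b \<Longrightarrow>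
      (\<integral>\<^sup>+z\<in>ball a s. ennreal (kern \<gamma> (b - z)) \<partial>lborel) \<le> ennreal (C * s ^ ?n * kern \<gamma> (b - a))"
    using kern_average[where 'a="real^'n", of \<gamma>] assms by auto
  obtain B where B: "B > 0" "\<And>\<epsilon> w. \<epsilon> > 0 \<Longrightarrow>
    moll \<epsilon> (\<lambda>_::'n. 0) w \<le> B / \<epsilon> ^ ?n * indicator (ball 0 (real ?n * \<epsilon>)) w"
    using moll_0_le[where 'n='n] by blast
  \<comment> \<open>The ball of radius n \<epsilon> contributes (n \<epsilon>)^n; the power of
    \<epsilon> cancels the height B / \<epsilon>^n of the mollifier bound, and n^n remains.\<close>
  define C' where "C' = B * C * real ?n ^ ?n"
  show thesis
  proof (rule that)
    show "C' > 0" using B C by (simp add: C'_def)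
    fix g :: "real ^ 'n \<Rightarrow> real" and x :: "real ^ 'n" and \<epsilon> :: real
    assume [measurable]: "g \<in> borel_measurable borel" and g: "\<And>y. g y \<ge> 0" and \<epsilon>: "\<epsilon> > 0"
    have "(\<integral>\<^sup>+z. (\<integral>\<^sup>+y. ennreal (g y * moll \<epsilon> (\<lambda>_. 0) (z - y)) \<partial>lborel) * ennreal (kern \<gamma> (x - z)) \<partial>lborel) =
      (\<integral>\<^sup>+z. (\<integral>\<^sup>+y. ennreal (g y * moll \<epsilon> (\<lambda>_. 0) (z - y)) * ennreal (kern \<gamma> (x - z)) \<partial>lborel) \<partial>lborel)"
      by (intro nn_integral_cong nn_integral_multc[symmetric]) measurable
    also have "\<dots> = (\<integral>\<^sup>+y. (\<integral>\<^sup>+z. ennreal (g y * moll \<epsilon> (\<lambda>_. 0) (z - y)) * ennreal (kern \<gamma> (x - z)) \<partial>lborel) \<partial>lborel)"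
      by (rule lborel_pair.Fubini') measurable
    also have "\<dots> \<le> (\<integral>\<^sup>+y. ennreal C' * ennreal (g y * kern \<gamma> (x - y)) \<partial>lborel)"
    proof (rule nn_integral_mono_AE)
      have "AE y in lborel. y \<noteq> x" by (rule AE_lborel_singleton)
      then show "AE y in lborel. (\<integral>\<^sup>+z. ennreal (g y * moll \<epsilon> (\<lambda>_. 0) (z - y)) * ennreal (kern \<gamma> (x - z)) \<partial>lborel)
        \<le> ennreal C' * ennreal (g y * kern \<gamma> (x - y))"
      proof eventually_elim
        case (elim y)
        have [measurable]: "ball y (real ?n * \<epsilon>) \<in> sets borel" by simp
        have "(\<integral>\<^sup>+z. ennreal (g y * moll \<epsilon> (\<lambda>_. 0) (z - y)) * ennreal (kern \<gamma> (x - z)) \<partial>lborel) \<le>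
          (\<integral>\<^sup>+z. ennreal (g y * (B / \<epsilon> ^ ?n)) * (ennreal (kern \<gamma> (x - z)) * indicator (ball y (real ?n * \<epsilon>)) z) \<partial>lborel)"
        proof (rule nn_integral_mono)
          fix z
          have "moll \<epsilon> (\<lambda>_::'n. 0) (z - y) \<le> B / \<epsilon> ^ ?n * indicator (ball y (real ?n * \<epsilon>)) z"
            using B(2)[OF \<epsilon>, of "z - y"] by (simp add: indicator_def dist_norm norm_minus_commute)
          then have "g y * moll \<epsilon> (\<lambda>_. 0) (z - y) * kern \<gamma> (x - z) \<le>
             g y * (B / \<epsilon> ^ ?n * indicator (ball y (real ?n * \<epsilon>)) z) * kern \<gamma> (x - z)"
            using g by (intro mult_right_mono mult_left_mono) auto
          then have "ennreal (g y * moll \<epsilon> (\<lambda>_. 0) (z - y) * kern \<gamma> (x - z)) \<le>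
             ennreal (g y * (B / \<epsilon> ^ ?n * indicator (ball y (real ?n * \<epsilon>)) z) * kern \<gamma> (x - z))"
            by (rule ennreal_leI)
          then show "ennreal (g y * moll \<epsilon> (\<lambda>_. 0) (z - y)) * ennreal (kern \<gamma> (x - z)) \<le>
             ennreal (g y * (B / \<epsilon> ^ ?n)) * (ennreal (kern \<gamma> (x - z)) * indicator (ball y (real ?n * \<epsilon>)) z)"
            by (cases "z \<in> ball y (real ?n * \<epsilon>)") (simp_all flip: ennreal_mult'')
        qed
        also have "\<dots> = ennreal (g y * (B / \<epsilon> ^ ?n)) * (\<integral>\<^sup>+z\<in>ball y (real ?n * \<epsilon>). ennreal (kern \<gamma> (x - z)) \<partial>lborel)"
          by (rule nn_integral_cmult) measurable
        also have "\<dots> \<le> ennreal (g y * (B / \<epsilon> ^ ?n)) * ennreal (C * (real ?n * \<epsilon>) ^ ?n * kern \<gamma> (x - y))"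
          using elim \<epsilon> by (intro mult_left_mono C(2)) auto
        also have "\<dots> = ennreal (g y * (B / \<epsilon> ^ ?n) * (C * (real ?n * \<epsilon>) ^ ?n * kern \<gamma> (x - y)))"
          using g B(1) C(1) \<epsilon> by (intro ennreal_mult[symmetric]) auto
        also have "g y * (B / \<epsilon> ^ ?n) * (C * (real ?n * \<epsilon>) ^ ?n * kern \<gamma> (x - y)) = C' * (g y * kern \<gamma> (x - y))"
          using \<epsilon> by (simp add: C'_def power_mult_distrib)
        also have "ennreal \<dots> = ennreal C' * ennreal (g y * kern \<gamma> (x - y))"
          using g B(1) C(1) by (intro ennreal_mult) (auto simp: C'_def)
        finally show ?case .
      qed
    qed
    also have "\<dots> = ennreal C' * potential \<gamma> g x"
      unfolding potential_def by (rule nn_integral_cmult) measurable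
    finally show "(\<integral>\<^sup>+z. (\<integral>\<^sup>+y. ennreal (g y * moll \<epsilon> (\<lambda>_. 0) (z - y)) \<partial>lborel) * ennreal (kern \<gamma> (x - z)) \<partial>lborel)
        \<le> ennreal C' * potential \<gamma> g x" .
  qed
qed

text \<open>When the ray inequality is averaged over all directions, the endpoints sweep out
  \<open>ball w r\<close> and the remainders add up to a truncated Riesz potential. Both are bounded
  by the full potential of H at w.\<close>

lemma riesz_bound_from_rays:
  fixes H :: "'a::euclidean_space \<Rightarrow> real" and w :: 'a
  assumes [measurable]: "H \<in> borel_measurable borel" and H: "\<And>z. H z \<ge> 0"
    and m: "m > 0" "m < DIM('a)" and r: "r > 0" and A: "A \<ge> 0"
    and ray: "\<And>e. norm e < 1 \<Longrightarrow> ennreal u \<le> ennreal (A * H (w + r *\<^sub>R e)) +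
      ennreal A * (\<integral>\<^sup>+s. ennreal (s ^ (m - 1)) * ennreal (H (w + s *\<^sub>R e)) * indicator {0..r} s \<partial>lborel)"
  defines "\<gamma> \<equiv> real DIM('a) - real m"
  shows "ennreal (unit_ball_vol (real DIM('a))) * ennreal u \<le>
    ennreal (A * (1 / r ^ m + 1 / \<gamma>)) * (\<integral>\<^sup>+z. ennreal (H z) * ennreal (kern \<gamma> (w - z)) \<partial>lborel)"
proof -
  let ?n = "DIM('a)"
  have \<gamma>: "\<gamma> > 0" using m by (simp add: \<gamma>_def)
  have [measurable]: "ball (0::'a) 1 \<in> sets borel" "ball w r \<in> sets borel" by simp_all
  let ?I = "\<integral>\<^sup>+z. ennreal (H z) * ennreal (kern \<gamma> (w - z)) \<partial>lborel"
  let ?S = "\<lambda>e. \<integral>\<^sup>+s. ennreal (s ^ (m - 1)) * ennreal (H (w + s *\<^sub>R e)) * indicator {0..r} s \<partial>lborel"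
  have ball: "emeasure lborel (ball (0::'a) 1) = ennreal (unit_ball_vol (real ?n))"
    by (simp add: emeasure_ball)
  \<comment> \<open>Endpoint term: on \<open>ball w r\<close> the kernel is at least r^(-\<gamma>),
    so the plain integral of H is at most r^\<gamma> times the potential; together with the Jacobian
    r^(-n) this leaves r^(-m).\<close>
  have 1: "(\<integral>\<^sup>+e\<in>ball 0 1. ennreal (H (w + r *\<^sub>R e)) \<partial>lborel) \<le> ennreal (1 / r ^ m) * ?I"
  proof -
    have "(\<integral>\<^sup>+e\<in>ball 0 1. ennreal (H (w + r *\<^sub>R e)) \<partial>lborel) =
      ennreal (1 / r ^ ?n) * ennreal (r ^ ?n) * (\<integral>\<^sup>+e\<in>ball 0 1. ennreal (H (w + r *\<^sub>R e)) \<partial>lborel)"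
      using r by (simp flip: ennreal_mult)
    also have "\<dots> = ennreal (1 / r ^ ?n) * (\<integral>\<^sup>+z\<in>ball w r. ennreal (H z) \<partial>lborel)"
      using r nn_integral_ball_affine[of "\<lambda>z. ennreal (H z)" r w] by (simp add: mult.assoc)
    also have "(\<integral>\<^sup>+z\<in>ball w r. ennreal (H z) \<partial>lborel) \<le>
      (\<integral>\<^sup>+z. ennreal (r powr \<gamma>) * (ennreal (H z) * ennreal (kern \<gamma> (w - z))) \<partial>lborel)"
    proof (rule nn_integral_mono_AE)
      have "AE z in lborel. z \<noteq> w" by (rule AE_lborel_singleton)
      then show "AE z in lborel. ennreal (H z) * indicator (ball w r) z \<le>
         ennreal (r powr \<gamma>) * (ennreal (H z) * ennreal (kern \<gamma> (w - z)))"
      proof eventually_elim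
        case (elim z)
        show ?case
        proof (cases "z \<in> ball w r")
          case True
          then have "norm (w - z) powr \<gamma> \<le> r powr \<gamma>"
            using \<gamma> by (intro powr_mono2) (auto simp: dist_norm)
          then have "1 \<le> r powr \<gamma> * kern \<gamma> (w - z)"
            using elim by (simp add: kern_def field_simps)
          then have "H z * 1 \<le> H z * (r powr \<gamma> * kern \<gamma> (w - z))"
            using H by (intro mult_left_mono) auto
          then have "ennreal (H z) \<le> ennreal (r powr \<gamma> * (H z * kern \<gamma> (w - z)))"
            by (intro ennreal_leI) (simp add: ac_simps)
          then show ?thesis using True H by (simp add: ennreal_mult)
        qed simp
      qed
    qed
    also have "\<dots> = ennreal (r powr \<gamma>) * ?I"
      by (rule nn_integral_cmult) measurable
    finally have "(\<integral>\<^sup>+e\<in>ball 0 1. ennreal (H (w + r *\<^sub>R e)) \<partial>lborel) \<le>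
       ennreal (1 / r ^ ?n) * (ennreal (r powr \<gamma>) * ?I)"
      by (simp add: mult_left_mono)
    also have "\<dots> = ennreal (1 / r ^ m) * ?I"
    proof -
      have "1 / r ^ ?n * r powr \<gamma> = 1 / r ^ m"
        using r by (simp add: \<gamma>_def powr_diff powr_realpow)
      then show ?thesis using r by (simp add: mult.assoc[symmetric] flip: ennreal_mult)
    qed
    finally show ?thesis .
  qed
  \<comment> \<open>Remainder term: exchanging s and z leaves, for each z, the integral of
    s^(-\<gamma>-1) over |w - z| < s <= r. Dropping the upper limit and applying the layer cake
    formula gives the kernel divided by \<gamma>.\<close>
  have 2: "(\<integral>\<^sup>+e\<in>ball 0 1. ?S e \<partial>lborel) \<le> ennreal (1 / \<gamma>) * ?I"
  proof -
    have eq: "ennreal (s ^ (m - 1)) * ennreal (1 / s ^ ?n) = ennreal (s powr (- \<gamma> - 1))" if "s > 0" for s :: real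
    proof -
      have "s ^ (m - 1) * (1 / s ^ ?n) = s powr (real (m - 1) - ?n)"
        using that by (simp add: powr_diff powr_realpow)
      also have "real (m - 1) - ?n = - \<gamma> - 1"
        using m by (simp add: \<gamma>_def of_nat_diff)
      finally show ?thesis using that by (simp flip: ennreal_mult)
    qed
    have "(\<integral>\<^sup>+e\<in>ball 0 1. ?S e \<partial>lborel) =
       (\<integral>\<^sup>+s. ennreal (s ^ (m - 1)) * ennreal (1 / s ^ ?n) * (\<integral>\<^sup>+z\<in>ball w s. ennreal (H z) \<partial>lborel) * indicator {0<..r} s \<partial>lborel)"
      by (rule ray_fubini) measurable
    \<comment> \<open>\<open>ball w s\<close> is rewritten as a section of an open set of pairs,
      since Tonelli asks for joint measurability in s and z.\<close>
    also have "\<dots> = (\<integral>\<^sup>+s. (\<integral>\<^sup>+z. ennreal (s powr (- \<gamma> - 1)) * indicator {0<..r} s * (ennreal (H z) * indicator {p. norm (w - snd p) < fst p} (s, z)) \<partial>lborel) \<partial>lborel)"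
    proof (rule nn_integral_cong)
      fix s :: real
      have "indicator {p. norm (w - snd p) < fst p} (s, z) = (indicator (ball w s) z :: ennreal)" for z
        by (simp add: indicator_def dist_norm)
      moreover have [measurable]: "ball w s \<in> sets borel" by simp
      ultimately have "(\<integral>\<^sup>+z. ennreal (s powr (- \<gamma> - 1)) * indicator {0<..r} s * (ennreal (H z) * indicator {p. norm (w - snd p) < fst p} (s, z)) \<partial>lborel) =
        ennreal (s powr (- \<gamma> - 1)) * indicator {0<..r} s * (\<integral>\<^sup>+z\<in>ball w s. ennreal (H z) \<partial>lborel)"
        by (simp only:) (rule nn_integral_cmult, measurable)
      then show "ennreal (s ^ (m - 1)) * ennreal (1 / s ^ ?n) * (\<integral>\<^sup>+z\<in>ball w s. ennreal (H z) \<partial>lborel) * indicator {0<..r} s =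
        (\<integral>\<^sup>+z. ennreal (s powr (- \<gamma> - 1)) * indicator {0<..r} s * (ennreal (H z) * indicator {p. norm (w - snd p) < fst p} (s, z)) \<partial>lborel)"
        using eq[of s] by (cases "s \<in> {0<..r}") simp_all
    qed
    also have "\<dots> = (\<integral>\<^sup>+z. (\<integral>\<^sup>+s. ennreal (s powr (- \<gamma> - 1)) * indicator {0<..r} s * (ennreal (H z) * indicator {p. norm (w - snd p) < fst p} (s, z)) \<partial>lborel) \<partial>lborel)"
    proof (rule lborel_pair.Fubini')
      have "open {p :: 'a \<times> real. norm (w - fst p) < snd p}"
        by (intro open_Collect_less continuous_intros)
      then have [measurable]: "{p :: 'a \<times> real. norm (w - fst p) < snd p} \<in> sets (lborel \<Otimes>\<^sub>M lborel)"
        by (simp only: sets_lborel_pair borel_open)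
      have eq: "(\<lambda>(z, s). ennreal (s powr (- \<gamma> - 1)) * indicator {0<..r} s * (ennreal (H z) * indicator {p. norm (w - snd p) < fst p} (s, z))) =
        (\<lambda>p. ennreal (snd p powr (- \<gamma> - 1)) * indicator {0<..r} (snd p) * (ennreal (H (fst p)) * indicator {p. norm (w - fst p) < snd p} p))"
        by (auto simp: fun_eq_iff indicator_def)
      show "(\<lambda>(z, s). ennreal (s powr (- \<gamma> - 1)) * indicator {0<..r} s * (ennreal (H z) * indicator {p. norm (w - snd p) < fst p} (s, z)))
        \<in> borel_measurable (lborel \<Otimes>\<^sub>M lborel)"
        unfolding eq by measurable
    qed
    also have "\<dots> \<le> (\<integral>\<^sup>+z. ennreal (1 / \<gamma>) * (ennreal (H z) * ennreal (kern \<gamma> (w - z))) \<partial>lborel)"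
    proof (rule nn_integral_mono_AE)
      have "AE z in lborel. z \<noteq> w" by (rule AE_lborel_singleton)
      then show "AE z in lborel. (\<integral>\<^sup>+s. ennreal (s powr (- \<gamma> - 1)) * indicator {0<..r} s * (ennreal (H z) * indicator {p. norm (w - snd p) < fst p} (s, z)) \<partial>lborel)
        \<le> ennreal (1 / \<gamma>) * (ennreal (H z) * ennreal (kern \<gamma> (w - z)))"
      proof eventually_elim
        case (elim z)
        have "(\<integral>\<^sup>+s. ennreal (s powr (- \<gamma> - 1)) * indicator {0<..r} s * (ennreal (H z) * indicator {p. norm (w - snd p) < fst p} (s, z)) \<partial>lborel)
          \<le> (\<integral>\<^sup>+s. ennreal (1 / \<gamma>) * ennreal (H z) * (ennreal (\<gamma> * s powr (- \<gamma> - 1)) * indicator {norm (w - z)..} s) \<partial>lborel)"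
        proof (rule nn_integral_mono)
          fix s :: real
          have "ennreal (s powr (- \<gamma> - 1)) = ennreal (1 / \<gamma>) * ennreal (\<gamma> * s powr (- \<gamma> - 1))"
            using \<gamma> by (simp flip: ennreal_mult)
          then show "ennreal (s powr (- \<gamma> - 1)) * indicator {0<..r} s * (ennreal (H z) * indicator {p. norm (w - snd p) < fst p} (s, z))
            \<le> ennreal (1 / \<gamma>) * ennreal (H z) * (ennreal (\<gamma> * s powr (- \<gamma> - 1)) * indicator {norm (w - z)..} s)"
            by (auto simp: indicator_def ac_simps)
        qed
        also have "\<dots> = ennreal (1 / \<gamma>) * ennreal (H z) * ennreal (kern \<gamma> (w - z))"
          using elim \<gamma> by (subst nn_integral_cmult) (simp_all add: kern_layer_cake)
        finally show ?case by (simp add: mult.assoc)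
      qed
    qed
    also have "\<dots> = ennreal (1 / \<gamma>) * ?I"
      by (rule nn_integral_cmult) measurable
    finally show ?thesis .
  qed
  have "ennreal (unit_ball_vol (real ?n)) * ennreal u = (\<integral>\<^sup>+e\<in>ball (0::'a) 1. ennreal u \<partial>lborel)"
    by (subst nn_integral_cmult_indicator) (auto simp: ball mult.commute)
  also have "\<dots> \<le> (\<integral>\<^sup>+e. ennreal A * (ennreal (H (w + r *\<^sub>R e)) * indicator (ball 0 1) e) + ennreal A * (?S e * indicator (ball 0 1) e) \<partial>lborel)"
  proof (rule nn_integral_mono)
    fix e :: 'a
    show "ennreal u * indicator (ball 0 1) e \<le> ennreal A * (ennreal (H (w + r *\<^sub>R e)) * indicator (ball 0 1) e) + ennreal A * (?S e * indicator (ball 0 1) e)"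
      using ray[of e] A H by (cases "e \<in> ball 0 1") (simp_all add: ennreal_mult)
  qed
  also have "\<dots> = ennreal A * (\<integral>\<^sup>+e\<in>ball 0 1. ennreal (H (w + r *\<^sub>R e)) \<partial>lborel) + ennreal A * (\<integral>\<^sup>+e\<in>ball 0 1. ?S e \<partial>lborel)"
  proof -
    have [measurable]: "?S \<in> borel_measurable borel" by measurable
    show ?thesis
      by (subst nn_integral_add) (simp_all add: nn_integral_cmult)
  qed
  also have "\<dots> \<le> ennreal A * (ennreal (1 / r ^ m) * ?I) + ennreal A * (ennreal (1 / \<gamma>) * ?I)"
    by (intro add_mono mult_left_mono 1 2) auto
  also have "\<dots> = ennreal (A * (1 / r ^ m + 1 / \<gamma>)) * ?I"
  proof -
    have "ennreal (A * (1 / r ^ m + 1 / \<gamma>)) = ennreal A * ennreal (1 / r ^ m) + ennreal A * ennreal (1 / \<gamma>)"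
      using A r \<gamma> by (subst ennreal_mult) (simp_all add: distrib_left)
    then show ?thesis by (simp only: distrib_right mult.assoc)
  qed
  finally show ?thesis .
qed

text \<open>D plays the role of the size of the gradient. It enters only through integrals over
  balls centred at x, which is what the potential at x controls. The factor s^n in
  \<open>avg\<close> cancels the Jacobian, and integrating over 0 < s <= \<rho> gives the additional
  power of \<rho>.\<close>

lemma ball_oscillation_from_rays:
  fixes u :: "'a::euclidean_space \<Rightarrow> real" and x :: 'a
  assumes [measurable]: "u \<in> borel_measurable borel" "D \<in> borel_measurable borel"
    and \<rho>: "\<rho> > 0"
    and ray: "\<And>e. norm e < 1 \<Longrightarrow> ennreal \<bar>u x - u (x + \<rho> *\<^sub>R e)\<bar> \<le> (\<integral>\<^sup>+s. D (x + s *\<^sub>R e) * indicator {0..\<rho>} s \<partial>lborel)"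
    and avg: "\<And>s. 0 < s \<Longrightarrow> s \<le> \<rho> \<Longrightarrow> (\<integral>\<^sup>+z\<in>ball x s. D z \<partial>lborel) \<le> ennreal (s ^ DIM('a)) * M"
  shows "(\<integral>\<^sup>+z\<in>ball x \<rho>. ennreal \<bar>u x - u z\<bar> \<partial>lborel) \<le> ennreal (\<rho> ^ (DIM('a) + 1)) * M"
proof -
  let ?n = "DIM('a)"
  have "(\<integral>\<^sup>+z\<in>ball x \<rho>. ennreal \<bar>u x - u z\<bar> \<partial>lborel) =
    ennreal (\<rho> ^ ?n) * (\<integral>\<^sup>+e\<in>ball 0 1. ennreal \<bar>u x - u (x + \<rho> *\<^sub>R e)\<bar> \<partial>lborel)"
    using \<rho> by (intro nn_integral_ball_affine) measurable
  also have "(\<integral>\<^sup>+e\<in>ball 0 1. ennreal \<bar>u x - u (x + \<rho> *\<^sub>R e)\<bar> \<partial>lborel) \<le>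
    (\<integral>\<^sup>+e\<in>ball 0 1. (\<integral>\<^sup>+s. 1 * D (x + s *\<^sub>R e) * indicator {0..\<rho>} s \<partial>lborel) \<partial>lborel)"
  proof (rule nn_integral_mono)
    fix e :: 'a
    show "ennreal \<bar>u x - u (x + \<rho> *\<^sub>R e)\<bar> * indicator (ball 0 1) e \<le>
       (\<integral>\<^sup>+s. 1 * D (x + s *\<^sub>R e) * indicator {0..\<rho>} s \<partial>lborel) * indicator (ball 0 1) e"
      using ray[of e] by (cases "e \<in> ball 0 1") simp_all
  qed
  also have "\<dots> = (\<integral>\<^sup>+s. 1 * ennreal (1 / s ^ ?n) * (\<integral>\<^sup>+z\<in>ball x s. D z \<partial>lborel) * indicator {0<..\<rho>} s \<partial>lborel)"
    by (rule ray_fubini) measurable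
  also have "\<dots> \<le> (\<integral>\<^sup>+s. M * indicator {0<..\<rho>} s \<partial>lborel)"
  proof (rule nn_integral_mono)
    fix s :: real
    show "1 * ennreal (1 / s ^ ?n) * (\<integral>\<^sup>+z\<in>ball x s. D z \<partial>lborel) * indicator {0<..\<rho>} s \<le> M * indicator {0<..\<rho>} s"
    proof (cases "s \<in> {0<..\<rho>}")
      case True
      then have "ennreal (1 / s ^ ?n) * (\<integral>\<^sup>+z\<in>ball x s. D z \<partial>lborel) \<le> ennreal (1 / s ^ ?n) * (ennreal (s ^ ?n) * M)"
        by (intro mult_left_mono avg) auto
      also have "\<dots> = M" using True by (simp add: mult.assoc[symmetric] flip: ennreal_mult)
      finally show ?thesis using True by simp
    qed simp
  qed
  also have "\<dots> = M * ennreal \<rho>"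
    using \<rho> by (subst nn_integral_cmult_indicator) auto
  finally have "(\<integral>\<^sup>+z\<in>ball x \<rho>. ennreal \<bar>u x - u z\<bar> \<partial>lborel) \<le> ennreal (\<rho> ^ ?n) * (M * ennreal \<rho>)"
    by (simp add: mult_left_mono)
  also have "\<dots> = ennreal (\<rho> ^ (?n + 1)) * M"
    using \<rho> by (simp add: ennreal_mult ac_simps)
  finally show ?thesis .
qed

section \<open>Oscillation of mollified functions\<close>

text \<open>Through \<open>eq\<close> the derivatives pass from the mollifier to the functions g; as
  the undifferentiated mollifier is nonnegative, absolute values can then be taken inside the
  integral.\<close>

lemma mconv_sum_le_nn_integral:
  fixes g :: "('n::finite \<Rightarrow> nat) \<Rightarrow> real ^ 'n \<Rightarrow> real"
  assumes g: "\<And>\<alpha>. integrable lborel (g \<alpha>)" and \<epsilon>: "\<epsilon> > 0"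
    and eq: "\<And>\<alpha>. multi_order \<alpha> \<le> k \<Longrightarrow> mconv \<epsilon> f \<alpha> z = mconv \<epsilon> (g \<alpha>) (\<lambda>_. 0) z"
  shows "ennreal (mconv_sum \<epsilon> k f z) \<le>
    (\<integral>\<^sup>+y. ennreal ((\<Sum>\<beta> | multi_order \<beta> \<le> k. \<bar>g \<beta> y\<bar>) * moll \<epsilon> (\<lambda>_. 0) (z - y)) \<partial>lborel)"
proof -
  let ?g = "\<lambda>y. \<Sum>\<beta> | multi_order \<beta> \<le> k. \<bar>g \<beta> y\<bar>"
  have gs: "integrable lborel ?g"
    using g by (intro Bochner_Integration.integrable_sum integrable_abs)
  have nonneg: "?g y \<ge> 0" for y by (intro sum_nonneg) auto
  have "mconv_sum \<epsilon> k f z = (\<Sum>\<beta> | multi_order \<beta> \<le> k. \<bar>mconv \<epsilon> (g \<beta>) (\<lambda>_. 0) z\<bar>)"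
    unfolding mconv_sum_def using eq by (intro sum.cong) auto
  also have "\<dots> \<le> (\<Sum>\<beta> | multi_order \<beta> \<le> k. mconv \<epsilon> (\<lambda>y. \<bar>g \<beta> y\<bar>) (\<lambda>_. 0) z)"
  proof (rule sum_mono)
    fix \<beta>
    have "\<bar>mconv \<epsilon> (g \<beta>) (\<lambda>_. 0) z\<bar> \<le> (LINT y|lborel. \<bar>g \<beta> y * moll \<epsilon> (\<lambda>_. 0) (z - y)\<bar>)"
      unfolding mconv_def by (rule integral_abs_bound)
    also have "\<dots> = mconv \<epsilon> (\<lambda>y. \<bar>g \<beta> y\<bar>) (\<lambda>_. 0) z"
      unfolding mconv_def
      by (intro Bochner_Integration.integral_cong) (auto simp: abs_mult moll_0_nonneg[OF \<epsilon>])
    finally show "\<bar>mconv \<epsilon> (g \<beta>) (\<lambda>_. 0) z\<bar> \<le> mconv \<epsilon> (\<lambda>y. \<bar>g \<beta> y\<bar>) (\<lambda>_. 0) z" .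
  qed
  also have "\<dots> = (LINT y|lborel. ?g y * moll \<epsilon> (\<lambda>_. 0) (z - y))"
    unfolding mconv_def sum_distrib_right
    using g by (intro Bochner_Integration.integral_sum[symmetric] mconv_integrable integrable_abs)
  finally have "ennreal (mconv_sum \<epsilon> k f z) \<le> ennreal (LINT y|lborel. ?g y * moll \<epsilon> (\<lambda>_. 0) (z - y))"
    by (rule ennreal_leI)
  also have "\<dots> = (\<integral>\<^sup>+y. ennreal (?g y * moll \<epsilon> (\<lambda>_. 0) (z - y)) \<partial>lborel)"
    using nonneg
    by (intro nn_integral_eq_integral[symmetric] mconv_integrable[OF gs])
      (auto intro!: mult_nonneg_nonneg simp: moll_0_nonneg[OF \<epsilon>])
  finally show ?thesis .
qed

lemma norm_scaleR_less:
  fixes e :: "'a::real_normed_vector"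
  assumes "norm e < 1" "0 \<le> s" "s \<le> r" "0 < r"
  shows "norm (s *\<^sub>R e) < r"
proof -
  have "norm (s *\<^sub>R e) \<le> r * norm e" using assms by (simp add: mult_right_mono)
  also have "\<dots> < r" using assms by simp
  finally show ?thesis .
qed

text \<open>A first derivative of the mollification is expanded along rays by m further derivatives,
  up to total order m + 1. The functions \<open>g \<alpha>\<close> stand for the weak derivatives of
  f. The point is that K depends only on n, m and r, and not on \<epsilon>.\<close>

lemma mollified_gradient_bound:
  fixes m :: nat and r :: real
  assumes m: "0 < m" "m < CARD('n::finite)" and r: "r > 0"
  obtains K where "K > 0"
    "\<And>(f :: real ^ 'n \<Rightarrow> real) g \<epsilon> w i. integrable lborel f \<Longrightarrow> (\<And>\<alpha>. integrable lborel (g \<alpha>)) \<Longrightarrow> \<epsilon> > 0 \<Longrightarrow>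
      (\<And>\<alpha> z. multi_order \<alpha> \<le> m + 1 \<Longrightarrow> z \<in> ball w r \<Longrightarrow> mconv \<epsilon> f \<alpha> z = mconv \<epsilon> (g \<alpha>) (\<lambda>_. 0) z) \<Longrightarrow>
      ennreal \<bar>mconv \<epsilon> f (inc i (\<lambda>_. 0)) w\<bar> \<le> ennreal K *
        potential (real CARD('n) - real m) (\<lambda>y. \<Sum>\<beta> | multi_order \<beta> \<le> m + 1. \<bar>g \<beta> y\<bar>) w"
proof -
  let ?n = "CARD('n)"
  define \<gamma> where "\<gamma> = real ?n - real m"
  have \<gamma>: "0 < \<gamma>" "\<gamma> < real ?n" using m by (auto simp: \<gamma>_def)
  obtain C where C: "C > 0" "\<And>(g :: real ^ 'n \<Rightarrow> real) x \<epsilon>. g \<in> borel_measurable borel \<Longrightarrow> (\<And>y. g y \<ge> 0) \<Longrightarrow> \<epsilon> > 0 \<Longrightarrow>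
      (\<integral>\<^sup>+z. (\<integral>\<^sup>+y. ennreal (g y * moll \<epsilon> (\<lambda>_. 0) (z - y)) \<partial>lborel) * ennreal (kern \<gamma> (x - z)) \<partial>lborel)
        \<le> ennreal C * potential \<gamma> g x"
    using potential_mollified[OF \<gamma>] by blast
  define \<omega> where "\<omega> = unit_ball_vol (real ?n)"
  have \<omega>: "\<omega> > 0" by (simp add: \<omega>_def)
  \<comment> \<open>The sum collects the endpoint terms of order j < m, and the last summand belongs
    to the remainder; n^j counts the terms of a j-fold directional derivative.\<close>
  define A where "A = (\<Sum>j<m. r ^ j * real ?n ^ j) + real ?n ^ m"
  have A: "A > 0" unfolding A_def using r by (intro add_nonneg_pos sum_nonneg) auto
  have Am: "real ?n ^ m \<le> A" unfolding A_def using r by (auto intro!: sum_nonneg)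
  define B where "B = A * (1 / r ^ m + 1 / \<gamma>)"
  define K where "K = B * C / \<omega>"
  have K0: "B > 0" unfolding B_def using A r \<gamma> by (intro mult_pos_pos add_pos_pos) auto
  show thesis
  proof (rule that)
    show "K > 0" unfolding K_def by (rule divide_pos_pos[OF mult_pos_pos[OF K0 C(1)] \<omega>])
    fix f :: "real ^ 'n \<Rightarrow> real" and g :: "('n \<Rightarrow> nat) \<Rightarrow> real ^ 'n \<Rightarrow> real" and \<epsilon> :: real and w :: "real ^ 'n" and i
    assume f: "integrable lborel f" and g: "\<And>\<alpha>. integrable lborel (g \<alpha>)" and \<epsilon>: "\<epsilon> > 0"
      and eq: "\<And>\<alpha> z. multi_order \<alpha> \<le> m + 1 \<Longrightarrow> z \<in> ball w r \<Longrightarrow> mconv \<epsilon> f \<alpha> z = mconv \<epsilon> (g \<alpha>) (\<lambda>_. 0) z"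
    have [measurable]: "f \<in> borel_measurable borel" "g \<alpha> \<in> borel_measurable borel" for \<alpha>
      using f g[of \<alpha>] by auto
    have [measurable]: "ball w r \<in> sets borel" by simp
    let ?g = "\<lambda>y. \<Sum>\<beta> | multi_order \<beta> \<le> m + 1. \<bar>g \<beta> y\<bar>"
    have g0: "?g y \<ge> 0" for y by (intro sum_nonneg) auto
    \<comment> \<open>The cutoff confines H to the ball swept out by the rays, the only place where
      mollified weak derivatives are known to be the derivatives of the mollification.\<close>
    define H where "H z = indicator (ball w r) z * mconv_sum \<epsilon> (m + 1) f z" for z
    have [measurable]: "H \<in> borel_measurable borel" unfolding H_def by measurable
    have H0: "H z \<ge> 0" for z by (simp add: H_def mconv_sum_nonneg)
    have Heq: "H (w + s *\<^sub>R e) = mconv_sum \<epsilon> (m + 1) f (w + s *\<^sub>R e)"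
      if "norm e < 1" "0 \<le> s" "s \<le> r" for s e
      using norm_scaleR_less[OF that r] by (simp add: H_def dist_norm)
    let ?u = "\<bar>mconv \<epsilon> f (inc i (\<lambda>_. 0)) w\<bar>"
    have "ennreal \<omega> * ennreal ?u \<le>
      ennreal B * (\<integral>\<^sup>+z. ennreal (H z) * ennreal (kern \<gamma> (w - z)) \<partial>lborel)"
      unfolding \<omega>_def B_def \<gamma>_def
    proof (rule riesz_bound_from_rays[where 'a="real^'n", simplified])
      fix e :: "real ^ 'n" assume e: "norm e < 1"
      define v where "v j s = dir_deriv \<epsilon> f e j (inc i (\<lambda>_. 0)) (w + s *\<^sub>R e)" for j s
      have v: "\<bar>v j s\<bar> \<le> real ?n ^ j * H (w + s *\<^sub>R e)" if "j \<le> m" "0 \<le> s" "s \<le> r" for j s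
        unfolding v_def Heq[OF e that(2,3)]
        using e that(1) by (intro dir_deriv_le_mconv_sum) (auto simp: multi_order_def[of "\<lambda>_. 0"])
      have "ennreal \<bar>v 0 0\<bar> \<le> ennreal (\<Sum>j<m. r ^ j * \<bar>v j r\<bar>) +
         (\<integral>\<^sup>+s. ennreal (s ^ (m - 1) * \<bar>v m s\<bar>) * indicator {0..r} s \<partial>lborel)"
        using m r unfolding v_def by (intro taylor_estimate dir_deriv_line_derivative f) auto
      also have "\<dots> \<le> ennreal (A * H (w + r *\<^sub>R e)) +
         ennreal A * (\<integral>\<^sup>+s. ennreal (s ^ (m - 1)) * ennreal (H (w + s *\<^sub>R e)) * indicator {0..r} s \<partial>lborel)"
      proof (rule add_mono)
        have "(\<Sum>j<m. r ^ j * \<bar>v j r\<bar>) \<le> (\<Sum>j<m. r ^ j * (real ?n ^ j * H (w + r *\<^sub>R e)))"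
          using r by (intro sum_mono mult_left_mono v) auto
        also have "\<dots> = (\<Sum>j<m. r ^ j * real ?n ^ j) * H (w + r *\<^sub>R e)"
          by (simp add: sum_distrib_right mult.assoc)
        also have "\<dots> \<le> A * H (w + r *\<^sub>R e)"
          unfolding A_def by (intro mult_right_mono H0) auto
        finally show "ennreal (\<Sum>j<m. r ^ j * \<bar>v j r\<bar>) \<le> ennreal (A * H (w + r *\<^sub>R e))"
          by (rule ennreal_leI)
        have "(\<integral>\<^sup>+s. ennreal (s ^ (m - 1) * \<bar>v m s\<bar>) * indicator {0..r} s \<partial>lborel) \<le>
          (\<integral>\<^sup>+s. ennreal A * (ennreal (s ^ (m - 1)) * ennreal (H (w + s *\<^sub>R e)) * indicator {0..r} s) \<partial>lborel)"
        proof (rule nn_integral_mono)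
          fix s :: real
          show "ennreal (s ^ (m - 1) * \<bar>v m s\<bar>) * indicator {0..r} s \<le>
             ennreal A * (ennreal (s ^ (m - 1)) * ennreal (H (w + s *\<^sub>R e)) * indicator {0..r} s)"
          proof (cases "s \<in> {0..r}")
            case True
            then have "\<bar>v m s\<bar> \<le> A * H (w + s *\<^sub>R e)"
              using v[of m s] mult_right_mono[OF Am H0[of "w + s *\<^sub>R e"]] by auto
            then have "s ^ (m - 1) * \<bar>v m s\<bar> \<le> s ^ (m - 1) * (A * H (w + s *\<^sub>R e))"
              using True by (intro mult_left_mono) auto
            then have "ennreal (s ^ (m - 1) * \<bar>v m s\<bar>) \<le> ennreal (A * (s ^ (m - 1) * H (w + s *\<^sub>R e)))"
              by (intro ennreal_leI) (simp add: ac_simps)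
            also have "\<dots> = ennreal A * (ennreal (s ^ (m - 1)) * ennreal (H (w + s *\<^sub>R e)))"
              using True A H0 by (simp add: ennreal_mult)
            finally show ?thesis using True by simp
          qed simp
        qed
        also have "\<dots> = ennreal A * (\<integral>\<^sup>+s. ennreal (s ^ (m - 1)) * ennreal (H (w + s *\<^sub>R e)) * indicator {0..r} s \<partial>lborel)"
          by (rule nn_integral_cmult) measurable
        finally show "(\<integral>\<^sup>+s. ennreal (s ^ (m - 1) * \<bar>v m s\<bar>) * indicator {0..r} s \<partial>lborel) \<le> \<dots>" .
      qed
      finally show "ennreal ?u \<le> ennreal (A * H (w + r *\<^sub>R e)) +
         ennreal A * (\<integral>\<^sup>+s. ennreal (s ^ (m - Suc 0)) * ennreal (H (w + s *\<^sub>R e)) * indicator {0..r} s \<partial>lborel)"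
        by (simp add: v_def)
    qed (use m r A H0 in auto)
    \<comment> \<open>Inside the ball H is at most the mollification of the sum of the |g \<beta>|,
      outside it is 0; the integral may therefore be extended to the whole space, where the uniform
      bound for mollified potentials applies.\<close>
    also have "(\<integral>\<^sup>+z. ennreal (H z) * ennreal (kern \<gamma> (w - z)) \<partial>lborel) \<le>
      (\<integral>\<^sup>+z. (\<integral>\<^sup>+y. ennreal (?g y * moll \<epsilon> (\<lambda>_. 0) (z - y)) \<partial>lborel) * ennreal (kern \<gamma> (w - z)) \<partial>lborel)"
    proof (intro nn_integral_mono mult_right_mono)
      fix z
      show "ennreal (H z) \<le> (\<integral>\<^sup>+y. ennreal (?g y * moll \<epsilon> (\<lambda>_. 0) (z - y)) \<partial>lborel)"
      proof (cases "z \<in> ball w r")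
        case True
        then show ?thesis using mconv_sum_le_nn_integral[OF g \<epsilon> eq, of "m + 1" z] by (simp add: H_def)
      qed (simp add: H_def)
    qed simp
    also have "\<dots> \<le> ennreal C * potential \<gamma> ?g w"
      using g0 \<epsilon> by (intro C(2)) auto
    finally have le: "ennreal \<omega> * ennreal ?u \<le> ennreal B * (ennreal C * potential \<gamma> ?g w)"
      by (simp add: mult_left_mono)
    have "ennreal ?u = ennreal (1 / \<omega>) * (ennreal \<omega> * ennreal ?u)"
      using \<omega> by (simp flip: ennreal_mult)
    also have "\<dots> \<le> ennreal (1 / \<omega>) * (ennreal B * (ennreal C * potential \<gamma> ?g w))"
      by (intro mult_left_mono le) auto
    also have "\<dots> = ennreal (1 / \<omega> * B * C) * potential \<gamma> ?g w"
      using \<omega> K0 C(1) by (simp add: ennreal_mult mult.assoc del: times_divide_eq_left times_divide_eq_right)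
    also have "1 / \<omega> * B * C = K"
      by (simp add: K_def)
    finally show "ennreal ?u \<le> ennreal K * potential (real ?n - real m) ?g w"
      by (simp add: \<gamma>_def)
  qed
qed

text \<open>The gradient bound is integrated along rays from x, and the averages of the potential
  over balls centred at x are bounded by its value at x. The radius 2 r appears because each point
  of \<open>ball x r\<close> looks at a ball of radius r.\<close>

lemma mollified_oscillation:
  fixes m :: nat and r :: real
  assumes m: "0 < m" "m < CARD('n::finite)" and r: "r > 0"
  obtains A where "A > 0"
    "\<And>(f :: real ^ 'n \<Rightarrow> real) g \<epsilon> x \<rho>. integrable lborel f \<Longrightarrow> (\<And>\<alpha>. integrable lborel (g \<alpha>)) \<Longrightarrow> \<epsilon> > 0 \<Longrightarrow>
      (\<And>\<alpha> z. multi_order \<alpha> \<le> m + 1 \<Longrightarrow> z \<in> ball x (2 * r) \<Longrightarrow> mconv \<epsilon> f \<alpha> z = mconv \<epsilon> (g \<alpha>) (\<lambda>_. 0) z) \<Longrightarrow>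
      0 < \<rho> \<Longrightarrow> \<rho> \<le> r \<Longrightarrow>
      (\<integral>\<^sup>+z\<in>ball x \<rho>. ennreal \<bar>mconv \<epsilon> f (\<lambda>_. 0) x - mconv \<epsilon> f (\<lambda>_. 0) z\<bar> \<partial>lborel) \<le>
        ennreal (\<rho> ^ (CARD('n) + 1)) * (ennreal A *
          potential (real CARD('n) - real m) (\<lambda>y. \<Sum>\<beta> | multi_order \<beta> \<le> m + 1. \<bar>g \<beta> y\<bar>) x)"
proof -
  let ?n = "CARD('n)"
  define \<gamma> where "\<gamma> = real ?n - real m"
  have \<gamma>: "0 < \<gamma>" "\<gamma> < real ?n" using m by (auto simp: \<gamma>_def)
  obtain K where K: "K > 0"
    "\<And>(f :: real ^ 'n \<Rightarrow> real) g \<epsilon> w i. integrable lborel f \<Longrightarrow> (\<And>\<alpha>. integrable lborel (g \<alpha>)) \<Longrightarrow> \<epsilon> > 0 \<Longrightarrow>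
      (\<And>\<alpha> z. multi_order \<alpha> \<le> m + 1 \<Longrightarrow> z \<in> ball w r \<Longrightarrow> mconv \<epsilon> f \<alpha> z = mconv \<epsilon> (g \<alpha>) (\<lambda>_. 0) z) \<Longrightarrow>
      ennreal \<bar>mconv \<epsilon> f (inc i (\<lambda>_. 0)) w\<bar> \<le> ennreal K *
        potential \<gamma> (\<lambda>y. \<Sum>\<beta> | multi_order \<beta> \<le> m + 1. \<bar>g \<beta> y\<bar>) w"
  proof (rule mollified_gradient_bound[OF m r, folded \<gamma>_def], goal_cases)
    case (1 K)
    show thesis by (rule 1(1)[OF 1(2-)])
  qed
  obtain C where C: "C > 0" "\<And>(g :: real ^ 'n \<Rightarrow> real) x s. g \<in> borel_measurable borel \<Longrightarrow> (\<And>y. g y \<ge> 0) \<Longrightarrow> s > 0 \<Longrightarrow>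
      (\<integral>\<^sup>+z\<in>ball x s. potential \<gamma> g z \<partial>lborel) \<le> ennreal (C * s ^ ?n) * potential \<gamma> g x"
    using potential_average[where 'a="real^'n", of \<gamma>] \<gamma> by auto
  show thesis
  proof (rule that)
    show "real ?n * K * C > 0" using K C by simp
    fix f :: "real ^ 'n \<Rightarrow> real" and g :: "('n \<Rightarrow> nat) \<Rightarrow> real ^ 'n \<Rightarrow> real" and \<epsilon> \<rho> :: real and x :: "real ^ 'n"
    assume f: "integrable lborel f" and g: "\<And>\<alpha>. integrable lborel (g \<alpha>)" and \<epsilon>: "\<epsilon> > 0"
      and eq: "\<And>\<alpha> z. multi_order \<alpha> \<le> m + 1 \<Longrightarrow> z \<in> ball x (2 * r) \<Longrightarrow> mconv \<epsilon> f \<alpha> z = mconv \<epsilon> (g \<alpha>) (\<lambda>_. 0) z"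
      and \<rho>: "0 < \<rho>" "\<rho> \<le> r"
    have [measurable]: "f \<in> borel_measurable borel" "g \<alpha> \<in> borel_measurable borel" for \<alpha>
      using f g[of \<alpha>] by auto
    let ?g = "\<lambda>y. \<Sum>\<beta> | multi_order \<beta> \<le> m + 1. \<bar>g \<beta> y\<bar>"
    have g0: "?g y \<ge> 0" for y by (intro sum_nonneg) auto
    \<comment> \<open>The factor n comes from bounding a directional derivative by the sum of the n
      partial derivatives.\<close>
    define D where "D z = ennreal (real ?n * K) * potential \<gamma> ?g z" for z
    have [measurable]: "D \<in> borel_measurable borel" unfolding D_def by measurable
    have grad: "ennreal \<bar>mconv \<epsilon> f (inc i (\<lambda>_. 0)) w\<bar> \<le> ennreal K * potential \<gamma> ?g w" if w: "w \<in> ball x r" for w i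
    proof (rule K(2)[OF f g \<epsilon>])
      fix \<alpha> :: "'n \<Rightarrow> nat" and z assume "multi_order \<alpha> \<le> m + 1" "z \<in> ball w r"
      moreover have "dist x z < 2 * r" using w \<open>z \<in> ball w r\<close> dist_triangle[of x z w] by simp
      ultimately show "mconv \<epsilon> f \<alpha> z = mconv \<epsilon> (g \<alpha>) (\<lambda>_. 0) z" by (intro eq) auto
    qed
    have "(\<integral>\<^sup>+z\<in>ball x \<rho>. ennreal \<bar>mconv \<epsilon> f (\<lambda>_. 0) x - mconv \<epsilon> f (\<lambda>_. 0) z\<bar> \<partial>lborel) \<le>
      ennreal (\<rho> ^ (DIM(real ^ 'n) + 1)) * (ennreal (real ?n * K * C) * potential \<gamma> ?g x)"
    proof (rule ball_oscillation_from_rays)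
      show "mconv \<epsilon> f (\<lambda>_. 0) \<in> borel_measurable borel" "D \<in> borel_measurable borel" by measurable
      fix s :: real assume s: "0 < s" "s \<le> \<rho>"
      have [measurable]: "ball x s \<in> sets borel" by simp
      have "(\<integral>\<^sup>+z\<in>ball x s. D z \<partial>lborel) = ennreal (real ?n * K) * (\<integral>\<^sup>+z\<in>ball x s. potential \<gamma> ?g z \<partial>lborel)"
        unfolding D_def mult.assoc by (rule nn_integral_cmult) measurable
      also have "\<dots> \<le> ennreal (real ?n * K) * (ennreal (C * s ^ ?n) * potential \<gamma> ?g x)"
        using g0 s by (intro mult_left_mono C(2)) auto
      also have "\<dots> = ennreal (s ^ DIM(real ^ 'n)) * (ennreal (real ?n * K * C) * potential \<gamma> ?g x)"
        using K C s by (simp add: ennreal_mult ac_simps)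
      finally show "(\<integral>\<^sup>+z\<in>ball x s. D z \<partial>lborel) \<le> ennreal (s ^ DIM(real ^ 'n)) * (ennreal (real ?n * K * C) * potential \<gamma> ?g x)" .
    next
      fix e :: "real ^ 'n" assume e: "norm e < 1"
      \<comment> \<open>Subtracting the value at the far end in order 0 makes the boundary term of
        \<open>taylor_estimate\<close> with m = 1 vanish, so that only the integral of the
        derivative remains.\<close>
      define v where "v j s = dir_deriv \<epsilon> f e j (\<lambda>_. 0) (x + s *\<^sub>R e) -
        (if j = 0 then mconv \<epsilon> f (\<lambda>_. 0) (x + \<rho> *\<^sub>R e) else 0)" for j s
      have v': "(v j has_real_derivative v (Suc j) t) (at t)" for j t
      proof -
        have "(v j has_real_derivative dir_deriv \<epsilon> f e (Suc j) (\<lambda>_. 0) (x + t *\<^sub>R e) - 0) (at t)"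
          unfolding v_def by (intro DERIV_diff dir_deriv_line_derivative f DERIV_const)
        then show ?thesis by (simp add: v_def)
      qed
      have v1: "ennreal \<bar>v 1 s\<bar> \<le> D (x + s *\<^sub>R e)" if s: "0 \<le> s" "s \<le> \<rho>" for s
      proof -
        have w: "x + s *\<^sub>R e \<in> ball x r"
          using norm_scaleR_less[OF e, of s r] s \<rho> r by (simp add: dist_norm)
        have "\<bar>v 1 s\<bar> \<le> (\<Sum>i\<in>UNIV. \<bar>e $ i\<bar> * \<bar>mconv \<epsilon> f (inc i (\<lambda>_. 0)) (x + s *\<^sub>R e)\<bar>)"
          by (simp add: v_def flip: abs_mult)
        also have "\<dots> \<le> (\<Sum>i\<in>UNIV. 1 * \<bar>mconv \<epsilon> f (inc i (\<lambda>_. 0)) (x + s *\<^sub>R e)\<bar>)"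
          using order_trans[OF component_le_norm_cart less_imp_le[OF e]]
          by (intro sum_mono mult_right_mono) auto
        finally have "ennreal \<bar>v 1 s\<bar> \<le> ennreal (\<Sum>i\<in>UNIV. \<bar>mconv \<epsilon> f (inc i (\<lambda>_. 0)) (x + s *\<^sub>R e)\<bar>)"
          by (simp add: ennreal_leI)
        also have "\<dots> = (\<Sum>i\<in>UNIV. ennreal \<bar>mconv \<epsilon> f (inc i (\<lambda>_. 0)) (x + s *\<^sub>R e)\<bar>)"
          by (intro sum_ennreal[symmetric]) auto
        also have "\<dots> \<le> (\<Sum>i\<in>(UNIV :: 'n set). ennreal K * potential \<gamma> ?g (x + s *\<^sub>R e))"
          by (intro sum_mono grad w)
        also have "\<dots> = D (x + s *\<^sub>R e)"
          using K(1) by (simp add: D_def ennreal_mult mult.assoc ennreal_of_nat_eq_real_of_nat)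
        finally show ?thesis .
      qed
      have "ennreal \<bar>v 0 0\<bar> \<le> ennreal (\<Sum>j<1. \<rho> ^ j * \<bar>v j \<rho>\<bar>) +
         (\<integral>\<^sup>+s. ennreal (s ^ (1 - 1) * \<bar>v 1 s\<bar>) * indicator {0..\<rho>} s \<partial>lborel)"
        using \<rho> by (intro taylor_estimate v') auto
      also have "\<dots> = (\<integral>\<^sup>+s. ennreal \<bar>v 1 s\<bar> * indicator {0..\<rho>} s \<partial>lborel)"
        by (simp add: v_def)
      also have "\<dots> \<le> (\<integral>\<^sup>+s. D (x + s *\<^sub>R e) * indicator {0..\<rho>} s \<partial>lborel)"
      proof (rule nn_integral_mono)
        fix s :: real
        show "ennreal \<bar>v 1 s\<bar> * indicator {0..\<rho>} s \<le> D (x + s *\<^sub>R e) * indicator {0..\<rho>} s"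
          using v1[of s] by (cases "s \<in> {0..\<rho>}") auto
      qed
      finally show "ennreal \<bar>mconv \<epsilon> f (\<lambda>_. 0) x - mconv \<epsilon> f (\<lambda>_. 0) (x + \<rho> *\<^sub>R e)\<bar> \<le>
         (\<integral>\<^sup>+s. D (x + s *\<^sub>R e) * indicator {0..\<rho>} s \<partial>lborel)"
        by (simp add: v_def)
    qed (rule \<rho>)
    then show "(\<integral>\<^sup>+z\<in>ball x \<rho>. ennreal \<bar>mconv \<epsilon> f (\<lambda>_. 0) x - mconv \<epsilon> f (\<lambda>_. 0) z\<bar> \<partial>lborel) \<le>
        ennreal (\<rho> ^ (?n + 1)) * (ennreal (real ?n * K * C) *
          potential (real ?n - real m) ?g x)"
      by (simp add: \<gamma>_def)
  qed
qed

section \<open>Removing the mollification\<close>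

lemma moll_translated:
  fixes y :: "real ^ 'n::finite"
  assumes \<epsilon>: "\<epsilon> > 0"
  shows "integrable lborel (\<lambda>z. moll \<epsilon> (\<lambda>_. 0) (z - y))" "(LINT z|lborel. moll \<epsilon> (\<lambda>_. 0) (z - y)) = 1"
proof -
  have "(\<integral>\<^sup>+z. ennreal (moll \<epsilon> (\<lambda>_. 0) (z - y)) \<partial>lborel) = (\<integral>\<^sup>+z. ennreal (moll \<epsilon> (\<lambda>_::'n. 0) z) \<partial>lborel)"
    using nn_integral_lborel_affine[of "\<lambda>z. ennreal (moll \<epsilon> (\<lambda>_::'n. 0) z)" 1 "- y"] by simp
  also have "\<dots> = ennreal 1" using nn_integral_moll[OF \<epsilon>] by simp
  finally have "has_bochner_integral lborel (\<lambda>z. moll \<epsilon> (\<lambda>_. 0) (z - y)) 1"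
    by (intro has_bochner_integral_nn_integral) (auto simp: moll_0_nonneg[OF \<epsilon>])
  then show "integrable lborel (\<lambda>z. moll \<epsilon> (\<lambda>_. 0) (z - y))" "(LINT z|lborel. moll \<epsilon> (\<lambda>_. 0) (z - y)) = 1"
    by (auto simp: has_bochner_integral_iff)
qed

lemma AE_not_on_sphere:
  fixes c :: "'a::euclidean_space"
  shows "AE y in lborel. dist c y \<noteq> s"
proof -
  have "sphere c s \<in> null_sets lebesgue"
    using negligible_sphere[of c s] by (simp add: negligible_iff_null_sets)
  moreover have "sphere c s \<in> sets borel" by (simp add: closed_sphere borel_closed)
  ultimately have "sphere c s \<in> null_sets lborel"
    by (simp add: null_sets_def)
  then have "AE y in lborel. y \<notin> sphere c s" by (rule AE_not_in)
  then show ?thesis by eventually_elim simp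
qed

text \<open>Fubini moves the mollifier from f onto the indicator of the ball. The mollified
  indicator \<open>\<theta>\<close> has values in [0, 1] and, at each point off the sphere,
  eventually equals the indicator, so dominated convergence applies with bound |f|.\<close>

lemma mconv_ball_integral_tendsto:
  fixes f :: "real ^ 'n::finite \<Rightarrow> real"
  assumes f: "integrable lborel f" and \<epsilon>: "\<And>k. \<epsilon> k > 0" "\<epsilon> \<longlonglongrightarrow> 0"
  shows "(\<lambda>k. LINT z|lborel. indicator (ball c s) z * mconv (\<epsilon> k) f (\<lambda>_. 0) z) \<longlonglongrightarrow>
    (LINT z|lborel. indicator (ball c s) z * f z)"
proof -
  have [measurable]: "f \<in> borel_measurable borel" using f by auto
  have [measurable]: "ball c s \<in> sets borel" by simp
  let ?n = "real CARD('n)"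
  define \<theta> where "\<theta> k y = (LINT z|lborel. indicator (ball c s) z * moll (\<epsilon> k) (\<lambda>_. 0) (z - y))" for k y
  have [measurable]: "\<theta> k \<in> borel_measurable borel" for k unfolding \<theta>_def by measurable
  have int: "integrable lborel (\<lambda>z. indicator (ball c s) z * moll (\<epsilon> k) (\<lambda>_. 0) (z - y))" for k y
    by (rule Bochner_Integration.integrable_bound[OF moll_translated(1)[OF \<epsilon>(1)[of k], of y]])
      (auto simp: indicator_def)
  have \<theta>0: "\<theta> k y \<ge> 0" for k y
    unfolding \<theta>_def by (intro integral_nonneg_AE) (auto simp: moll_0_nonneg[OF \<epsilon>(1)])
  have \<theta>1: "\<theta> k y \<le> 1" for k y
  proof -
    have "\<theta> k y \<le> (LINT z|lborel. moll (\<epsilon> k) (\<lambda>_. 0) (z - y))"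
      unfolding \<theta>_def using moll_translated(1)[OF \<epsilon>(1)[of k], of y] int
      by (intro integral_mono) (auto simp: indicator_def moll_0_nonneg[OF \<epsilon>(1)])
    then show ?thesis by (simp add: moll_translated(2)[OF \<epsilon>(1)])
  qed
  have fub: "(LINT z|lborel. indicator (ball c s) z * mconv (\<epsilon> k) f (\<lambda>_. 0) z) = (LINT y|lborel. f y * \<theta> k y)" for k
  proof -
    let ?h = "\<lambda>y z. indicator (ball c s) z * (f y * moll (\<epsilon> k) (\<lambda>_. 0) (z - y))"
    have eq: "?h y z = f y * (indicator (ball c s) z * moll (\<epsilon> k) (\<lambda>_. 0) (z - y))" for y z by simp
    have "integrable (lborel \<Otimes>\<^sub>M lborel) (case_prod ?h)"
    proof (rule lborel_pair.Fubini_integrable)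
      have "(LINT z|lborel. norm (case (y, z) of (y, z) \<Rightarrow> ?h y z)) = \<bar>f y\<bar> * \<theta> k y" for y
      proof -
        have "(LINT z|lborel. norm (case (y, z) of (y, z) \<Rightarrow> ?h y z)) =
          (LINT z|lborel. \<bar>f y\<bar> * (indicator (ball c s) z * moll (\<epsilon> k) (\<lambda>_. 0) (z - y)))"
          by (intro Bochner_Integration.integral_cong) (auto simp: abs_mult moll_0_nonneg[OF \<epsilon>(1)])
        then show ?thesis by (simp add: \<theta>_def)
      qed
      moreover have "integrable lborel (\<lambda>y. \<bar>f y\<bar> * \<theta> k y)"
      proof (rule Bochner_Integration.integrable_bound[OF f])
        show "AE y in lborel. norm (\<bar>f y\<bar> * \<theta> k y) \<le> norm (f y)"
          by (intro AE_I2) (simp add: abs_mult \<theta>0 \<theta>1 mult_right_le_one_le)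
      qed measurable
      ultimately show "integrable lborel (\<lambda>y. LINT z|lborel. norm (case (y, z) of (y, z) \<Rightarrow> ?h y z))" by simp
      show "AE y in lborel. integrable lborel (\<lambda>z. case (y, z) of (y, z) \<Rightarrow> ?h y z)"
        unfolding prod.case eq using int by simp
    qed measurable
    then have "(LINT z|lborel. (LINT y|lborel. ?h y z)) = (LINT y|lborel. (LINT z|lborel. ?h y z))"
      by (rule lborel_pair.Fubini_integral)
    moreover have "(LINT y|lborel. ?h y z) = indicator (ball c s) z * mconv (\<epsilon> k) f (\<lambda>_. 0) z" for z
      by (simp add: mconv_def)
    moreover have "(LINT z|lborel. ?h y z) = f y * \<theta> k y" for y
      unfolding eq \<theta>_def by simp
    ultimately show ?thesis by (simp only:)
  qed
  have "(\<lambda>k. LINT y|lborel. f y * \<theta> k y) \<longlonglongrightarrow> (LINT y|lborel. indicator (ball c s) y * f y)"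
  proof (rule integral_dominated_convergence)
    show "integrable lborel (\<lambda>y. \<bar>f y\<bar>)" using f by simp
    show "AE y in lborel. norm (f y * \<theta> k y) \<le> \<bar>f y\<bar>" for k
      by (intro AE_I2) (simp add: abs_mult \<theta>0 \<theta>1 mult_right_le_one_le)
    have small: "eventually (\<lambda>k. ?n * \<epsilon> k < d) sequentially" if "d > 0" for d
    proof -
      have "(\<lambda>k. ?n * \<epsilon> k) \<longlonglongrightarrow> ?n * 0" by (intro tendsto_mult_left \<epsilon>(2))
      then show ?thesis using that by (intro order_tendstoD(2)) simp_all
    qed
    have near: "dist z y < ?n * \<epsilon> k" if "moll (\<epsilon> k) (\<lambda>_. 0) (z - y) \<noteq> 0" for z y :: "real ^ 'n" and k
      using that moll_eq_0[OF \<epsilon>(1)[of k], of "z - y" "\<lambda>_. 0"] by (force simp: dist_norm not_less)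
    show "AE y in lborel. (\<lambda>k. f y * \<theta> k y) \<longlonglongrightarrow> indicator (ball c s) y * f y"
      using AE_not_on_sphere[of c s]
    proof eventually_elim
      case (elim y)
      consider "dist c y < s" | "dist c y > s" using elim by linarith
      then show ?case
      proof cases
        case 1
        \<comment> \<open>As soon as n \<epsilon> is smaller than the distance from y to the sphere,
          the mollifier centred at y is supported inside the ball, and \<theta> equals its total
          mass 1.\<close>
        have "eventually (\<lambda>k. f y * \<theta> k y = f y) sequentially"
          using small[OF diff_gt_0_iff_gt[THEN iffD2, OF 1]]
        proof (eventually_elim)
          case (elim k)
          have ind: "indicator (ball c s) z * moll (\<epsilon> k) (\<lambda>_. 0) (z - y) = moll (\<epsilon> k) (\<lambda>_. 0) (z - y)" for z
          proof (cases "moll (\<epsilon> k) (\<lambda>_. 0) (z - y) = 0")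
            case False
            then have "dist c z < s" using near[OF False] elim dist_triangle[of c z y] by (simp add: dist_commute)
            then show ?thesis by simp
          qed simp
          show ?case unfolding \<theta>_def ind moll_translated(2)[OF \<epsilon>(1)] by simp
        qed
        then show ?thesis using 1 by (simp add: tendsto_eventually)
      next
        case 2
        have "eventually (\<lambda>k. f y * \<theta> k y = 0) sequentially"
          using small[OF diff_gt_0_iff_gt[THEN iffD2, OF 2]]
        proof (eventually_elim)
          case (elim k)
          have ind: "indicator (ball c s) z * moll (\<epsilon> k) (\<lambda>_. 0) (z - y) = 0" for z
          proof (cases "moll (\<epsilon> k) (\<lambda>_. 0) (z - y) = 0")
            case False
            then have "\<not> dist c z < s" using near[OF False] elim dist_triangle[of c y z] by (simp add: dist_commute)
            then show ?thesis by simp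
          qed simp
          show ?case unfolding \<theta>_def ind by simp
        qed
        then show ?thesis using 2 by (simp add: tendsto_eventually)
      qed
    qed
  qed measurable
  then show ?thesis unfolding fub .
qed

text \<open>The number a is a subsequential limit of the mollified values at x. These are bounded,
  since by the oscillation bound they stay close to averages over \<open>ball x r\<close>, which
  converge. A subsequence suffices because a is identified afterwards with the precise
  representative.\<close>

lemma mollified_limit_value:
  fixes f :: "real ^ 'n::finite \<Rightarrow> real"
  assumes f: "integrable lborel f" and r: "r > 0" and \<epsilon>0: "\<epsilon>0 > 0"
    and osc: "\<And>\<epsilon> \<rho>. 0 < \<epsilon> \<Longrightarrow> \<epsilon> < \<epsilon>0 \<Longrightarrow> 0 < \<rho> \<Longrightarrow> \<rho> \<le> r \<Longrightarrow>
      (\<integral>\<^sup>+z\<in>ball x \<rho>. ennreal \<bar>mconv \<epsilon> f (\<lambda>_. 0) x - mconv \<epsilon> f (\<lambda>_. 0) z\<bar> \<partial>lborel) \<le> ennreal (M * \<rho> ^ (CARD('n) + 1))"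
    and M: "M \<ge> 0"
  shows "\<exists>a. \<forall>\<rho> c s. 0 < \<rho> \<longrightarrow> \<rho> \<le> r \<longrightarrow> ball c s \<subseteq> ball x \<rho> \<longrightarrow>
    \<bar>a * measure lborel (ball c s) - (LINT z|lborel. indicator (ball c s) z * f z)\<bar> \<le> M * \<rho> ^ (CARD('n) + 1)"
proof -
  have [measurable]: "f \<in> borel_measurable borel" using f by auto
  \<comment> \<open>The shift by 2 keeps every term, including the one for k = 0, strictly below
    \<open>\<epsilon>0\<close>.\<close>
  define \<epsilon> where "\<epsilon> k = \<epsilon>0 / real (k + 2)" for k
  have \<epsilon>: "\<epsilon> k > 0" "\<epsilon> k < \<epsilon>0" for k using \<epsilon>0 by (auto simp: \<epsilon>_def field_simps add_pos_nonneg)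
  have "\<epsilon> \<longlonglongrightarrow> 0"
    unfolding \<epsilon>_def by (rule LIMSEQ_ignore_initial_segment[OF lim_const_over_n])
  define F where "F k = mconv (\<epsilon> k) f (\<lambda>_. 0)" for k
  define J where "J k c s = (LINT z|lborel. indicator (ball c s) z * F k z)" for k c s
  define J' where "J' c s = (LINT z|lborel. indicator (ball c s) z * f z)" for c s
  have lim: "(\<lambda>k. J k c s) \<longlonglongrightarrow> J' c s" for c s
    unfolding J_def J'_def F_def by (rule mconv_ball_integral_tendsto[OF f \<epsilon>(1) \<open>\<epsilon> \<longlonglongrightarrow> 0\<close>])
  have [measurable]: "F k \<in> borel_measurable borel" for k unfolding F_def by measurable
  \<comment> \<open>The integral of the oscillation over \<open>ball x \<rho>\<close> dominates the
    one over any sub-ball. The resulting inequality involves \<open>F k\<close> only through its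
    value at x and its integral over a ball, and both can be passed to the limit.\<close>
  have bnd: "\<bar>F k x * measure lborel (ball c s) - J k c s\<bar> \<le> M * \<rho> ^ (CARD('n) + 1)"
    if \<rho>: "0 < \<rho>" "\<rho> \<le> r" and sub: "ball c s \<subseteq> ball x \<rho>" for \<rho> c s k
  proof -
    have [measurable]: "ball c s \<in> sets borel" by simp
    let ?B = "M * \<rho> ^ (CARD('n) + 1)"
    have "(\<integral>\<^sup>+z. ennreal \<bar>indicator (ball c s) z * (F k x - F k z)\<bar> \<partial>lborel) \<le>
       (\<integral>\<^sup>+z\<in>ball x \<rho>. ennreal \<bar>F k x - F k z\<bar> \<partial>lborel)"
      using sub by (intro nn_integral_mono) (auto simp: indicator_def)
    also have "\<dots> \<le> ennreal ?B" unfolding F_def by (rule osc[OF \<epsilon> \<rho>])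
    finally have le: "(\<integral>\<^sup>+z. ennreal \<bar>indicator (ball c s) z * (F k x - F k z)\<bar> \<partial>lborel) \<le> ennreal ?B" .
    have int: "integrable lborel (\<lambda>z. indicator (ball c s) z * (F k x - F k z))"
      using le by (intro integrableI_bounded) (auto intro: le_less_trans)
    have intB: "integrable lborel (\<lambda>z. indicator (ball c s) z * F k x)"
      using emeasure_bounded_finite[OF bounded_ball[of c s]] by (auto intro!: integrable_real_indicator)
    have "integrable lborel (\<lambda>z. indicator (ball c s) z * F k x - indicator (ball c s) z * (F k x - F k z))"
      by (rule Bochner_Integration.integrable_diff[OF intB int])
    then have intF: "integrable lborel (\<lambda>z. indicator (ball c s) z * F k z)"
      by (simp add: algebra_simps)
    have "F k x * measure lborel (ball c s) - J k c s =
       (LINT z|lborel. indicator (ball c s) z * F k x) - (LINT z|lborel. indicator (ball c s) z * F k z)"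
      by (simp add: J_def)
    also have "\<dots> = (LINT z|lborel. indicator (ball c s) z * F k x - indicator (ball c s) z * F k z)"
      by (rule Bochner_Integration.integral_diff[OF intB intF, symmetric])
    also have "\<dots> = (LINT z|lborel. indicator (ball c s) z * (F k x - F k z))"
      by (simp add: algebra_simps)
    finally have "ennreal \<bar>F k x * measure lborel (ball c s) - J k c s\<bar> \<le>
        ennreal (LINT z|lborel. \<bar>indicator (ball c s) z * (F k x - F k z)\<bar>)"
      by (simp only:) (intro ennreal_leI integral_abs_bound)
    also have "\<dots> = (\<integral>\<^sup>+z. ennreal \<bar>indicator (ball c s) z * (F k x - F k z)\<bar> \<partial>lborel)"
      using int by (intro nn_integral_eq_integral[symmetric]) auto
    also note le
    finally show ?thesis using M \<rho> by (subst (asm) ennreal_le_iff) auto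
  qed
  have "bounded (range (\<lambda>k. F k x))"
  proof -
    have "convergent (\<lambda>k. J k x r)" using lim by (auto simp: convergent_def)
    then have "Bseq (\<lambda>k. J k x r)" by (rule convergent_imp_Bseq)
    then obtain J0 where J0: "\<And>k. \<bar>J k x r\<bar> \<le> J0" unfolding Bseq_def real_norm_def by blast
    have pos: "measure lborel (ball x r) > 0" using r content_ball_gt_0_iff[of x r] by simp
    have "\<bar>F k x\<bar> \<le> (M * r ^ (CARD('n) + 1) + J0) / measure lborel (ball x r)" for k
    proof -
      have "\<bar>F k x\<bar> * measure lborel (ball x r) = \<bar>F k x * measure lborel (ball x r)\<bar>" by (simp add: abs_mult)
      also have "\<dots> \<le> M * r ^ (CARD('n) + 1) + J0"
        using bnd[OF r order_refl order_refl, of k] J0[of k] by linarith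
      finally show ?thesis using pos by (simp add: field_simps)
    qed
    then show ?thesis by (auto intro!: boundedI)
  qed
  then obtain a \<sigma> where \<sigma>: "strict_mono \<sigma>" "((\<lambda>k. F k x) \<circ> \<sigma>) \<longlonglongrightarrow> a"
    using bounded_imp_convergent_subsequence by blast
  show ?thesis
  proof (intro exI[of _ a] allI impI)
    fix \<rho> c s assume \<rho>: "0 < \<rho>" "\<rho> \<le> r" and sub: "ball c s \<subseteq> ball x \<rho>"
    have "(\<lambda>k. \<bar>((\<lambda>k. F k x) \<circ> \<sigma>) k * measure lborel (ball c s) - ((\<lambda>k. J k c s) \<circ> \<sigma>) k\<bar>) \<longlonglongrightarrow>
      \<bar>a * measure lborel (ball c s) - J' c s\<bar>"
      by (intro tendsto_intros \<sigma> LIMSEQ_subseq_LIMSEQ[OF lim])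
    then show "\<bar>a * measure lborel (ball c s) - (LINT z|lborel. indicator (ball c s) z * f z)\<bar> \<le> M * \<rho> ^ (CARD('n) + 1)"
      unfolding J'_def[symmetric]
      by (rule LIMSEQ_le_const2) (use bnd[OF \<rho> sub] in auto)
  qed
qed

text \<open>Quantifying over all sub-balls \<open>ball c s\<close> serves two purposes: the estimate passes to the limit
  of the mollifications without any \<open>L\<^sup>1\<close> convergence, and two points at distance \<open>\<rho>\<close> can be compared
  on a common sub-ball of their \<open>\<rho>\<close>-balls.\<close>

definition approx_value :: "(real ^ 'n::finite \<Rightarrow> real) \<Rightarrow> real \<Rightarrow> real \<Rightarrow> real ^ 'n \<Rightarrow> real \<Rightarrow> bool" where
  "approx_value f r A x a \<longleftrightarrow> (\<forall>\<rho> c s. 0 < \<rho> \<longrightarrow> \<rho> \<le> r \<longrightarrow> ball c s \<subseteq> ball x \<rho> \<longrightarrow>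
     \<bar>a * measure lebesgue (ball c s) - (LINT y:ball c s|lebesgue. f y)\<bar> \<le> A * \<rho> ^ (CARD('n) + 1))"

text \<open>For c = x and s = \<rho>, division by the volume \<omega> \<rho>^n leaves an error of A
  \<rho> / \<omega>, which tends to 0. In particular, approximate values are unique, whatever r and
  A are.\<close>

lemma approx_value_precise_rep:
  fixes x :: "real ^ 'n::finite"
  assumes a: "approx_value f r A x a" and r: "r > 0"
  shows "precise_rep f x = a"
proof -
  define \<omega> where "\<omega> = unit_ball_vol (real CARD('n))"
  have \<omega>: "\<omega> > 0" by (simp add: \<omega>_def)
  have le: "\<bar>ball_average f x \<rho> - a\<bar> \<le> A / \<omega> * \<rho>" if \<rho>: "0 < \<rho>" "\<rho> < r" for \<rho>
  proof -
    have V: "measure lebesgue (ball x \<rho>) = \<omega> * \<rho> ^ CARD('n)" using \<rho> by (simp add: content_ball \<omega>_def)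
    have pos: "\<omega> * \<rho> ^ CARD('n) > 0" using \<omega> \<rho> by simp
    have "ball_average f x \<rho> - a = ((LINT y:ball x \<rho>|lebesgue. f y) - a * (\<omega> * \<rho> ^ CARD('n))) / (\<omega> * \<rho> ^ CARD('n))"
      unfolding ball_average_def V using \<omega> \<rho> by (simp add: diff_divide_distrib)
    then have "\<bar>ball_average f x \<rho> - a\<bar> = \<bar>a * (\<omega> * \<rho> ^ CARD('n)) - (LINT y:ball x \<rho>|lebesgue. f y)\<bar> / (\<omega> * \<rho> ^ CARD('n))"
      using pos by (simp only: abs_divide abs_minus_commute)
    also have "\<dots> \<le> A * \<rho> ^ (CARD('n) + 1) / (\<omega> * \<rho> ^ CARD('n))"
      using a \<rho> pos unfolding approx_value_def V[symmetric] by (intro divide_right_mono) auto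
    also have "\<dots> = A / \<omega> * \<rho>" using \<omega> \<rho> by (simp add: field_simps)
    finally show ?thesis .
  qed
  have "(ball_average f x \<longlongrightarrow> a) (at_right 0)"
  proof (rule LIM_zero_cancel, rule tendsto_rabs_zero_cancel, rule tendsto_sandwich)
    show "\<forall>\<^sub>F \<rho> in at_right 0. 0 \<le> \<bar>ball_average f x \<rho> - a\<bar>" by simp
    show "\<forall>\<^sub>F \<rho> in at_right 0. \<bar>ball_average f x \<rho> - a\<bar> \<le> A / \<omega> * \<rho>"
      using le r by (auto simp: eventually_at_right_field intro!: exI[of _ r])
    show "((\<lambda>\<rho>. A / \<omega> * \<rho>) \<longlongrightarrow> 0) (at_right 0)"
      using tendsto_mult_left[of "\<lambda>\<rho>. \<rho>" 0 "at_right 0" "A / \<omega>"] by simp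
  qed simp
  then show ?thesis
    unfolding precise_rep_def by (auto intro: tendsto_Lim)
qed

text \<open>Points at distance d <= r share the ball of radius d/2 around their midpoint, which lies
  in both d-balls, and both values are close to the mean of f there. Distant points are handled by
  the bound M, since S may offer no chain of nearby points between them.\<close>

lemma approx_value_lipschitz:
  fixes h :: "real ^ 'n::finite \<Rightarrow> real"
  assumes h: "\<And>x. x \<in> S \<Longrightarrow> approx_value f r A x (h x)" and r: "r > 0" and A: "A \<ge> 0"
    and M: "\<And>x. x \<in> S \<Longrightarrow> \<bar>h x\<bar> \<le> M" "M \<ge> 0"
  shows "\<exists>L. L-lipschitz_on S h"
proof -
  define \<omega> where "\<omega> = unit_ball_vol (real CARD('n))"
  have \<omega>: "\<omega> > 0" by (simp add: \<omega>_def)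
  \<comment> \<open>The factor 2 comes from the two estimates and 2^n from the halved radius of the
    common ball.\<close>
  define L where "L = 2 * A * 2 ^ CARD('n) / \<omega>"
  have L: "L \<ge> 0" using A \<omega> by (simp add: L_def)
  have "dist (h x) (h y) \<le> (L + 2 * M / r) * dist x y" if x: "x \<in> S" and y: "y \<in> S" for x y
  proof (cases "dist x y \<le> r")
    case True
    have "dist (h x) (h y) \<le> L * dist x y"
    proof (cases "x = y")
      case False
      define d where "d = dist x y"
      have d: "d > 0" "d \<le> r" using False True by (auto simp: d_def)
      let ?c = "midpoint x y"
      have "ball ?c (d / 2) \<subseteq> ball x d" "ball ?c (d / 2) \<subseteq> ball y d"
      proof -
        have c: "dist x ?c = d / 2" "dist y ?c = d / 2" by (simp_all add: d_def dist_midpoint)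
        have "dist x z < d \<and> dist y z < d" if "dist ?c z < d / 2" for z
          using that c dist_triangle[of x z ?c] dist_triangle[of y z ?c] by linarith
        then show "ball ?c (d / 2) \<subseteq> ball x d" "ball ?c (d / 2) \<subseteq> ball y d" by auto
      qed
      then have "\<bar>h x * measure lebesgue (ball ?c (d / 2)) - (LINT y:ball ?c (d / 2)|lebesgue. f y)\<bar> \<le> A * d ^ (CARD('n) + 1)"
        "\<bar>h y * measure lebesgue (ball ?c (d / 2)) - (LINT y:ball ?c (d / 2)|lebesgue. f y)\<bar> \<le> A * d ^ (CARD('n) + 1)"
        using h[OF x] h[OF y] d unfolding approx_value_def by auto
      then have "\<bar>h x * measure lebesgue (ball ?c (d / 2)) - h y * measure lebesgue (ball ?c (d / 2))\<bar> \<le> 2 * (A * d ^ (CARD('n) + 1))"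
        by linarith
      moreover have "measure lebesgue (ball ?c (d / 2)) = \<omega> * (d / 2) ^ CARD('n)"
        using d by (simp add: content_ball \<omega>_def)
      ultimately have "\<bar>h x - h y\<bar> * (\<omega> * (d / 2) ^ CARD('n)) \<le> 2 * (A * d ^ (CARD('n) + 1))"
        using \<omega> d by (simp add: left_diff_distrib[symmetric] abs_mult)
      then have "\<bar>h x - h y\<bar> \<le> 2 * (A * d ^ (CARD('n) + 1)) / (\<omega> * (d / 2) ^ CARD('n))"
        using \<omega> d by (subst pos_le_divide_eq) auto
      also have "\<dots> = L * d" using \<omega> d by (simp add: L_def power_divide field_simps)
      finally show ?thesis by (simp add: d_def dist_real_def)
    qed simp
    also have "\<dots> \<le> (L + 2 * M / r) * dist x y" using M r by (intro mult_right_mono) auto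
    finally show ?thesis .
  next
    case False
    have "dist (h x) (h y) \<le> 2 * M" using M(1)[OF x] M(1)[OF y] by (simp add: dist_real_def)
    also have "\<dots> \<le> 2 * M / r * dist x y"
      using False r M mult_left_mono[of r "dist x y" "2 * M"] by (simp add: field_simps)
    also have "\<dots> \<le> (L + 2 * M / r) * dist x y" using L by (intro mult_right_mono) auto
    finally show ?thesis .
  qed
  moreover have "L + 2 * M / r \<ge> 0" using L M r by simp
  ultimately show ?thesis by (intro exI lipschitz_onI)
qed

section \<open>Capacity and representatives\<close>

text \<open>Fatou's lemma along a convergent sequence. The integrands converge for every y other
  than the limit point; there the conventional value 0 of the kernel breaks continuity, but a single
  point is a null set.\<close>

lemma closed_potential_le:
  fixes g :: "'a::euclidean_space \<Rightarrow> real"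
  assumes [measurable]: "g \<in> borel_measurable borel"
  shows "closed {x. potential \<gamma> g x \<le> t}"
  unfolding closed_sequential_limits
proof (intro allI impI, elim conjE)
  fix X x assume X: "\<forall>k. X k \<in> {x. potential \<gamma> g x \<le> t}" "X \<longlonglongrightarrow> x"
  have "potential \<gamma> g x = (\<integral>\<^sup>+y. liminf (\<lambda>k. ennreal (g y * kern \<gamma> (X k - y))) \<partial>lborel)"
    unfolding potential_def
  proof (rule nn_integral_cong_AE)
    have "AE y in lborel. y \<noteq> x" by (rule AE_lborel_singleton)
    then show "AE y in lborel. ennreal (g y * kern \<gamma> (x - y)) = liminf (\<lambda>k. ennreal (g y * kern \<gamma> (X k - y)))"
    proof eventually_elim
      case (elim y)
      have "(\<lambda>k. ennreal (g y * kern \<gamma> (X k - y))) \<longlonglongrightarrow> ennreal (g y * kern \<gamma> (x - y))"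
        unfolding kern_def using elim by (intro tendsto_intros X) auto
      then show ?case by (intro lim_imp_Liminf[symmetric]) auto
    qed
  qed
  also have "\<dots> \<le> liminf (\<lambda>k. potential \<gamma> g (X k))"
    unfolding potential_def by (rule nn_integral_liminf) measurable
  also have "\<dots> \<le> t"
    using X(1) by (intro Liminf_le) auto
  finally show "x \<in> {x. potential \<gamma> g x \<le> t}" by simp
qed

lemma riesz_gamma_pos:
  assumes "0 < \<alpha>" "\<alpha> < real CARD('n::finite)"
  shows "riesz_gamma TYPE('n) \<alpha> > 0"
  unfolding riesz_gamma_def using assms by (intro divide_pos_pos mult_pos_pos Gamma_real_pos) auto

lemma riesz_capacity_empty: "p \<ge> 1 \<Longrightarrow> riesz_capacity \<alpha> p {} = 0"
proof -
  assume "p \<ge> 1"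
  then have "riesz_capacity \<alpha> p ({} :: (real ^ 'n) set) \<le> ennreal (LINT y|lebesgue. \<bar>(\<lambda>_ :: real ^ 'n. 0) y\<bar> powr p)"
    unfolding riesz_capacity_def by (intro Inf_lower CollectI exI[of _ "\<lambda>_. 0"]) (auto simp: Lp_def)
  then show ?thesis by simp
qed

text \<open>One function serves all \<open>g j\<close> at once, in place of countable subadditivity.
  With h the sum of the c_j g_j^p, which is integrable, u = (\<delta> h)^(1/p) dominates a positive
  multiple of each g_j almost everywhere, so its potential is infinite on E, while the integral of
  u^p is \<delta> times that of h. Summing p-th powers rather than functions makes the cost
  additive.\<close>

lemma riesz_capacity_eq_0:
  fixes g :: "nat \<Rightarrow> real ^ 'n::finite \<Rightarrow> real" and \<alpha> :: real
  assumes \<alpha>: "0 < \<alpha>" "\<alpha> < real CARD('n)" and p: "p \<ge> 1"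
    and meas [measurable]: "\<And>j. g j \<in> borel_measurable borel" and nonneg: "\<And>j y. g j y \<ge> 0"
    and int: "\<And>j. integrable lborel (\<lambda>y. g j y powr p)"
    and E: "\<And>x. x \<in> E \<Longrightarrow> \<exists>j. potential (real CARD('n) - \<alpha>) (g j) x = \<infinity>"
  shows "riesz_capacity \<alpha> p E = 0"
proof -
  define \<gamma> where "\<gamma> = real CARD('n) - \<alpha>"
  \<comment> \<open>Weighted so that c_j g_j^p has integral at most 2^(-j); the 1 in the denominator
    guards against a vanishing integral.\<close>
  define c where "c j = (1 / 2) ^ j / (1 + (LINT y|lborel. g j y powr p))" for j
  have I0: "(LINT y|lborel. g j y powr p) \<ge> 0" for j by (intro integral_nonneg_AE) auto
  have I1: "1 + (LINT y|lborel. g j y powr p) > 0" for j using I0[of j] by linarith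
  have c: "c j > 0" for j unfolding c_def using I1[of j] by (intro divide_pos_pos) auto
  define H where "H y = (\<Sum>j. ennreal (c j * g j y powr p))" for y
  have [measurable]: "H \<in> borel_measurable borel" unfolding H_def by measurable
  have "(\<integral>\<^sup>+y. H y \<partial>lborel) = (\<Sum>j. \<integral>\<^sup>+y. ennreal (c j * g j y powr p) \<partial>lborel)"
    unfolding H_def by (rule nn_integral_suminf) measurable
  also have "\<dots> \<le> (\<Sum>j. ennreal ((1 / 2) ^ j))"
  proof (intro suminf_le summableI allI)
    fix j
    have "(\<integral>\<^sup>+y. ennreal (c j * g j y powr p) \<partial>lborel) = ennreal (LINT y|lborel. c j * g j y powr p)"
      using int[of j] c[of j] by (intro nn_integral_eq_integral) auto
    also have "\<dots> \<le> ennreal ((1 / 2) ^ j)"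
    proof (rule ennreal_leI)
      have "(1 / 2) ^ j * ((LINT y|lborel. g j y powr p) / (1 + (LINT y|lborel. g j y powr p))) \<le> (1 / 2 :: real) ^ j * 1"
        using I1[of j] by (intro mult_left_mono) (simp_all add: divide_le_eq)
      then show "(LINT y|lborel. c j * g j y powr p) \<le> (1 / 2) ^ j"
        by (simp add: c_def)
    qed
    finally show "(\<integral>\<^sup>+y. ennreal (c j * g j y powr p) \<partial>lborel) \<le> ennreal ((1 / 2) ^ j)" .
  qed
  also have "\<dots> < \<infinity>" by (subst suminf_ennreal2) (auto simp: summable_geometric)
  finally have H: "(\<integral>\<^sup>+y. H y \<partial>lborel) < \<infinity>" .
  then have H_fin: "AE y in lborel. H y \<noteq> \<infinity>"
    by (intro nn_integral_PInf_AE) auto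
  \<comment> \<open>\<open>enn2real\<close> replaces the value infinity by 0, which happens only on
    a null set; hence the comparison \<open>h_ge\<close> holds almost everywhere.\<close>
  define h where "h y = enn2real (H y)" for y
  have [measurable]: "h \<in> borel_measurable borel" unfolding h_def by measurable
  have h0: "h y \<ge> 0" for y by (simp add: h_def)
  have h_int: "integrable lborel h"
  proof (rule integrableI_bounded)
    have "(\<integral>\<^sup>+y. ennreal (norm (h y)) \<partial>lborel) \<le> (\<integral>\<^sup>+y. H y \<partial>lborel)"
      by (intro nn_integral_mono) (simp add: h_def ennreal_enn2real_if)
    then show "(\<integral>\<^sup>+y. ennreal (norm (h y)) \<partial>lborel) < \<infinity>" using H by (rule le_less_trans)
  qed measurable
  have h_ge: "AE y in lborel. \<forall>j. c j * g j y powr p \<le> h y"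
    using H_fin
  proof eventually_elim
    case (elim y)
    show ?case
    proof
      fix j
      have "ennreal (c j * g j y powr p) \<le> H y"
        unfolding H_def using sum_le_suminf[OF summableI, of "{j}" "\<lambda>j. ennreal (c j * g j y powr p)"] by simp
      also have "H y = ennreal (h y)" using elim by (simp add: h_def ennreal_enn2real_if)
      finally show "c j * g j y powr p \<le> h y" using h0 by (simp add: ennreal_le_iff)
    qed
  qed
  have cap: "riesz_capacity \<alpha> p E \<le> ennreal (\<delta> * (LINT y|lborel. h y))" if \<delta>: "\<delta> > 0" for \<delta>
  proof -
    define u where "u y = (\<delta> * h y) powr (1 / p)" for y
    have [measurable]: "u \<in> borel_measurable borel" unfolding u_def by measurable
    have up: "\<bar>u y\<bar> powr p = \<delta> * h y" for y
      using \<delta> h0[of y] p by (simp add: u_def powr_powr)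
    have "u \<in> Lp p UNIV"
      unfolding Lp_def lebesgue_on_UNIV_eq
      using h_int by (auto simp: up integrable_completion intro!: measurable_completion)
    moreover have "\<forall>y. 0 \<le> u y" by (simp add: u_def)
    moreover have "\<forall>x\<in>E. 1 \<le> riesz_potential \<alpha> u x"
    proof
      fix x assume "x \<in> E"
      then obtain j where j: "potential \<gamma> (g j) x = \<infinity>" using E by (auto simp: \<gamma>_def)
      define b where "b = (\<delta> * c j) powr (1 / p)"
      have b: "b > 0" using \<delta> c[of j] by (simp add: b_def)
      have "ennreal b * potential \<gamma> (g j) x = (\<integral>\<^sup>+y. ennreal b * ennreal (g j y * kern \<gamma> (x - y)) \<partial>lborel)"
        unfolding potential_def by (rule nn_integral_cmult[symmetric]) measurable
      also have "\<dots> \<le> (\<integral>\<^sup>+y. ennreal (u y * kern \<gamma> (x - y)) \<partial>lborel)"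
      proof (rule nn_integral_mono_AE)
        show "AE y in lborel. ennreal b * ennreal (g j y * kern \<gamma> (x - y)) \<le> ennreal (u y * kern \<gamma> (x - y))"
          using h_ge
        proof eventually_elim
          case (elim y)
          have "b * g j y = (\<delta> * (c j * g j y powr p)) powr (1 / p)"
            using \<delta> c[of j] nonneg[of j y] p by (simp add: b_def powr_mult powr_powr)
          also have "\<dots> \<le> u y"
            unfolding u_def using elim \<delta> c[of j] p by (intro powr_mono2) auto
          finally have "b * g j y * kern \<gamma> (x - y) \<le> u y * kern \<gamma> (x - y)"
            by (intro mult_right_mono) auto
          then show ?case
            using b by (simp add: ennreal_mult'[symmetric] ennreal_leI mult.assoc)
        qed
      qed
      also have "\<dots> = (\<integral>\<^sup>+y. ennreal (u y / norm (x - y) powr \<gamma>) \<partial>lebesgue)"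
        by (simp add: nn_integral_completion kern_def)
      finally have "(\<integral>\<^sup>+y. ennreal (u y / norm (x - y) powr \<gamma>) \<partial>lebesgue) = \<infinity>"
        using j b by (simp add: ennreal_mult_top top_unique)
      then show "1 \<le> riesz_potential \<alpha> u x"
        unfolding riesz_potential_def \<gamma>_def[symmetric]
        using riesz_gamma_pos[OF \<alpha>] by (simp add: ennreal_mult_top)
    qed
    ultimately have "riesz_capacity \<alpha> p E \<le> ennreal (LINT y|lebesgue. \<bar>u y\<bar> powr p)"
      unfolding riesz_capacity_def by (intro Inf_lower CollectI exI[of _ u] conjI refl)
    also have "(LINT y|lebesgue. \<bar>u y\<bar> powr p) = \<delta> * (LINT y|lborel. h y)"
      unfolding up by (subst integral_completion) auto
    finally show ?thesis .
  qed
  have hI: "(LINT y|lborel. h y) \<ge> 0" using h0 by (intro integral_nonneg_AE) auto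
  have "riesz_capacity \<alpha> p E \<le> 0"
  proof (rule ennreal_le_epsilon)
    fix e :: real assume e: "e > 0"
    let ?\<delta> = "e / (1 + (LINT y|lborel. h y))"
    have "riesz_capacity \<alpha> p E \<le> ennreal (?\<delta> * (LINT y|lborel. h y))"
      using e hI by (intro cap divide_pos_pos) auto
    also have "\<dots> \<le> ennreal e"
      using e hI by (intro ennreal_leI) (auto simp: field_simps)
    finally show "riesz_capacity \<alpha> p E \<le> 0 + ennreal e" by simp
  qed
  then show ?thesis by simp
qed

section \<open>Borel representatives of Sobolev functions and their weak derivatives\<close>

text \<open>A bridge between two settings: the Sobolev definitions speak of Lebesgue measurable
  functions on U, whereas convolutions and Tonelli are carried out with Borel functions on the whole
  space. Extension by zero and a change on a null set mediate.\<close>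

lemma Lp_borel_representative:
  fixes f :: "real ^ 'n::finite \<Rightarrow> real"
  assumes f: "f \<in> Lp p U" and U: "open U" "bounded U" and p: "p \<ge> 1"
  obtains f0 where "f0 \<in> borel_measurable borel" "integrable lborel f0" "integrable lborel (\<lambda>x. \<bar>f0 x\<bar> powr p)"
    "AE x in lebesgue. f0 x = indicator U x * f x" "(\<lambda>x. indicator U x * f x) \<in> borel_measurable lebesgue"
proof -
  have US: "U \<in> sets lebesgue" using U by (simp add: borel_open)
  have ind: "(\<lambda>x. if x \<in> U then f x else 0) = (\<lambda>x. indicator U x * f x)" by (auto simp: indicator_def)
  have meas: "(\<lambda>x. indicator U x * f x) \<in> borel_measurable lebesgue"
    using f borel_measurable_if_I[of f U] US by (simp add: Lp_def ind[symmetric])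
  from completion_ex_borel_measurable_real[OF this]
  obtain f0 where "f0 \<in> borel_measurable lborel" and ae0: "AE x in lborel. indicator U x * f x = f0 x" ..
  then have f0 [measurable]: "f0 \<in> borel_measurable borel" by simp
  have ae: "AE x in lebesgue. f0 x = indicator U x * f x"
    using AE_completion[OF ae0] by eventually_elim simp
  have "integrable lebesgue (\<lambda>x. if x \<in> U then \<bar>f x\<bar> powr p else 0)"
    using f Lebesgue_Measure.integrable_restrict_UNIV[OF US, of "\<lambda>x. \<bar>f x\<bar> powr p"] by (simp add: Lp_def)
  then have "integrable lebesgue (\<lambda>x. \<bar>f0 x\<bar> powr p)"
  proof (rule Bochner_Integration.integrable_cong_AE_imp)
    show "AE x in lebesgue. (if x \<in> U then \<bar>f x\<bar> powr p else 0) = \<bar>f0 x\<bar> powr p"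
      using ae by eventually_elim (auto simp: indicator_def)
    show "(\<lambda>x. \<bar>f0 x\<bar> powr p) \<in> borel_measurable lebesgue"
      by (intro measurable_completion) measurable
  qed
  then have intp: "integrable lborel (\<lambda>x. \<bar>f0 x\<bar> powr p)"
    by (subst (asm) integrable_completion) auto
  have "integrable lborel f0"
  proof -
    \<comment> \<open>Integrability of \<open>f0\<close> follows from |t| <= 1 + |t|^p, valid for p
      >= 1; the constant 1 is integrable over the bounded set U.\<close>
    have "integrable lborel (\<lambda>x. indicator U x + \<bar>f0 x\<bar> powr p)"
      using U emeasure_bounded_finite[OF U(2)] intp by (intro Bochner_Integration.integrable_add) (auto intro!: integrable_real_indicator)
    then have "integrable lebesgue (\<lambda>x. indicator U x + \<bar>f0 x\<bar> powr p)"
      using U by (subst integrable_completion) (auto simp: borel_open)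
    then have "integrable lebesgue f0"
    proof (rule Bochner_Integration.integrable_bound)
      show "f0 \<in> borel_measurable lebesgue" by (intro measurable_completion) measurable
      show "AE x in lebesgue. norm (f0 x) \<le> norm (indicator U x + \<bar>f0 x\<bar> powr p)"
        using ae
      proof eventually_elim
        case (elim x)
        show ?case
        proof (cases "x \<in> U")
          case True
          have "\<bar>f0 x\<bar> \<le> 1 + \<bar>f0 x\<bar> powr p"
          proof (cases "\<bar>f0 x\<bar> \<le> 1")
            case False
            then have "\<bar>f0 x\<bar> powr 1 \<le> \<bar>f0 x\<bar> powr p" using p by (intro powr_mono) auto
            then show ?thesis using False by simp
          qed (simp add: add_increasing2)
          then show ?thesis using True by simp
        qed (simp add: elim)
      qed
    qed
    then show ?thesis by (subst (asm) integrable_completion) auto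
  qed
  then show thesis by (rule that[OF f0 _ intp ae meas])
qed

text \<open>The reflected mollifier centred at z is a test function once its support stays in U.
  Differentiating it produces (-1)^|\<alpha>|, which cancels the sign from integration by
  parts.\<close>

lemma weak_derivative_mconv:
  fixes z :: "real ^ 'n::finite"
  assumes wd: "weak_derivative U \<alpha> f g" and \<epsilon>: "\<epsilon> > 0" "cball z (real CARD('n) * \<epsilon>) \<subseteq> U"
    and f0: "f0 \<in> borel_measurable borel" "AE x in lebesgue. f0 x = indicator U x * f x"
      "(\<lambda>x. indicator U x * f x) \<in> borel_measurable lebesgue"
    and g0: "g0 \<in> borel_measurable borel" "AE x in lebesgue. g0 x = indicator U x * g x"
      "(\<lambda>x. indicator U x * g x) \<in> borel_measurable lebesgue"
  shows "mconv \<epsilon> f0 \<alpha> z = mconv \<epsilon> g0 (\<lambda>_. 0) z"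
proof -
  \<comment> \<open>The scalar b covers both uses: the sign together with \<beta> = \<alpha> for f,
    and 1 together with \<beta> = 0 for g.\<close>
  have conv: "(LINT x:U|lebesgue. u x * (b * moll \<epsilon> \<beta> (z - x))) = b * mconv \<epsilon> u0 \<beta> z"
    if [measurable]: "u0 \<in> borel_measurable borel" and ae: "AE x in lebesgue. u0 x = indicator U x * u x"
      and meas: "(\<lambda>x. indicator U x * u x) \<in> borel_measurable lebesgue" for u u0 \<beta> b
  proof -
    have m: "(\<lambda>x. u0 x * (b * moll \<epsilon> \<beta> (z - x))) \<in> borel_measurable lborel" by measurable
    have ae': "AE x in lebesgue. u0 x * (b * moll \<epsilon> \<beta> (z - x)) = indicator U x *\<^sub>R (u x * (b * moll \<epsilon> \<beta> (z - x)))"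
      using ae by eventually_elim simp
    have "(LINT x:U|lebesgue. u x * (b * moll \<epsilon> \<beta> (z - x))) = (LINT x|lebesgue. u0 x * (b * moll \<epsilon> \<beta> (z - x)))"
      unfolding set_lebesgue_integral_def
    proof (rule integral_cong_AE)
      show 1: "(\<lambda>x. u0 x * (b * moll \<epsilon> \<beta> (z - x))) \<in> borel_measurable lebesgue"
        by (rule measurable_completion[OF m])
      show "(\<lambda>x. indicator U x *\<^sub>R (u x * (b * moll \<epsilon> \<beta> (z - x)))) \<in> borel_measurable lebesgue"
      proof -
        have "(\<lambda>x. b * moll \<epsilon> \<beta> (z - x)) \<in> borel_measurable lborel" by measurable
        from borel_measurable_times[OF meas measurable_completion[OF this]]
        show ?thesis by (simp add: mult.assoc)
      qed
      show "AE x in lebesgue. indicator U x *\<^sub>R (u x * (b * moll \<epsilon> \<beta> (z - x))) = u0 x * (b * moll \<epsilon> \<beta> (z - x))"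
        using ae by eventually_elim simp
    qed
    also have "\<dots> = (LINT x|lborel. u0 x * (b * moll \<epsilon> \<beta> (z - x)))"
      by (rule integral_completion[OF m])
    also have "\<dots> = b * mconv \<epsilon> u0 \<beta> z"
      by (simp add: mconv_def mult.left_commute[of _ b])
    finally show ?thesis .
  qed
  let ?\<phi> = "\<lambda>x. moll \<epsilon> (\<lambda>_. 0) (z - x)"
  have "(LINT x:U|lebesgue. f x * multi_partial \<alpha> ?\<phi> x) = (-1) ^ multi_order \<alpha> * (LINT x:U|lebesgue. g x * ?\<phi> x)"
    using wd moll_test_function[OF \<epsilon>] by (simp add: weak_derivative_def)
  then have "(-1) ^ multi_order \<alpha> * mconv \<epsilon> f0 \<alpha> z = (-1) ^ multi_order \<alpha> * (1 * mconv \<epsilon> g0 (\<lambda>_. 0) z)"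
    unfolding multi_partial_moll conv[OF f0] conv[OF g0, of 1, symmetric] by simp
  then show ?thesis by simp
qed

section \<open>Local estimates and exhaustion\<close>

text \<open>Each term is compared with the largest one. The crude constant is enough to put the
  finite sum of derivatives into L^p.\<close>

lemma sum_powr_le:
  fixes a :: "'i \<Rightarrow> real"
  assumes S: "finite S" and a: "\<And>i. i \<in> S \<Longrightarrow> a i \<ge> 0" and p: "p \<ge> 0"
  shows "(\<Sum>i\<in>S. a i) powr p \<le> real (card S) powr p * (\<Sum>i\<in>S. a i powr p)"
proof (cases "S = {}")
  case False
  define b where "b = Max (a ` S)"
  have "b \<in> a ` S" unfolding b_def using S False by (intro Max_in) auto
  then obtain i where i: "i \<in> S" "b = a i" by auto
  have "(\<Sum>i\<in>S. a i) \<le> real (card S) * b"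
    using S by (intro sum_bounded_above) (auto simp: b_def)
  then have "(\<Sum>i\<in>S. a i) powr p \<le> (real (card S) * b) powr p"
    using a p by (intro powr_mono2 sum_nonneg) auto
  also have "\<dots> = real (card S) powr p * a i powr p"
    using a i by (simp add: powr_mult)
  also have "\<dots> \<le> real (card S) powr p * (\<Sum>i\<in>S. a i powr p)"
    using S i by (intro mult_left_mono member_le_sum) auto
  finally show ?thesis .
qed simp

lemma set_integral_ball_representative:
  fixes f :: "real ^ 'n::finite \<Rightarrow> real"
  assumes f0 [measurable]: "f0 \<in> borel_measurable borel" and ae: "AE x in lebesgue. f0 x = indicator U x * f x"
    and meas: "(\<lambda>x. indicator U x * f x) \<in> borel_measurable lebesgue" and sub: "ball c s \<subseteq> U"
  shows "(LINT y:ball c s|lebesgue. f y) = (LINT z|lborel. indicator (ball c s) z * f0 z)"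
proof -
  have [measurable]: "ball c s \<in> sets borel" by simp
  have m: "(\<lambda>z. indicator (ball c s) z * f0 z) \<in> borel_measurable lborel" by measurable
  have ind: "(\<lambda>x. indicator (ball c s) x *\<^sub>R f x) = (\<lambda>x. indicator (ball c s) x * (indicator U x * f x))"
    using sub by (auto simp: fun_eq_iff indicator_def)
  have "(LINT y:ball c s|lebesgue. f y) = (LINT z|lebesgue. indicator (ball c s) z * f0 z)"
    unfolding set_lebesgue_integral_def
  proof (rule integral_cong_AE)
    have "(indicator (ball c s) :: _ \<Rightarrow> real) \<in> borel_measurable lborel" by measurable
    from borel_measurable_times[OF measurable_completion[OF this] meas]
    show "(\<lambda>x. indicator (ball c s) x *\<^sub>R f x) \<in> borel_measurable lebesgue"
      unfolding ind .
    show "(\<lambda>z. indicator (ball c s) z * f0 z) \<in> borel_measurable lebesgue"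
      by (rule measurable_completion[OF m])
    show "AE x in lebesgue. indicator (ball c s) x *\<^sub>R f x = indicator (ball c s) x * f0 x"
      using ae by eventually_elim (use sub in \<open>auto simp: indicator_def\<close>)
  qed
  also have "\<dots> = (LINT z|lborel. indicator (ball c s) z * f0 z)"
    by (rule integral_completion[OF m])
  finally show ?thesis .
qed

lemma sobolev_representatives:
  fixes f :: "real ^ 'n::finite \<Rightarrow> real"
  assumes f: "f \<in> sobolev k p U" and U: "open U" "bounded U" and p: "p \<ge> 1"
  obtains f0 g where "f0 \<in> borel_measurable borel" "integrable lborel f0"
    "AE x in lebesgue. f0 x = indicator U x * f x" "(\<lambda>x. indicator U x * f x) \<in> borel_measurable lebesgue"
    "\<And>\<alpha>. integrable lborel (g \<alpha>)" "\<And>\<alpha>. integrable lborel (\<lambda>x. \<bar>g \<alpha> x\<bar> powr p)"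
    "\<And>\<alpha> \<epsilon> z. multi_order \<alpha> \<le> k \<Longrightarrow> \<epsilon> > 0 \<Longrightarrow> cball z (real CARD('n) * \<epsilon>) \<subseteq> U \<Longrightarrow>
      mconv \<epsilon> f0 \<alpha> z = mconv \<epsilon> (g \<alpha>) (\<lambda>_. 0) z"
proof -
  have "f \<in> Lp p U" using f by (simp add: sobolev_def)
  then obtain f0 where f0: "f0 \<in> borel_measurable borel" "integrable lborel f0"
    "integrable lborel (\<lambda>x. \<bar>f0 x\<bar> powr p)" "AE x in lebesgue. f0 x = indicator U x * f x" "(\<lambda>x. indicator U x * f x) \<in> borel_measurable lebesgue"
    by (rule Lp_borel_representative[OF _ U p])
  have "\<forall>\<alpha>. \<exists>g. integrable lborel g \<and> integrable lborel (\<lambda>x. \<bar>g x\<bar> powr p) \<and>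
    (\<forall>\<epsilon> z. multi_order \<alpha> \<le> k \<longrightarrow> \<epsilon> > 0 \<longrightarrow> cball z (real CARD('n) * \<epsilon>) \<subseteq> U \<longrightarrow>
      mconv \<epsilon> f0 \<alpha> z = mconv \<epsilon> g (\<lambda>_. 0) z)"
  proof
    fix \<alpha> :: "'n \<Rightarrow> nat"
    show "\<exists>g. integrable lborel g \<and> integrable lborel (\<lambda>x. \<bar>g x\<bar> powr p) \<and>
    (\<forall>\<epsilon> z. multi_order \<alpha> \<le> k \<longrightarrow> \<epsilon> > 0 \<longrightarrow> cball z (real CARD('n) * \<epsilon>) \<subseteq> U \<longrightarrow>
      mconv \<epsilon> f0 \<alpha> z = mconv \<epsilon> g (\<lambda>_. 0) z)"
    proof (cases "multi_order \<alpha> \<le> k")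
      case True
      then obtain h where h: "h \<in> Lp p U" and wd: "weak_derivative U \<alpha> f h"
        using f by (auto simp: sobolev_def)
      obtain g where g: "g \<in> borel_measurable borel" "integrable lborel g" "integrable lborel (\<lambda>x. \<bar>g x\<bar> powr p)"
        "AE x in lebesgue. g x = indicator U x * h x" "(\<lambda>x. indicator U x * h x) \<in> borel_measurable lebesgue"
        by (rule Lp_borel_representative[OF h U p])
      show ?thesis
        by (intro exI[of _ g] conjI allI impI g(2,3) weak_derivative_mconv[OF wd _ _ f0(1,4,5) g(1,4,5)])
    next
      case False
      \<comment> \<open>For orders above k the zero function keeps the integrability claims valid,
        so that g is a total family indexed by all multi-indices.\<close>
      then show ?thesis by (intro exI[of _ "\<lambda>_. 0"]) simp
    qed
  qed
  from choice[OF this] obtain g where *: "\<forall>\<alpha>. integrable lborel (g \<alpha>) \<and> integrable lborel (\<lambda>x. \<bar>g \<alpha> x\<bar> powr p) \<and>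
    (\<forall>\<epsilon> z. multi_order \<alpha> \<le> k \<longrightarrow> \<epsilon> > 0 \<longrightarrow> cball z (real CARD('n) * \<epsilon>) \<subseteq> U \<longrightarrow>
      mconv \<epsilon> f0 \<alpha> z = mconv \<epsilon> (g \<alpha>) (\<lambda>_. 0) z)" ..
  then have "integrable lborel (g \<alpha>)" "integrable lborel (\<lambda>x. \<bar>g \<alpha> x\<bar> powr p)" for \<alpha> by blast+
  then show thesis by (rule that[OF f0(1,2,4,5)]) (use * in blast)
qed

text \<open>The order of quantifiers matters: r, A and g are chosen before the level t, so that a
  single potential describes all sublevel sets in K. The level enters only through the constant
  \<open>A * t\<close> and the bound M.\<close>

lemma sobolev_loc_approx_value:
  fixes f :: "real ^ 'n::finite \<Rightarrow> real"
  assumes \<Omega>: "open \<Omega>" and f: "f \<in> sobolev_loc (m + 1) p \<Omega>" and m: "0 < m" "m < CARD('n)" and p: "p \<ge> 1"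
    and K: "compact K" "K \<subseteq> \<Omega>"
  obtains r A g where "r > 0" "A > 0" "g \<in> borel_measurable borel" "\<And>y. g y \<ge> 0"
    "integrable lborel (\<lambda>y. g y powr p)"
    "\<And>t. t \<ge> 0 \<Longrightarrow> \<exists>M\<ge>0. \<forall>x\<in>K. potential (real CARD('n) - real m) g x \<le> ennreal t \<longrightarrow>
      (\<exists>a. approx_value f r (A * t) x a \<and> \<bar>a\<bar> \<le> M)"
proof -
  let ?n = "CARD('n)"
  obtain e where e: "e > 0" "(\<Union>x\<in>K. cball x e) \<subseteq> \<Omega>"
    using compact_subset_open_imp_cball_epsilon_subset[OF K(1) \<Omega> K(2)] by blast
  define U where "U = (\<Union>x\<in>K. ball x e)"
  have "compact (\<Union>x\<in>K. cball x e)" by (rule compact_minkowski_sum_cball[OF K(1)])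
  then have cl: "closed (\<Union>x\<in>K. cball x e)" "bounded (\<Union>x\<in>K. cball x e)"
    by (simp_all add: compact_imp_closed compact_imp_bounded)
  have sub: "U \<subseteq> (\<Union>x\<in>K. cball x e)" unfolding U_def by auto
  have U: "open U" "bounded U" "closure U \<subseteq> \<Omega>"
    using bounded_subset[OF cl(2) sub] order_trans[OF closure_minimal[OF sub cl(1)] e(2)]
    by (auto simp: U_def)
  have fU: "f \<in> sobolev (m + 1) p U" using f U by (simp add: sobolev_loc_def)
  obtain f0 g where f0: "f0 \<in> borel_measurable borel" "integrable lborel f0"
    "AE x in lebesgue. f0 x = indicator U x * f x" "(\<lambda>x. indicator U x * f x) \<in> borel_measurable lebesgue"
    and g: "\<And>\<alpha>. integrable lborel (g \<alpha>)" "\<And>\<alpha>. integrable lborel (\<lambda>x. \<bar>g \<alpha> x\<bar> powr p)"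
    and eq: "\<And>\<alpha> \<epsilon> z. multi_order \<alpha> \<le> m + 1 \<Longrightarrow> \<epsilon> > 0 \<Longrightarrow> cball z (real CARD('n) * \<epsilon>) \<subseteq> U \<Longrightarrow>
      mconv \<epsilon> f0 \<alpha> z = mconv \<epsilon> (g \<alpha>) (\<lambda>_. 0) z"
  proof (rule sobolev_representatives[OF fU U(1,2) p], goal_cases)
    case (1 f0 g)
    show thesis by (rule 1(1)[OF 1(2-)])
  qed
  have [measurable]: "g \<alpha> \<in> borel_measurable borel" for \<alpha> using g(1)[of \<alpha>] by auto
  \<comment> \<open>Thirds of e: the oscillation estimate looks as far as 2 r from x, and the
    mollifier, used with n \<epsilon> < r, reaches less than r further, so everything stays within
    distance e of x.\<close>
  define r where "r = e / 3"
  have r: "r > 0" using e by (simp add: r_def)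
  let ?P = "potential (real ?n - real m)"
  define G where "G y = (\<Sum>\<beta> | multi_order \<beta> \<le> m + 1. \<bar>g \<beta> y\<bar>)" for y
  obtain A where A: "A > 0" and A_osc:
    "\<And>(f :: real ^ 'n \<Rightarrow> real) g \<epsilon> x \<rho>. integrable lborel f \<Longrightarrow> (\<And>\<alpha>. integrable lborel (g \<alpha>)) \<Longrightarrow> \<epsilon> > 0 \<Longrightarrow>
      (\<And>\<alpha> z. multi_order \<alpha> \<le> m + 1 \<Longrightarrow> z \<in> ball x (2 * r) \<Longrightarrow> mconv \<epsilon> f \<alpha> z = mconv \<epsilon> (g \<alpha>) (\<lambda>_. 0) z) \<Longrightarrow>
      0 < \<rho> \<Longrightarrow> \<rho> \<le> r \<Longrightarrow>
      (\<integral>\<^sup>+z\<in>ball x \<rho>. ennreal \<bar>mconv \<epsilon> f (\<lambda>_. 0) x - mconv \<epsilon> f (\<lambda>_. 0) z\<bar> \<partial>lborel) \<le>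
        ennreal (\<rho> ^ (?n + 1)) * (ennreal A *
          ?P (\<lambda>y. \<Sum>\<beta> | multi_order \<beta> \<le> m + 1. \<bar>g \<beta> y\<bar>) x)"
  proof (rule mollified_oscillation[OF m r], goal_cases)
    case (1 A)
    show thesis by (rule 1(1)[OF 1(2-)])
  qed
  note osc = A_osc[OF f0(2), of g, OF g(1), folded G_def]
  have [measurable]: "G \<in> borel_measurable borel" unfolding G_def by measurable
  have G0: "G y \<ge> 0" for y unfolding G_def by (intro sum_nonneg) auto
  show thesis
  proof (rule that[OF r A _ G0])
    show "G \<in> borel_measurable borel" by measurable
    let ?S = "{\<beta> :: 'n \<Rightarrow> nat. multi_order \<beta> \<le> m + 1}"
    show "integrable lborel (\<lambda>y. G y powr p)"
    proof (rule Bochner_Integration.integrable_bound)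
      show "integrable lborel (\<lambda>y. real (card ?S) powr p * (\<Sum>\<beta>\<in>?S. \<bar>g \<beta> y\<bar> powr p))"
        using g(2) by (intro integrable_mult_right Bochner_Integration.integrable_sum)
      have "G y powr p \<le> real (card ?S) powr p * (\<Sum>\<beta>\<in>?S. \<bar>g \<beta> y\<bar> powr p)" for y
        unfolding G_def using p by (intro sum_powr_le finite_multi_order_le) auto
      then show "AE y in lborel. norm (G y powr p) \<le> norm (real (card ?S) powr p * (\<Sum>\<beta>\<in>?S. \<bar>g \<beta> y\<bar> powr p))"
        by (intro AE_I2) (simp add: order_trans[OF _ abs_ge_self])
    qed measurable
    fix t :: real assume t: "t \<ge> 0"
    have pos: "measure lborel (ball x r) > 0" for x :: "real ^ 'n"
      using r content_ball_gt_0_iff[of x r] by simp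
    define V where "V = unit_ball_vol (real ?n) * r ^ ?n"
    have V: "measure lborel (ball x r) = V" for x :: "real ^ 'n"
      using r by (simp add: content_ball V_def)
    have V0: "V > 0" using pos[of 0] by (simp add: V)
    \<comment> \<open>Obtained from |a| V <= A t r^(n+1) plus the integral of |f0|, where V is the
      volume of a ball of radius r; this bound is the same for all x.\<close>
    define M where "M = (A * t * r ^ (?n + 1) + (LINT z|lborel. \<bar>f0 z\<bar>)) / V"
    have "M \<ge> 0" unfolding M_def using A t r V0
      by (intro divide_nonneg_nonneg add_nonneg_nonneg mult_nonneg_nonneg integral_nonneg_AE) auto
    moreover have "\<exists>a. approx_value f r (A * t) x a \<and> \<bar>a\<bar> \<le> M" if x: "x \<in> K" and Gx: "?P G x \<le> ennreal t" for x
    proof -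
      have e0: "0 < r / real ?n" using r by simp
      have osc_x: "(\<integral>\<^sup>+z\<in>ball x \<rho>. ennreal \<bar>mconv \<epsilon> f0 (\<lambda>_. 0) x - mconv \<epsilon> f0 (\<lambda>_. 0) z\<bar> \<partial>lborel) \<le> ennreal (A * t * \<rho> ^ (?n + 1))"
        if \<epsilon>: "0 < \<epsilon>" "\<epsilon> < r / real ?n" and \<rho>: "0 < \<rho>" "\<rho> \<le> r" for \<epsilon> \<rho>
      proof -
        have \<epsilon>': "real ?n * \<epsilon> < r" using \<epsilon>(2) by (simp add: field_simps)
        have "(\<integral>\<^sup>+z\<in>ball x \<rho>. ennreal \<bar>mconv \<epsilon> f0 (\<lambda>_. 0) x - mconv \<epsilon> f0 (\<lambda>_. 0) z\<bar> \<partial>lborel) \<le>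
          ennreal (\<rho> ^ (?n + 1)) * (ennreal A * ?P G x)"
        proof (rule osc[OF \<epsilon>(1) _ \<rho>])
          fix \<alpha> :: "'n \<Rightarrow> nat" and z assume \<alpha>: "multi_order \<alpha> \<le> m + 1" and z: "z \<in> ball x (2 * r)"
          have "cball z (real ?n * \<epsilon>) \<subseteq> ball x e"
          proof
            fix y assume "y \<in> cball z (real ?n * \<epsilon>)"
            then have "dist z y < r" using \<epsilon>' by simp
            then have "dist x y < 3 * r" using z dist_triangle[of x y z] by simp
            then show "y \<in> ball x e" by (simp add: r_def)
          qed
          then have "cball z (real ?n * \<epsilon>) \<subseteq> U" using x by (auto simp: U_def)
          then show "mconv \<epsilon> f0 \<alpha> z = mconv \<epsilon> (g \<alpha>) (\<lambda>_. 0) z" by (rule eq[OF \<alpha> \<epsilon>(1)])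
        qed
        also have "\<dots> \<le> ennreal (\<rho> ^ (?n + 1)) * (ennreal A * ennreal t)"
          by (intro mult_left_mono Gx) auto
        also have "\<dots> = ennreal (A * t * \<rho> ^ (?n + 1))"
          using A t \<rho> by (simp add: ennreal_mult[symmetric] ac_simps)
        finally show ?thesis .
      qed
      have At: "0 \<le> A * t" using A t by simp
      have "\<exists>a. \<forall>\<rho> c s. 0 < \<rho> \<longrightarrow> \<rho> \<le> r \<longrightarrow> ball c s \<subseteq> ball x \<rho> \<longrightarrow>
        \<bar>a * measure lborel (ball c s) - (LINT z|lborel. indicator (ball c s) z * f0 z)\<bar> \<le> A * t * \<rho> ^ (?n + 1)"
        (is "\<exists>a. ?Q a")
        by (rule mollified_limit_value[OF f0(2) r e0 osc_x At])
      then obtain a where a: "?Q a" ..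
      have "approx_value f r (A * t) x a"
        unfolding approx_value_def
      proof (intro allI impI)
        fix \<rho> c s assume \<rho>: "0 < \<rho>" "\<rho> \<le> r" and sub: "ball c s \<subseteq> ball x \<rho>"
        have "ball x \<rho> \<subseteq> ball x e" using \<rho> e by (intro subset_ball) (simp add: r_def)
        then have "ball c s \<subseteq> U" using sub x by (auto simp: U_def)
        from set_integral_ball_representative[OF f0(1,3,4) this]
        show "\<bar>a * measure lebesgue (ball c s) - (LINT y:ball c s|lebesgue. f y)\<bar> \<le> A * t * \<rho> ^ (?n + 1)"
          using a[rule_format, OF \<rho> sub] by simp
      qed
      moreover have "\<bar>a\<bar> \<le> M"
      proof -
        let ?J = "LINT z|lborel. indicator (ball x r) z * f0 z"
        have [measurable]: "ball x r \<in> sets borel" by simp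
        have "\<bar>?J\<bar> \<le> (LINT z|lborel. \<bar>indicator (ball x r) z * f0 z\<bar>)" by (rule integral_abs_bound)
        also have "\<dots> \<le> (LINT z|lborel. \<bar>f0 z\<bar>)"
        proof (rule integral_mono)
          show "integrable lborel (\<lambda>z. \<bar>indicator (ball x r) z * f0 z\<bar>)"
            using f0(1,2) by (intro Bochner_Integration.integrable_bound[OF f0(2)]) (auto simp: indicator_def)
        qed (use f0 in \<open>auto simp: indicator_def\<close>)
        finally have "\<bar>a * V\<bar> \<le> A * t * r ^ (?n + 1) + (LINT z|lborel. \<bar>f0 z\<bar>)"
          using a[rule_format, OF r order_refl order_refl] unfolding V by linarith
        then have "\<bar>a\<bar> * V \<le> A * t * r ^ (?n + 1) + (LINT z|lborel. \<bar>f0 z\<bar>)"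
          using V0 by (simp add: abs_mult)
        then show ?thesis unfolding M_def using V0 by (simp add: pos_le_divide_eq)
      qed
      ultimately show ?thesis by blast
    qed
    ultimately show "\<exists>M\<ge>0. \<forall>x\<in>K. ?P G x \<le> ennreal t \<longrightarrow> (\<exists>a. approx_value f r (A * t) x a \<and> \<bar>a\<bar> \<le> M)"
      by blast
  qed
qed

section \<open>Common constants and the sequence of closed sets\<close>

lemma approx_value_mono:
  assumes "approx_value f r A x a" "r' \<le> r" "A \<le> A'"
  shows "approx_value f r' A' x a"
  unfolding approx_value_def
proof (intro allI impI)
  fix \<rho> c s assume \<rho>: "0 < \<rho>" "\<rho> \<le> r'" and "ball c s \<subseteq> ball x \<rho>"
  then have "\<bar>a * measure lebesgue (ball c s) - (LINT y:ball c s|lebesgue. f y)\<bar> \<le> A * \<rho> ^ (CARD('a) + 1)"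
    using assms unfolding approx_value_def by auto
  also have "\<dots> \<le> A' * \<rho> ^ (CARD('a) + 1)"
    using assms(3) \<rho> by (intro mult_right_mono) auto
  finally show "\<bar>a * measure lebesgue (ball c s) - (LINT y:ball c s|lebesgue. f y)\<bar> \<le> A' * \<rho> ^ (CARD('a) + 1)" .
qed

theorem theorem1p3:
  fixes \<Omega> :: "(real ^ 'n::finite) set" and k :: nat and p :: real
    and f :: "real ^ 'n \<Rightarrow> real"
  assumes "open \<Omega>" and "k > 1" and "1 \<le> p" and "(real k - 1) * p < real CARD('n)"
    and "f \<in> sobolev_loc k p \<Omega>"
  shows "\<exists>C :: nat \<Rightarrow> (real ^ 'n) set.
    (\<forall>l\<ge>1. closed (C l) \<and> C l \<subseteq> C (l + 1) \<and> C (l + 1) \<subseteq> \<Omega> \<and>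
      (\<exists>\<Theta>. \<Theta> \<subseteq> C l \<and> riesz_capacity (real k - 1) p \<Theta> = 0 \<and>
        (\<exists>L. L-lipschitz_on (C l - \<Theta>) (precise_rep f)))) \<and>
    riesz_capacity (real k - 1) p (\<Omega> - (\<Union>l\<in>{1..}. C l)) = 0"
proof -
  note p = \<open>1 \<le> p\<close>
  define m where "m = k - 1"
  have k: "k = m + 1" "0 < m" "real k - 1 = real m" using \<open>k > 1\<close> by (auto simp: m_def)
  \<comment> \<open>p >= 1 turns m p < n into m < n, so that the kernel exponent lies strictly
    between 0 and n.\<close>
  have "real m * 1 \<le> real m * p" using p by (intro mult_left_mono) auto
  then have mn: "m < CARD('n)" using assms(4) unfolding k(3) by simp
  define \<gamma> where "\<gamma> = real CARD('n) - real m"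
  obtain K where K: "\<And>j. compact (K j)" "\<And>j. K j \<subseteq> \<Omega>"
    "\<And>j. K j \<subseteq> interior (K (Suc j))" "\<Union> (range K) = \<Omega>"
    "\<And>S. compact S \<Longrightarrow> S \<subseteq> \<Omega> \<Longrightarrow> \<exists>N. \<forall>j\<ge>N. S \<subseteq> K j"
  proof (rule open_Union_compact_subsets[OF \<open>open \<Omega>\<close>], goal_cases)
    case (1 K)
    show thesis by (rule 1(1)[OF 1(2-)])
  qed
  \<comment> \<open>All data attached to \<open>K j\<close> are packed into one predicate, so that
    r, A and g can be chosen for all j simultaneously.\<close>
  define Q where "Q j r A g \<longleftrightarrow> r > 0 \<and> A > 0 \<and> g \<in> borel_measurable borel \<and> (\<forall>y. g y \<ge> 0) \<and>
    integrable lborel (\<lambda>y. g y powr p) \<and>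
    (\<forall>t\<ge>0. \<exists>M\<ge>0. \<forall>x\<in>K j. potential \<gamma> g x \<le> ennreal t \<longrightarrow>
      (\<exists>a. approx_value f r (A * t) x a \<and> \<bar>a\<bar> \<le> M))" for j r A g
  have "\<exists>r A g. Q j r A g" for j
  proof -
    obtain r A g where "r > 0" "A > 0" "g \<in> borel_measurable borel" "\<And>y. g y \<ge> 0"
      "integrable lborel (\<lambda>y. g y powr p)"
      "\<And>t. t \<ge> 0 \<Longrightarrow> \<exists>M\<ge>0. \<forall>x\<in>K j. potential \<gamma> g x \<le> ennreal t \<longrightarrow>
        (\<exists>a. approx_value f r (A * t) x a \<and> \<bar>a\<bar> \<le> M)"
    proof (rule sobolev_loc_approx_value[OF \<open>open \<Omega>\<close> assms(5)[unfolded k(1)] k(2) mn p K(1)[of j] K(2)[of j],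
            folded \<gamma>_def], goal_cases)
      case (1 r A g)
      show thesis by (rule 1(1)[OF 1(2-)])
    qed
    then have "Q j r A g" unfolding Q_def by (intro conjI allI impI)
    then show ?thesis by blast
  qed
  then obtain r A g where Q: "\<And>j. Q j (r j) (A j) (g j)" by metis
  have r: "r j > 0" and A: "A j > 0"
    and g: "g j \<in> borel_measurable borel" "g j y \<ge> 0" "integrable lborel (\<lambda>y. g j y powr p)"
    and ex: "t \<ge> 0 \<Longrightarrow> \<exists>M\<ge>0. \<forall>x\<in>K j. potential \<gamma> (g j) x \<le> ennreal t \<longrightarrow>
      (\<exists>a. approx_value f (r j) (A j * t) x a \<and> \<bar>a\<bar> \<le> M)" for j y t
    using Q[of j] unfolding Q_def by simp_all
  \<comment> \<open>The number of pieces and the level grow together: each \<open>C l\<close> is a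
    finite union, hence closed, and every finite value of a potential eventually falls below the
    level.\<close>
  define C where "C l = (\<Union>j\<in>{..l}. K j \<inter> {x. potential \<gamma> (g j) x \<le> ennreal (real l)})" for l
  have closed: "closed (C l)" for l
  proof -
    have "closed (K j \<inter> {x. potential \<gamma> (g j) x \<le> ennreal (real l)})" for j
      by (rule closed_Int[OF compact_imp_closed[OF K(1)] closed_potential_le[OF g(1)]])
    then show ?thesis unfolding C_def by (intro closed_UN) auto
  qed
  have mono: "C l \<subseteq> C (l + 1)" for l
  proof
    fix x assume "x \<in> C l"
    then obtain j where j: "j \<le> l" "x \<in> K j" "potential \<gamma> (g j) x \<le> ennreal (real l)" by (auto simp: C_def)
    moreover have "ennreal (real l) \<le> ennreal (real (l + 1))" by (intro ennreal_leI) simp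
    ultimately show "x \<in> C (l + 1)" unfolding C_def by (intro UN_I[of j]) (auto intro: order_trans)
  qed
  have sub: "C l \<subseteq> \<Omega>" for l using K(2) by (auto simp: C_def)
  have lip: "\<exists>L. L-lipschitz_on (C l) (precise_rep f)" for l
  proof -
    have "\<exists>M\<ge>0. \<forall>x\<in>K j. potential \<gamma> (g j) x \<le> ennreal (real l) \<longrightarrow>
      (\<exists>a. approx_value f (r j) (A j * real l) x a \<and> \<bar>a\<bar> \<le> M)" for j
      by (rule ex) simp
    then obtain M where *: "\<And>j. M j \<ge> 0 \<and> (\<forall>x\<in>K j. potential \<gamma> (g j) x \<le> ennreal (real l) \<longrightarrow>
      (\<exists>a. approx_value f (r j) (A j * real l) x a \<and> \<bar>a\<bar> \<le> M j))"
      by metis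
    have M: "M j \<ge> 0" "x \<in> K j \<Longrightarrow> potential \<gamma> (g j) x \<le> ennreal (real l) \<Longrightarrow>
      \<exists>a. approx_value f (r j) (A j * real l) x a \<and> \<bar>a\<bar> \<le> M j" for j x
      using *[of j] by simp_all
    \<comment> \<open>Points of different pieces must be compared with each other, so the Lipschitz
      estimate is run once on all of \<open>C l\<close>, with constants valid for every one of the
      finitely many pieces; sums serve as upper bounds for maxima.\<close>
    define r' where "r' = Min (r ` {..l})"
    define A' where "A' = (\<Sum>j\<le>l. A j * real l)"
    define M' where "M' = (\<Sum>j\<le>l. M j)"
    have r': "r' > 0" unfolding r'_def using r by (subst Min_gr_iff) auto
    have A': "A' \<ge> 0" unfolding A'_def using A by (intro sum_nonneg mult_nonneg_nonneg) (auto intro: less_imp_le)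
    have M': "M' \<ge> 0" unfolding M'_def using M by (intro sum_nonneg) auto
    \<comment> \<open>Each piece comes with its own potential and its own value a, but a is always
      \<open>precise_rep f x\<close>; this makes the pieces compatible.\<close>
    have *: "approx_value f r' A' x (precise_rep f x) \<and> \<bar>precise_rep f x\<bar> \<le> M'" if "x \<in> C l" for x
    proof -
      obtain j where j: "j \<le> l" "x \<in> K j" "potential \<gamma> (g j) x \<le> ennreal (real l)" using \<open>x \<in> C l\<close> by (auto simp: C_def)
      obtain a where a: "approx_value f (r j) (A j * real l) x a" "\<bar>a\<bar> \<le> M j" using M(2)[OF j(2,3)] by blast
      have "r' \<le> r j" unfolding r'_def using j by (intro Min_le) auto
      moreover have "A j * real l \<le> A'" unfolding A'_def
        using j A by (intro member_le_sum) (auto intro!: mult_nonneg_nonneg less_imp_le)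
      ultimately have "approx_value f r' A' x a" by (rule approx_value_mono[OF a(1)])
      moreover have "M j \<le> M'" unfolding M'_def using j M(1) by (intro member_le_sum) auto
      ultimately show ?thesis using approx_value_precise_rep[OF a(1) r] a(2) by simp
    qed
    show ?thesis by (rule approx_value_lipschitz[OF _ r' A' _ M']) (use * in auto)
  qed
  have "riesz_capacity (real m) p (\<Omega> - (\<Union>l\<in>{1..}. C l)) = 0"
  proof (rule riesz_capacity_eq_0[OF _ _ p g])
    fix x assume x: "x \<in> \<Omega> - (\<Union>l\<in>{1..}. C l)"
    then obtain j where j: "x \<in> K j" using K(4) by auto
    have "potential \<gamma> (g j) x = \<infinity>"
    proof (rule ccontr)
      assume "potential \<gamma> (g j) x \<noteq> \<infinity>"
      then obtain q where q: "potential \<gamma> (g j) x = ennreal q" "q \<ge> 0"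
        by (cases "potential \<gamma> (g j) x") auto
      \<comment> \<open>The entry j + 1 admits the piece with index j and makes l positive, as the
        union starts at 1; the other entry lifts the level to at least q.\<close>
      define l where "l = max (j + 1) (nat \<lceil>q\<rceil>)"
      have "q \<le> real l" unfolding l_def by linarith
      then have "x \<in> C l" using j q unfolding C_def by (intro UN_I[of j]) (auto simp: l_def intro!: ennreal_leI)
      moreover have "l \<ge> 1" by (simp add: l_def)
      ultimately show False using x by auto
    qed
    then show "\<exists>j. potential (real CARD('n) - real m) (g j) x = \<infinity>" unfolding \<gamma>_def by blast
  qed (use k mn in auto)
  then show ?thesis
    unfolding k(3) using closed mono sub lip riesz_capacity_empty[OF p]
    by (intro exI[of _ C] conjI allI impI exI[of _ "{}"]) auto
qed

end
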